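(* Let $(X,\mu)$ be a connected $d$-partite complex with sites $V$ and let $W$ be an absorbing random walk matrix on $V\cup B$. Suppose that for every $\sigma\in X(d-2)$ we have $\lambda_2(P_\sigma)\leq\sqrt{W(u,v)\cdot W(v,u)}$, where $u,v$ are the two distinct sites of $V\setminus V(\sigma)$. Then for all distinct $u,v\in V$, $$\lambda_2(P_{u,v})\leq\sqrt{\mathbb{W}_{\{u\}}[v\to u]\cdot\mathbb{W}_{\{v\}}[u\to v]}.$$
   Context: A $d$-partite complex $(X,\mu)$: a set $V$ of $d$ sites; each site $v$ has a finite nonempty set $S_v$ of spins (pairwise disjoint; elements written $vs_v$); $X$ is a pure simplicial complex on $\bigcup_vS_v$ whose facets contain exactly one spin from each $S_v$; $\mu$ is a probability distribution on facets, each facet having positive probability. For a face $\tau$: $V(\tau)$ is the set of sites with a spin in $\tau$; $\operatorname{codim}(\tau)=d-|\tau|$; $X(k)$ the faces of size $k$; the link $X_\tau=\{\sigma\setminus\tau:\sigma\supseteq\tau\}$, $X_\tau(k)$ its faces of size $k$. For $\operatorname{codim}(\tau)\ge2$, $G_\tau$ is the weighted graph on $X_\tau(1)$ with edges $X_\tau(2)$, weights $w_\tau(x,y)=\sum_{\text{facets }\omega\supseteq\tau\cup\{x,y\}}\mu(\omega)$; $P_\tau$ its simple random walk matrix; $\lambda_2$ denotes the second largest eigenvalue. $X$ is connected if every such $G_\tau$ is connected. For distinct $u,v\in V$, $G_{u,v}$ is the weighted bipartite graph on $S_u\cup S_v$ with edge weight $\Pr_{\sigma\sim\mu}[us_u,vs_v\in\sigma]$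 between $us_u$ and $vs_v$, and $P_{u,v}$ is its simple random walk matrix. Absorbing random walk: $B$ is a finite set disjoint from $V$, $W\in\mathbb{R}^{(V\cup B)\times(V\cup B)}$ a stochastic matrix such that from every $v\in V$ there is a path $v=x_0,\dots,x_k\in B$ with $W(x_{i-1},x_i)>0$. For $U\subseteq V$, $u,v\in V\cup B$: $\mathbb{W}_U[u\to v]=\sum\prod_{i=1}^\ell W(x_{i-1},x_i)$ over all walks $(x_0,\dots,x_\ell)$, $\ell\ge0$, $x_0=u$, $x_\ell=v$, $x_1,\dots,x_{\ell-1}\notin B\cup U$. *)

theory Defs
  imports
    "HOL-Analysis.Infinite_Sum"
    "HOL-Probability.Probability_Mass_Function"
    "Jordan_Normal_Form.Char_Poly"
begin

text \<open>
  The complex \<open>X\<close> is the set of all its faces (including the empty face).  Purity is part of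
  \<open>facet_spin\<close>, which forces every facet to have exactly \<open>card V\<close> elements.  That \<open>X\<close> is a
  complex \<^emph>\<open>on\<close> the set of spins means that the spins are exactly its vertices; this is also
  what makes all degrees in the bipartite graphs \<open>G\<^sub>u\<^sub>,\<^sub>v\<close> below positive.
\<close>

definition facets :: "'a set set \<Rightarrow> 'a set set" where
  "facets X = {\<omega> \<in> X. \<forall>\<sigma>\<in>X. \<omega> \<subseteq> \<sigma> \<longrightarrow> \<sigma> = \<omega>}"

locale partite_complex =
  fixes V :: "'v set" and S :: "'v \<Rightarrow> 'a set" and X :: "'a set set" and \<mu> :: "'a set pmf"
  assumes finite_sites: "finite V"
    and finite_spins: "v \<in> V \<Longrightarrow> finite (S v)"
    and spins_nonempty: "v \<in> V \<Longrightarrow> S v \<noteq> {}"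
    and spins_disjoint: "disjoint_family_on S V"
    and face_subset: "\<sigma> \<in> X \<Longrightarrow> \<tau> \<subseteq> \<sigma> \<Longrightarrow> \<tau> \<in> X"
    and vertices: "\<Union>X = (\<Union>v\<in>V. S v)"
    and facet_spin: "\<omega> \<in> facets X \<Longrightarrow> v \<in> V \<Longrightarrow> \<exists>!x. x \<in> \<omega> \<inter> S v"
    and support: "set_pmf \<mu> = facets X"

definition sites_of :: "'v set \<Rightarrow> ('v \<Rightarrow> 'a set) \<Rightarrow> 'a set \<Rightarrow> 'v set" where
  "sites_of V S \<tau> = {v \<in> V. \<tau> \<inter> S v \<noteq> {}}"

definition faces :: "'a set set \<Rightarrow> nat \<Rightarrow> 'a set set" where
  "faces X k = {\<tau> \<in> X. card \<tau> = k}"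

definition link :: "'a set set \<Rightarrow> 'a set \<Rightarrow> 'a set set" where
  "link X \<tau> = {\<sigma> - \<tau> |\<sigma>. \<sigma> \<in> X \<and> \<tau> \<subseteq> \<sigma>}"

text \<open>Vertices of \<open>G\<^sub>\<tau>\<close>: a one-element face \<open>{x}\<close> of the link is identified with \<open>x\<close>.\<close>

definition link_vertices :: "'a set set \<Rightarrow> 'a set \<Rightarrow> 'a set" where
  "link_vertices X \<tau> = {x. {x} \<in> faces (link X \<tau>) 1}"

definition link_weight :: "'a set set \<Rightarrow> 'a set pmf \<Rightarrow> 'a set \<Rightarrow> 'a \<Rightarrow> 'a \<Rightarrow> real" where
  "link_weight X \<mu> \<tau> x y =
     (if {x, y} \<in> faces (link X \<tau>) 2
      then \<Sum>\<omega> \<in> {\<omega> \<in> facets X. \<tau> \<union> {x, y} \<subseteq> \<omega>}. pmf \<mu> \<omega> else 0)"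

text \<open>Connectedness of all graphs \<open>G\<^sub>\<tau>\<close> with \<open>\<tau>\<close> of codimension at least \<open>2\<close>.\<close>

definition connected_complex :: "'v set \<Rightarrow> 'a set set \<Rightarrow> bool" where
  "connected_complex V X \<longleftrightarrow>
     (\<forall>\<tau>\<in>X. card \<tau> + 2 \<le> card V \<longrightarrow>
        (\<forall>x \<in> link_vertices X \<tau>. \<forall>y \<in> link_vertices X \<tau>.
           (x, y) \<in> {(a, b). {a, b} \<in> faces (link X \<tau>) 2}\<^sup>*))"

definition pair_vertices :: "('v \<Rightarrow> 'a set) \<Rightarrow> 'v \<Rightarrow> 'v \<Rightarrow> 'a set" where
  "pair_vertices S u v = S u \<union> S v"

definition pair_weight ::
  "('v \<Rightarrow> 'a set) \<Rightarrow> 'a set pmf \<Rightarrow> 'v \<Rightarrow> 'v \<Rightarrow> 'a \<Rightarrow> 'a \<Rightarrow> real" where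
  "pair_weight S \<mu> u v x y =
     (if x \<in> S u \<and> y \<in> S v \<or> x \<in> S v \<and> y \<in> S u
      then measure_pmf.prob \<mu> {\<sigma>. x \<in> \<sigma> \<and> y \<in> \<sigma>} else 0)"

text \<open>Simple random walk matrix of the weighted graph with vertex set \<open>N\<close> and weights \<open>w\<close>.\<close>

definition srw :: "'a set \<Rightarrow> ('a \<Rightarrow> 'a \<Rightarrow> real) \<Rightarrow> 'a \<Rightarrow> 'a \<Rightarrow> real" where
  "srw N w x y = w x y / (\<Sum>z\<in>N. w x z)"

text \<open>
  A matrix with rows and columns indexed by a finite set \<open>N\<close> is turned into a library matrix by an
  enumeration of \<open>N\<close>.  Matrices from different enumerations are conjugate by a permutation matrix,
  so the characteristic polynomial does not depend on the choice.
\<close>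

definition indexed_mat :: "'a set \<Rightarrow> ('a \<Rightarrow> 'a \<Rightarrow> real) \<Rightarrow> real mat" where
  "indexed_mat N P =
     (let e = (SOME e. bij_betw e {..<card N} N)
      in Matrix.mat (card N) (card N) (\<lambda>(i, j). P (e i) (e j)))"

text \<open>
  Real eigenvalues with algebraic multiplicity in descending order.  Random walk matrices of
  weighted undirected graphs are self-adjoint for the degree-weighted inner product, so for them
  these are all the eigenvalues.  \<open>\<lambda>\<^sub>2\<close> is meaningful only if \<open>N\<close> has at least two elements; both
  kinds of graph considered here have at least two vertices.
\<close>

definition eigenvalues :: "real mat \<Rightarrow> real list" where
  "eigenvalues A = rev (sorted_list_of_multiset (proots (char_poly A)))"

definition lambda2 :: "'a set \<Rightarrow> ('a \<Rightarrow> 'a \<Rightarrow> real) \<Rightarrow> real" where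
  "lambda2 N P = eigenvalues (indexed_mat N P) ! 1"

definition lambda2_link :: "'a set set \<Rightarrow> 'a set pmf \<Rightarrow> 'a set \<Rightarrow> real" where
  "lambda2_link X \<mu> \<tau> =
     lambda2 (link_vertices X \<tau>) (srw (link_vertices X \<tau>) (link_weight X \<mu> \<tau>))"

definition lambda2_pair :: "('v \<Rightarrow> 'a set) \<Rightarrow> 'a set pmf \<Rightarrow> 'v \<Rightarrow> 'v \<Rightarrow> real" where
  "lambda2_pair S \<mu> u v =
     lambda2 (pair_vertices S u v) (srw (pair_vertices S u v) (pair_weight S \<mu> u v))"

locale absorbing_walk =
  fixes V B :: "'v set" and W :: "'v \<Rightarrow> 'v \<Rightarrow> real"
  assumes finite_absorbing: "finite B"
    and disjoint: "V \<inter> B = {}"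
    and nonneg: "x \<in> V \<union> B \<Longrightarrow> y \<in> V \<union> B \<Longrightarrow> 0 \<le> W x y"
    and row_sum: "x \<in> V \<union> B \<Longrightarrow> (\<Sum>y\<in>V \<union> B. W x y) = 1"
    and absorbed: "v \<in> V \<Longrightarrow>
      \<exists>b\<in>B. (v, b) \<in> {(x, y). x \<in> V \<union> B \<and> y \<in> V \<union> B \<and> 0 < W x y}\<^sup>*"

text \<open>
  A walk \<open>(x\<^sub>0, \<dots>, x\<^sub>\<ell>)\<close> is the list of its \<open>\<ell> + 1\<close> vertices; in particular \<open>[u]\<close> is the
  walk of length \<open>0\<close> from \<open>u\<close> to \<open>u\<close>, with weight \<open>1\<close>.
\<close>

definition walks :: "'v set \<Rightarrow> 'v set \<Rightarrow> 'v set \<Rightarrow> 'v \<Rightarrow> 'v \<Rightarrow> 'v list set" where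
  "walks V B U u v =
     {xs. xs \<noteq> [] \<and> hd xs = u \<and> last xs = v \<and> set xs \<subseteq> V \<union> B \<and>
          (\<forall>i. 0 < i \<and> i < length xs - 1 \<longrightarrow> xs ! i \<notin> B \<union> U)}"

definition walk_weight :: "('v \<Rightarrow> 'v \<Rightarrow> real) \<Rightarrow> 'v list \<Rightarrow> real" where
  "walk_weight W xs = (\<Prod>i<length xs - 1. W (xs ! i) (xs ! Suc i))"

text \<open>
  For an absorbing walk the sum converges absolutely: the interior vertices lie in \<open>V - U\<close>, and
  the restriction of \<open>W\<close> to \<open>V - U\<close> has spectral radius less than \<open>1\<close>.  Hence the default value
  of \<^const>\<open>infsum\<close> for divergent sums plays no role.
\<close>

definition hit :: "'v set \<Rightarrow> 'v set \<Rightarrow> ('v \<Rightarrow> 'v \<Rightarrow> real) \<Rightarrow> 'v set \<Rightarrow> 'v \<Rightarrow> 'v \<Rightarrow> real" where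
  "hit V B W U u v = (\<Sum>\<^sub>\<infinity>xs\<in>walks V B U u v. walk_weight W xs)"

end

theory Submission
  imports Defs
begin

text \<open>
  The eigenvalue \<open>\<lambda>\<^sub>2\<close> of a bipartite walk is the maximal correlation of mean-zero functions of the
  two spins.  Dually, normalising the Green function \<open>(I - W\<^sub>U)\<^sup>-\<^sup>1\<close> of the walk killed outside a set
  \<open>U\<close> of sites gives numbers \<open>r\<^sub>U(u, v)\<close> in \<open>[0, 1)\<close>, whose square is the product of the two hitting
  probabilities, and passing from \<open>U\<close> to \<open>U - {w}\<close> turns them into partial correlations given \<open>w\<close>.
  By induction on \<open>U\<close>, the maximal correlation \<open>\<rho>(u, v)\<close> in a link with free sites \<open>U\<close> is at most
  \<open>r\<^sub>U(u, v)\<close>.  Conditioning on the spin at a third site \<open>w\<close> bounds \<open>\<rho>(u, v)\<close> by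
  \<open>s t + r\<^sub>U\<^sub>-\<^sub>w(u, v) \<surd>(1 - s\<^sup>2) \<surd>(1 - t\<^sup>2)\<close> with \<open>s \<le> \<rho>(u, w)\<close> and \<open>t \<le> \<rho>(v, w)\<close>.  Connectedness gives
  \<open>\<rho> < 1\<close>, and at the pair minimising \<open>(1 - \<rho>) / (1 - r)\<close> a ratio below \<open>1\<close> would contradict this
  bound, because scaling all distances \<open>1 - r\<close> by a common factor below \<open>1\<close> strictly increases
  partial correlations.
\<close>

section \<open>Triangles of correlations\<close>

text \<open>The obstacle is circularity. Pinning a spin at w lowers the number of free sites only
  for the conditional correlation. The numbers \<rho>(u, w) and \<rho>(v, w) in the bound for
  \<rho>(u, v) belong to the same face, so the induction hypothesis says nothing about them. Hence
  all pairs of free sites are treated at once, through the family r \<mapsto> 1 - t (1 - r). At t =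
  0 all correlations are 1 and the third-site bound holds with equality, so this bound alone cannot
  suffice: t > 0, that is \<rho> < 1, has to come from connectedness. Moreover s s' + b sqrt(1 -
  s^2) sqrt(1 - s'^2) is not monotone in s and s', for which only upper estimates are known. It is
  under control up to the values needed because r(u, w) r(w, v) stays below r(u, v). This
  multiplicative triangle inequality expresses that partial correlations are nonnegative, and it
  survives the shrinking of distances.\<close>

text \<open>Weighted AM-GM, tight at \<open>(a0, c0)\<close>, bounds both products by an expression linear in \<open>a\<^sup>2\<close> and
  \<open>c\<^sup>2\<close>; the last two assumptions say that its coefficients are nonnegative.\<close>

lemma angle_bound_monotone:
  fixes a c a0 c0 b :: real
  assumes "0 \<le> a" "a \<le> a0" "a0 < 1" "0 < a0" "0 \<le> c" "c \<le> c0" "c0 < 1" "0 < c0" "0 \<le> b"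
    and foot1: "b * a0 * sqrt (1 - c0\<^sup>2) \<le> c0 * sqrt (1 - a0\<^sup>2)"
    and foot2: "b * c0 * sqrt (1 - a0\<^sup>2) \<le> a0 * sqrt (1 - c0\<^sup>2)"
  shows "a * c + b * (sqrt (1 - a\<^sup>2) * sqrt (1 - c\<^sup>2))
       \<le> a0 * c0 + b * (sqrt (1 - a0\<^sup>2) * sqrt (1 - c0\<^sup>2))"
proof -
  define A where "A = sqrt (1 - a0\<^sup>2)"
  define C where "C = sqrt (1 - c0\<^sup>2)"
  have sq: "a0\<^sup>2 < 1" "c0\<^sup>2 < 1" "a\<^sup>2 \<le> a0\<^sup>2" "c\<^sup>2 \<le> c0\<^sup>2"
    using assms by (auto simp: power_less_one_iff abs_square_less_1 intro: power_mono)
  have AC: "A > 0" "C > 0" "A\<^sup>2 = 1 - a0\<^sup>2" "C\<^sup>2 = 1 - c0\<^sup>2"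
    using sq by (auto simp: A_def C_def)
  define \<kappa> where "\<kappa> = c0 / a0"
  define l where "l = C / A"
  have pos: "\<kappa> > 0" "l > 0" using assms AC by (auto simp: \<kappa>_def l_def)
  have amgm: "x * y \<le> (k * x\<^sup>2 + y\<^sup>2 / k) / 2" if "k > 0" for x y k :: real
  proof -
    have "0 \<le> (k * x - y)\<^sup>2 / k" using that by simp
    also have "\<dots> = k * x\<^sup>2 + y\<^sup>2 / k - 2 * (x * y)"
      using that by (simp add: power2_eq_square field_simps)
    finally show ?thesis by simp
  qed
  have s1: "(sqrt (1 - a\<^sup>2))\<^sup>2 = 1 - a\<^sup>2" "(sqrt (1 - c\<^sup>2))\<^sup>2 = 1 - c\<^sup>2" using sq by auto
  have "a * c + b * (sqrt (1 - a\<^sup>2) * sqrt (1 - c\<^sup>2))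
      \<le> (\<kappa> * a\<^sup>2 + c\<^sup>2 / \<kappa>) / 2 + b * ((l * (1 - a\<^sup>2) + (1 - c\<^sup>2) / l) / 2)"
    using amgm[OF pos(1), of a c] amgm[OF pos(2), of "sqrt (1 - a\<^sup>2)" "sqrt (1 - c\<^sup>2)"]
      \<open>0 \<le> b\<close> by (intro add_mono mult_left_mono) (auto simp: s1)
  also have "\<dots> = ((\<kappa> - b * l) * a\<^sup>2 + (1 / \<kappa> - b / l) * c\<^sup>2 + b * (l + 1 / l)) / 2"
    by (simp add: algebra_simps add_divide_distrib diff_divide_distrib)
  also have "\<dots> \<le> ((\<kappa> - b * l) * a0\<^sup>2 + (1 / \<kappa> - b / l) * c0\<^sup>2 + b * (l + 1 / l)) / 2"
  proof -
    have "\<kappa> - b * l \<ge> 0" using foot1 assms AC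
      by (simp add: \<kappa>_def l_def A_def[symmetric] C_def[symmetric] field_simps)
    moreover have "1 / \<kappa> - b / l \<ge> 0" using foot2 assms AC
      by (simp add: \<kappa>_def l_def A_def[symmetric] C_def[symmetric] field_simps)
    ultimately show ?thesis using sq by (intro divide_right_mono add_right_mono add_mono mult_left_mono) auto
  qed
  also have "\<dots> = (\<kappa> * a0\<^sup>2 + c0\<^sup>2 / \<kappa>) / 2 + b * ((l * A\<^sup>2 + C\<^sup>2 / l) / 2)"
    by (simp add: AC algebra_simps add_divide_distrib diff_divide_distrib)
  also have "\<dots> = a0 * c0 + b * (A * C)"
    using assms AC(1,2) by (simp add: \<kappa>_def l_def power2_eq_square field_simps)
  finally show ?thesis by (simp add: A_def C_def)
qed

text \<open>In terms of \<open>\<alpha> = 1 - p\<close>, \<open>\<beta> = 1 - q\<close>, \<open>\<gamma> = 1 - r\<close>: the partial correlation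
  \<open>(\<alpha> + \<beta> - \<gamma> - t \<alpha> \<beta>) / \<surd>(\<alpha> \<beta> (2 - t \<alpha>) (2 - t \<beta>))\<close> of the triangle shrunk by \<open>t\<close> is
  decreasing in \<open>t\<close>.\<close>

lemma shrunk_triangle_aux:
  fixes \<alpha> \<beta> \<gamma> t b :: real
  assumes "0 < \<alpha>" "\<alpha> \<le> \<beta>" "\<beta> \<le> 1" "0 < \<gamma>" "\<gamma> \<le> 1" "0 < t" "t < 1" "0 \<le> b"
    and acute: "\<beta> < \<alpha> + \<gamma>"
    and b: "b * (sqrt (2 - \<alpha>) * sqrt (2 - \<beta>)) * sqrt (\<alpha> * \<beta>) \<le> \<alpha> + \<beta> - \<gamma> - \<alpha> * \<beta>"
  shows "b * (sqrt (2 - t * \<alpha>) * sqrt (2 - t * \<beta>)) * sqrt (\<alpha> * \<beta>) < \<alpha> + \<beta> - \<gamma> - t * \<alpha> * \<beta>"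
proof -
  define N where "N s = \<alpha> + \<beta> - \<gamma> - s * (\<alpha> * \<beta>)" for s
  define R where "R s = sqrt (2 - s * \<alpha>) * sqrt (2 - s * \<beta>)" for s
  have lt1: "t * x < 1" if "x \<le> 1" for x
  proof -
    have "t * x \<le> t * 1" using that assms by (intro mult_left_mono) auto
    then show ?thesis using \<open>t < 1\<close> by linarith
  qed
  have ta: "t * \<alpha> < 1" "t * \<beta> < 1" using assms by (auto intro!: lt1)
  have "0 \<le> b * (sqrt (2 - \<alpha>) * sqrt (2 - \<beta>)) * sqrt (\<alpha> * \<beta>)"
    using assms by (intro mult_nonneg_nonneg) auto
  then have N1: "0 \<le> N 1" using b by (simp add: N_def)
  have Npos: "N t > N 1" using assms unfolding N_def by simp
  show ?thesis
  proof (cases "N 1 = 0")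
    case True
    \<comment> \<open>A vanishing right-hand side at parameter 1 forces b = 0; the claim is then
      just N t > N 1.\<close>
    define z where "z = sqrt (2 - \<alpha>) * sqrt (2 - \<beta>) * sqrt (\<alpha> * \<beta>)"
    have "b * z \<le> 0" using b True by (simp add: N_def z_def mult.assoc)
    moreover have "z > 0" using assms by (simp add: z_def)
    ultimately have "b = 0" using \<open>0 \<le> b\<close> by (simp add: mult_le_0_iff)
    then show ?thesis using Npos True by (simp add: N_def mult.assoc)
  next
    case False
    then have N1: "0 < N 1" using N1 by simp
    have Rpos: "R t > 0" "R 1 > 0" using ta assms by (auto simp: R_def)
    \<comment> \<open>The quotient N s / (2 - s \<beta>) is larger at t than at 1; this is where
      \<open>acute\<close> enters. After squaring N 1 * R t < N t * R 1, what remains is (2 -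
      \<beta>) (2 - t \<alpha>) \<le> (2 - \<alpha>) (2 - t \<beta>), which uses \<alpha> \<le>
      \<beta>.\<close>
    have key: "N 1 * (2 - t * \<beta>) < N t * (2 - \<beta>)"
    proof -
      have "N t * (2 - \<beta>) - N 1 * (2 - t * \<beta>) = (1 - t) * \<beta> * (2 * \<alpha> - (\<alpha> + \<beta> - \<gamma>))"
        unfolding N_def by (simp add: algebra_simps)
      also have "\<dots> > 0" using assms by simp
      finally show ?thesis by simp
    qed
    have Req: "(R s)\<^sup>2 = (2 - s * \<alpha>) * (2 - s * \<beta>)" if "s * \<alpha> \<le> 1" "s * \<beta> \<le> 1" for s
      using that by (simp add: R_def power_mult_distrib)
    have "N 1 * R t < N t * R 1"
    proof (rule power2_less_imp_less)
      have "(N 1 * R t)\<^sup>2 = (N 1)\<^sup>2 * ((2 - t * \<alpha>) * (2 - t * \<beta>))"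
        using Req[of t] ta by (simp add: power_mult_distrib)
      also have "\<dots> * (2 - t * \<beta>) = (N 1 * (2 - t * \<beta>))\<^sup>2 * (2 - t * \<alpha>)"
        by (simp add: power2_eq_square)
      also have "\<dots> < (N t * (2 - \<beta>))\<^sup>2 * (2 - t * \<alpha>)"
        using key N1 ta by (intro mult_strict_right_mono power_strict_mono) auto
      also have "\<dots> = (N t)\<^sup>2 * (2 - \<beta>) * ((2 - \<beta>) * (2 - t * \<alpha>))"
        by (simp add: power2_eq_square)
      also have "\<dots> \<le> (N t)\<^sup>2 * (2 - \<beta>) * ((2 - \<alpha>) * (2 - t * \<beta>))"
      proof (intro mult_left_mono)
        have "(2 - \<alpha>) * (2 - t * \<beta>) - (2 - \<beta>) * (2 - t * \<alpha>) = 2 * (1 - t) * (\<beta> - \<alpha>)"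
          by (simp add: algebra_simps)
        also have "\<dots> \<ge> 0" using assms by simp
        finally show "(2 - \<beta>) * (2 - t * \<alpha>) \<le> (2 - \<alpha>) * (2 - t * \<beta>)" by simp
      qed (use assms in auto)
      also have "\<dots> = (N t * R 1)\<^sup>2 * (2 - t * \<beta>)"
        using Req[of 1] assms by (simp add: power_mult_distrib)
      finally show "(N 1 * R t)\<^sup>2 < (N t * R 1)\<^sup>2"
        using ta by (smt (verit) mult_le_cancel_right)
      show "0 \<le> N t * R 1" using Npos N1 Rpos by simp
    qed
    moreover have "b * R 1 * sqrt (\<alpha> * \<beta>) \<le> N 1" using b by (simp add: R_def N_def)
    ultimately have "b * R 1 * sqrt (\<alpha> * \<beta>) * R t < N t * R 1"
      using Rpos by (smt (verit) mult_right_mono)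
    then have "(b * R t * sqrt (\<alpha> * \<beta>)) * R 1 < N t * R 1" by (simp add: mult_ac)
    then have "b * R t * sqrt (\<alpha> * \<beta>) < N t" using Rpos by simp
    then show ?thesis by (simp add: R_def N_def mult.assoc)
  qed
qed

text \<open>Since (1 - p) (1 - r) > 0, the multiplicative inequality p r \<le> q becomes the strict
  triangle inequality \<beta> < \<alpha> + \<gamma> between distances, and likewise with p and q
  exchanged. Each square root contributes a factor sqrt t, so t cancels and the auxiliary lemma
  applies to the ordered pair of \<alpha> and \<beta>.\<close>

lemma shrunk_triangle:
  fixes p q r t b :: real
  assumes "0 \<le> p" "p < 1" "0 \<le> q" "q < 1" "0 \<le> r" "r < 1" "p * r \<le> q" "q * r \<le> p"
    and "0 < t" "t < 1" "0 \<le> b"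
    and b: "b * (sqrt (1 - p\<^sup>2) * sqrt (1 - q\<^sup>2)) + p * q \<le> r"
  defines "f \<equiv> \<lambda>x. 1 - t * (1 - x)"
  shows "b * (sqrt (1 - (f p)\<^sup>2) * sqrt (1 - (f q)\<^sup>2)) + f p * f q < f r"
proof -
  define \<alpha> \<beta> \<gamma> where d: "\<alpha> = 1 - p" "\<beta> = 1 - q" "\<gamma> = 1 - r"
  have gen: "sqrt (1 - (1 - s * x)\<^sup>2) = sqrt s * sqrt x * sqrt (2 - s * x)" for s x :: real
    by (simp flip: real_sqrt_mult) (simp add: power2_eq_square algebra_simps)
  have ineq: "0 < \<alpha>" "\<alpha> \<le> 1" "0 < \<beta>" "\<beta> \<le> 1" "0 < \<gamma>" "\<gamma> \<le> 1"
    using assms d by auto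
  have "(1 - p) * (1 - r) > 0" "(1 - q) * (1 - r) > 0" using assms by auto
  then have ac: "\<beta> < \<alpha> + \<gamma>" "\<alpha> < \<beta> + \<gamma>" using assms d by (auto simp: algebra_simps)
  have b1: "b * (sqrt (2 - \<alpha>) * sqrt (2 - \<beta>)) * sqrt (\<alpha> * \<beta>) \<le> \<alpha> + \<beta> - \<gamma> - \<alpha> * \<beta>"
  proof -
    have "sqrt (1 - p\<^sup>2) = sqrt \<alpha> * sqrt (2 - \<alpha>)" "sqrt (1 - q\<^sup>2) = sqrt \<beta> * sqrt (2 - \<beta>)"
      using gen[of 1 \<alpha>] gen[of 1 \<beta>] by (simp_all add: d)
    then have "b * (sqrt (2 - \<alpha>) * sqrt (2 - \<beta>)) * sqrt (\<alpha> * \<beta>) \<le> r - p * q"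
      using b by (simp add: real_sqrt_mult mult_ac)
    also have "r - p * q = \<alpha> + \<beta> - \<gamma> - \<alpha> * \<beta>" by (simp add: d algebra_simps)
    finally show ?thesis .
  qed
  have "b * (sqrt (2 - t * \<alpha>) * sqrt (2 - t * \<beta>)) * sqrt (\<alpha> * \<beta>) < \<alpha> + \<beta> - \<gamma> - t * \<alpha> * \<beta>"
  proof (cases "\<alpha> \<le> \<beta>")
    case True
    show ?thesis by (rule shrunk_triangle_aux) (use True ineq ac assms b1 in auto)
  next
    case False
    have "b * (sqrt (2 - t * \<beta>) * sqrt (2 - t * \<alpha>)) * sqrt (\<beta> * \<alpha>) < \<beta> + \<alpha> - \<gamma> - t * \<beta> * \<alpha>"
      by (rule shrunk_triangle_aux) (use False ineq ac assms b1 in \<open>auto simp: mult_ac add_ac\<close>)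
    then show ?thesis by (simp add: mult_ac add_ac)
  qed
  then have "t * (b * (sqrt (2 - t * \<alpha>) * sqrt (2 - t * \<beta>)) * sqrt (\<alpha> * \<beta>))
      < t * (\<alpha> + \<beta> - \<gamma> - t * \<alpha> * \<beta>)"
    using assms by simp
  moreover have "b * (sqrt (1 - (f p)\<^sup>2) * sqrt (1 - (f q)\<^sup>2))
      = (sqrt t * sqrt t) * (b * (sqrt (2 - t * \<alpha>) * sqrt (2 - t * \<beta>)) * sqrt (\<alpha> * \<beta>))"
    using gen[of t \<alpha>] gen[of t \<beta>] by (simp add: f_def d real_sqrt_mult mult_ac del: real_sqrt_mult_self)
  moreover have "sqrt t * sqrt t = t" using assms by simp
  ultimately have "b * (sqrt (1 - (f p)\<^sup>2) * sqrt (1 - (f q)\<^sup>2)) < t * (\<alpha> + \<beta> - \<gamma> - t * \<alpha> * \<beta>)"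
    by metis
  moreover have "f r - f p * f q = t * (\<alpha> + \<beta> - \<gamma> - t * \<alpha> * \<beta>)"
    by (simp add: f_def d algebra_simps)
  ultimately show ?thesis by simp
qed

text \<open>The form used in the induction, where a and c are only known to lie below the shrunk
  correlations. They are first raised to these values by \<open>angle_bound_monotone\<close>, and
  then \<open>shrunk_triangle\<close> gives strictness.\<close>

lemma triangle_trickle_down:
  fixes p q r t b a c :: real
  assumes "0 \<le> p" "p < 1" "0 \<le> q" "q < 1" "0 \<le> r" "r < 1" "p * r \<le> q" "q * r \<le> p"
    and "0 < t" "t < 1" "0 \<le> b"
    and b: "b * (sqrt (1 - p\<^sup>2) * sqrt (1 - q\<^sup>2)) + p * q \<le> r"
    and "0 \<le> a" "a \<le> 1 - t * (1 - p)" "0 \<le> c" "c \<le> 1 - t * (1 - q)"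
  shows "a * c + b * (sqrt (1 - a\<^sup>2) * sqrt (1 - c\<^sup>2)) < 1 - t * (1 - r)"
proof -
  define f where "f x = 1 - t * (1 - x)" for x
  have main: "b * (sqrt (1 - (f p)\<^sup>2) * sqrt (1 - (f q)\<^sup>2)) + f p * f q < f r"
    unfolding f_def by (rule shrunk_triangle) (use assms in auto)
  have f01: "0 < f x" "f x < 1" if "0 \<le> x" "x < 1" for x
  proof -
    have "t * (1 - x) \<le> t * 1" using that assms by (intro mult_left_mono) auto
    then show "0 < f x" unfolding f_def using assms(10) by linarith
    show "f x < 1" using that assms by (simp add: f_def)
  qed
  have mult: "f x * f z \<le> f y" if "x * z \<le> y" "x < 1" "z < 1" for x y z
  proof -
    have "f y - f x * f z = t * (y - x * z) + t * (1 - t) * ((1 - x) * (1 - z))"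
      by (simp add: f_def algebra_simps)
    also have "\<dots> \<ge> 0" using that assms by (intro add_nonneg_nonneg mult_nonneg_nonneg) auto
    finally show ?thesis by simp
  qed
  \<comment> \<open>Up to a positive factor, this says that the bound has nonnegative derivative in
    its first variable at (f x, f y). It results from multiplying \<open>m\<close> by f x and using
    f x * f r \<le> f y, the shrunk form of x * r \<le> y.\<close>
  have foot: "b * f x * sqrt (1 - (f y)\<^sup>2) \<le> f y * sqrt (1 - (f x)\<^sup>2)"
    if x: "0 \<le> x" "x < 1" and y: "0 \<le> y" "y < 1" and xy: "x * r \<le> y"
      and m: "b * (sqrt (1 - (f x)\<^sup>2) * sqrt (1 - (f y)\<^sup>2)) + f x * f y < f r" for x y
  proof -
    define Y where "Y = sqrt (1 - (f x)\<^sup>2)"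
    have "(f x)\<^sup>2 < 1" using f01[OF x] by (simp add: abs_square_less_1)
    then have Y: "Y > 0" "Y * Y = 1 - f x * f x" by (auto simp: Y_def simp flip: power2_eq_square)
    have "f x * (b * (Y * sqrt (1 - (f y)\<^sup>2))) \<le> f x * (f r - f x * f y)"
      using m f01[OF x] by (intro mult_left_mono) (auto simp: Y_def)
    also have "\<dots> \<le> f y - f x * f x * f y" using mult[OF xy] x assms by (simp add: algebra_simps)
    also have "\<dots> = f y * (Y * Y)" by (simp add: Y algebra_simps)
    finally have "(b * f x * sqrt (1 - (f y)\<^sup>2)) * Y \<le> (f y * Y) * Y" by (simp add: mult_ac)
    then show ?thesis using Y by (simp add: Y_def)
  qed
  have "a * c + b * (sqrt (1 - a\<^sup>2) * sqrt (1 - c\<^sup>2))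
     \<le> f p * f q + b * (sqrt (1 - (f p)\<^sup>2) * sqrt (1 - (f q)\<^sup>2))"
    by (rule angle_bound_monotone)
      (use assms f01[of p] f01[of q] foot[of p q] foot[of q p] main in \<open>auto simp: f_def mult_ac\<close>)
  also have "\<dots> < f r" using main by simp
  finally show ?thesis by (simp add: f_def)
qed

section \<open>Hitting probabilities of the absorbing walk\<close>

lemma walk_weight_Cons: "ys \<noteq> [] \<Longrightarrow> walk_weight W (x # ys) = W x (hd ys) * walk_weight W ys"
proof -
  assume "ys \<noteq> []"
  then obtain n where n: "length ys = Suc n" by (cases ys) auto
  show ?thesis
    unfolding walk_weight_def using \<open>ys \<noteq> []\<close>
    by (simp add: n prod.lessThan_Suc_shift hd_conv_nth del: prod.lessThan_Suc)
qed

text \<open>First-step decomposition: the second vertex is either the endpoint v or an interior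
  vertex, hence in V - {v}. The condition x \<noteq> v excludes the walk of length 0.\<close>

lemma walks_loopfree_eq:
  assumes "x \<in> V" "v \<in> V" "x \<noteq> v" "V \<inter> B = {}"
  shows "walks V B {v} x v
       = insert [x, v] (\<Union>y\<in>V - {v}. (#) x ` walks V B {v} y v)"  (is "?L = ?R")
proof (intro equalityI subsetI)
  fix xs assume xs: "xs \<in> ?L"
  then obtain ys where ys: "xs = x # ys" by (cases xs) (auto simp: walks_def)
  have "ys \<noteq> []" using xs ys assms by (auto simp: walks_def)
  then obtain y zs where yz: "ys = y # zs" by (cases ys) auto
  have int: "xs ! i \<notin> B \<union> {v}" if "0 < i" "i < length xs - 1" for i
    using xs that by (auto simp: walks_def)
  show "xs \<in> ?R"
  proof (cases "zs = []")
    case True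
    then show ?thesis using xs ys yz by (auto simp: walks_def)
  next
    case False
    have "y \<in> V - {v}" using int[of 1] False xs ys yz by (auto simp: walks_def)
    moreover have "ys \<in> walks V B {v} y v"
      using xs int[of "Suc i" for i] ys yz by (auto simp: walks_def)
    ultimately show ?thesis using ys by blast
  qed
next
  fix xs assume "xs \<in> ?R"
  then consider "xs = [x, v]" | y ys where "y \<in> V - {v}" "ys \<in> walks V B {v} y v" "xs = x # ys"
    by blast
  then show "xs \<in> ?L"
  proof cases
    case 1 then show ?thesis using assms by (auto simp: walks_def)
  next
    case 2
    have "xs ! i \<notin> B \<union> {v}" if "0 < i" "i < length xs - 1" for i
    proof (cases "i = 1")
      case True
      then show ?thesis using 2 assms by (auto simp: walks_def hd_conv_nth)
    next
      case False
      then obtain j where "i = Suc j" "0 < j" using \<open>0 < i\<close> by (cases i) auto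
      then show ?thesis using 2 that by (auto simp: walks_def)
    qed
    then show ?thesis using 2 assms by (auto simp: walks_def)
  qed
qed

context absorbing_walk
begin

text \<open>A sum over an infinite set has the default value 0, which contradicts a row sum of
  1.\<close>

lemma finite_states: "V \<noteq> {} \<Longrightarrow> finite (V \<union> B)"
  using row_sum sum.infinite by (metis Un_iff ex_in_conv zero_neq_one)

text \<open>At a state attaining a positive maximum, the averaging inequality forces every successor
  of positive probability to attain it too. Following a path to B reaches an absorbing state with
  positive value, which the first premise forbids.\<close>

lemma max_principle:
  assumes "\<And>x. x \<in> V \<union> B \<Longrightarrow> 0 < f x \<Longrightarrow> x \<in> V \<and> f x \<le> (\<Sum>y\<in>V \<union> B. W x y * f y)"
    and x: "x \<in> V \<union> B"
  shows "f x \<le> 0"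
proof (rule ccontr)
  assume pos: "\<not> f x \<le> 0"
  then have "x \<in> V" using assms(1)[OF x] by auto
  then have fin: "finite (V \<union> B)" using finite_states by auto
  define M where "M = Max (f ` (V \<union> B))"
  have le: "f y \<le> M" if "y \<in> V \<union> B" for y using that fin by (simp add: M_def)
  have Mpos: "M > 0" using le[OF x] pos by simp
  obtain z where z: "z \<in> V \<union> B" "f z = M"
    using Max_in[of "f ` (V \<union> B)"] fin x unfolding M_def by fastforce
  have step: "f b = M" if a: "a \<in> V \<union> B" "f a = M" and b: "b \<in> V \<union> B" "0 < W a b" for a b
  proof (rule ccontr)
    assume "f b \<noteq> M"
    then have lt: "W a b * f b < W a b * M" using le[OF b(1)] b by simp
    have "(\<Sum>y\<in>V \<union> B. W a y * f y) < (\<Sum>y\<in>V \<union> B. W a y * M)"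
    proof (rule sum_strict_mono_ex1[OF fin])
      show "\<forall>y\<in>V \<union> B. W a y * f y \<le> W a y * M"
        using le nonneg[OF a(1)] by (auto intro!: mult_left_mono)
      show "\<exists>y\<in>V \<union> B. W a y * f y < W a y * M" using lt b(1) by blast
    qed
    also have "\<dots> = M" using row_sum[OF a(1)] by (simp flip: sum_distrib_right)
    finally show False using assms(1)[OF a(1)] a Mpos by simp
  qed
  have "z \<in> V" using assms(1)[OF z(1)] z Mpos by simp
  then obtain b where b: "b \<in> B" "(z, b) \<in> {(x, y). x \<in> V \<union> B \<and> y \<in> V \<union> B \<and> 0 < W x y}\<^sup>*"
    using absorbed by blast
  from b(2) have "f b = M \<and> b \<in> V \<union> B"
    by (induction rule: rtrancl_induct) (use z step in auto)
  then show False using assms(1)[of b] b disjoint Mpos by auto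
qed

text \<open>Declaring the sites outside U absorbing leaves W unchanged. The theory of hitting
  probabilities thus applies to the walk killed on leaving U, as needed for a link with free sites
  U.\<close>

lemma restrict: "U \<subseteq> V \<Longrightarrow> finite V \<Longrightarrow> absorbing_walk U (B \<union> (V - U)) W"
proof
  assume U: "U \<subseteq> V" "finite V"
  have eq: "U \<union> (B \<union> (V - U)) = V \<union> B" using U by auto
  show "finite (B \<union> (V - U))" using U finite_absorbing by auto
  show "U \<inter> (B \<union> (V - U)) = {}" using U disjoint by auto
  show "0 \<le> W x y" if "x \<in> U \<union> (B \<union> (V - U))" "y \<in> U \<union> (B \<union> (V - U))" for x y
    using that nonneg unfolding eq by simp
  show "(\<Sum>y\<in>U \<union> (B \<union> (V - U)). W x y) = 1" if "x \<in> U \<union> (B \<union> (V - U))" for x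
    using that row_sum unfolding eq by simp
  show "\<exists>b\<in>B \<union> (V - U). (v, b) \<in> {(x, y). x \<in> U \<union> (B \<union> (V - U)) \<and> y \<in> U \<union> (B \<union> (V - U)) \<and> 0 < W x y}\<^sup>*"
    if "v \<in> U" for v
    using that absorbed U unfolding eq by blast
qed

section \<open>Convergence of the sums over walks and the first-step equation\<close>

lemma walk_weight_nonneg: "xs \<in> walks V B C u v \<Longrightarrow> 0 \<le> walk_weight W xs"
  unfolding walk_weight_def
  by (intro prod_nonneg ballI nonneg) (auto simp: walks_def subset_iff)

text \<open>Different walks that reach v for the first time at their end are disjoint events, so
  their total weight is at most 1. The induction on the length replaces the probability space by the
  first-step decomposition; the uniform bound yields summability.\<close>

lemma sum_bounded_walks_le_1:
  assumes v: "v \<in> V" and x: "x \<in> V - {v}"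
  shows "finite {xs \<in> walks V B {v} x v. length xs \<le> n}
      \<and> sum (walk_weight W) {xs \<in> walks V B {v} x v. length xs \<le> n} \<le> 1"
  using x
proof (induction n arbitrary: x)
  case 0
  have "{xs \<in> walks V B {v} x v. length xs \<le> 0} = {}" by (auto simp: walks_def)
  then show ?case by (simp only: finite.emptyI sum.empty) simp
next
  case (Suc n)
  define A where "A y = {xs \<in> walks V B {v} y v. length xs \<le> n}" for y
  have fin: "finite (V \<union> B)" using finite_states v by auto
  have finA: "finite (A y)" and sumA: "sum (walk_weight W) (A y) \<le> 1" if "y \<in> V - {v}" for y
    using Suc.IH[OF that] by (auto simp: A_def)
  have fU: "finite (\<Union>y\<in>V - {v}. (#) x ` A y)" using finA fin by auto
  have sub: "{xs \<in> walks V B {v} x v. length xs \<le> Suc n} \<subseteq> insert [x, v] (\<Union>y\<in>V - {v}. (#) x ` A y)"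
    using walks_loopfree_eq[of x V v B] Suc.prems v disjoint by (auto simp: A_def)
  have nn: "0 \<le> walk_weight W xs" if "xs \<in> insert [x, v] (\<Union>y\<in>V - {v}. (#) x ` A y)" for xs
  proof -
    have "xs \<in> walks V B {v} x v"
      using that walks_loopfree_eq[of x V v B] Suc.prems v disjoint by (auto simp: A_def)
    then show ?thesis by (rule walk_weight_nonneg)
  qed
  have "sum (walk_weight W) {xs \<in> walks V B {v} x v. length xs \<le> Suc n}
     \<le> sum (walk_weight W) (insert [x, v] (\<Union>y\<in>V - {v}. (#) x ` A y))"
    by (rule sum_mono2) (use fU sub nn in auto)
  also have "\<dots> = W x v + sum (walk_weight W) (\<Union>y\<in>V - {v}. (#) x ` A y)"
  proof -
    have "[x, v] \<notin> (\<Union>y\<in>V - {v}. (#) x ` A y)" by (auto simp: A_def walks_def)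
    then show ?thesis using fU by (simp add: walk_weight_def)
  qed
  also have "sum (walk_weight W) (\<Union>y\<in>V - {v}. (#) x ` A y)
      = (\<Sum>y\<in>V - {v}. sum (walk_weight W) ((#) x ` A y))"
    by (rule sum.UNION_disjoint) (use finA fin in \<open>auto simp: A_def walks_def\<close>)
  also have "\<dots> = (\<Sum>y\<in>V - {v}. W x y * sum (walk_weight W) (A y))"
  proof (rule sum.cong)
    fix y assume "y \<in> V - {v}"
    have "sum (walk_weight W) ((#) x ` A y) = (\<Sum>ys\<in>A y. walk_weight W (x # ys))"
      by (subst sum.reindex) auto
    also have "\<dots> = (\<Sum>ys\<in>A y. W x y * walk_weight W ys)"
      by (rule sum.cong) (auto simp: A_def walks_def walk_weight_Cons)
    finally show "sum (walk_weight W) ((#) x ` A y) = W x y * sum (walk_weight W) (A y)"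
      by (simp add: sum_distrib_left)
  qed simp
  also have "W x v + \<dots> \<le> W x v + (\<Sum>y\<in>V - {v}. W x y * 1)"
    using sumA nonneg Suc.prems by (intro add_left_mono sum_mono mult_left_mono) auto
  also have "\<dots> = (\<Sum>y\<in>V. W x y)"
    using v fin by (simp add: sum.remove)
  also have "\<dots> \<le> (\<Sum>y\<in>V \<union> B. W x y)"
    using nonneg Suc.prems fin by (intro sum_mono2) auto
  also have "\<dots> = 1" using row_sum Suc.prems by simp
  finally show ?case using finite_subset[OF sub] fU by simp
qed

lemma walk_weight_summable:
  assumes v: "v \<in> V" and x: "x \<in> V - {v}"
  shows "walk_weight W summable_on walks V B {v} x v"
proof (rule nonneg_bdd_above_summable_on)
  show "0 \<le> walk_weight W xs" if "xs \<in> walks V B {v} x v" for xs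
    using that by (rule walk_weight_nonneg)
  show "bdd_above (sum (walk_weight W) ` {F. F \<subseteq> walks V B {v} x v \<and> finite F})"
  proof (rule bdd_aboveI2)
    fix F assume "F \<in> {F. F \<subseteq> walks V B {v} x v \<and> finite F}"
    then have F: "F \<subseteq> walks V B {v} x v" "finite F" by auto
    obtain n where n: "\<And>xs. xs \<in> F \<Longrightarrow> length xs \<le> n"
      using F(2) by (metis finite_imageI finite_nat_set_iff_bounded_le imageI)
    have "sum (walk_weight W) F \<le> sum (walk_weight W) {xs \<in> walks V B {v} x v. length xs \<le> n}"
      using sum_bounded_walks_le_1[OF v x, of n] F n by (intro sum_mono2) (auto intro: walk_weight_nonneg)
    also have "\<dots> \<le> 1" using sum_bounded_walks_le_1[OF v x, of n] by simp
    finally show "sum (walk_weight W) F \<le> 1" .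
  qed
qed

lemma hit_nonneg: "0 \<le> hit V B W C x v"
  unfolding hit_def by (intro infsum_nonneg walk_weight_nonneg)

lemma hit_eq:
  assumes v: "v \<in> V" and x: "x \<in> V - {v}"
  shows "hit V B W {v} x v = W x v + (\<Sum>y\<in>V - {v}. W x y * hit V B W {v} y v)"
proof -
  have fin: "finite (V - {v})" using finite_states v by (auto intro: finite_subset)
  have summ: "walk_weight W summable_on (#) x ` walks V B {v} y v"
    and val: "infsum (walk_weight W) ((#) x ` walks V B {v} y v) = W x y * hit V B W {v} y v"
    if "y \<in> V - {v}" for y
  proof -
    have "(\<lambda>ys. W x y * walk_weight W ys) summable_on walks V B {v} y v"
      using walk_weight_summable[OF v that] by (rule summable_on_cmult_right)
    moreover have cong: "(walk_weight W \<circ> (#) x) ys = W x y * walk_weight W ys"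
      if "ys \<in> walks V B {v} y v" for ys
      using that by (auto simp: walks_def walk_weight_Cons)
    ultimately have "(walk_weight W \<circ> (#) x) summable_on walks V B {v} y v"
      using summable_on_cong by (metis (no_types, lifting))
    then show "walk_weight W summable_on (#) x ` walks V B {v} y v"
      by (subst summable_on_reindex) auto
    have "infsum (walk_weight W) ((#) x ` walks V B {v} y v)
        = infsum (walk_weight W \<circ> (#) x) (walks V B {v} y v)"
      by (rule infsum_reindex) auto
    also have "\<dots> = infsum (\<lambda>ys. W x y * walk_weight W ys) (walks V B {v} y v)"
      by (rule infsum_cong) (rule cong)
    also have "\<dots> = W x y * hit V B W {v} y v"
      unfolding hit_def by (rule infsum_cmult_right) (use walk_weight_summable[OF v \<open>y \<in> V - {v}\<close>] in auto)
    finally show "infsum (walk_weight W) ((#) x ` walks V B {v} y v) = W x y * hit V B W {v} y v" .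
  qed
  have "hit V B W {v} x v
      = infsum (walk_weight W) (insert [x, v] (\<Union>y\<in>V - {v}. (#) x ` walks V B {v} y v))"
    unfolding hit_def using walks_loopfree_eq[of x V v B] x v disjoint by auto
  also have "\<dots> = walk_weight W [x, v]
      + infsum (walk_weight W) (\<Union>y\<in>V - {v}. (#) x ` walks V B {v} y v)"
  proof (rule infsum_insert)
    show "walk_weight W summable_on (\<Union>y\<in>V - {v}. (#) x ` walks V B {v} y v)"
      using fin summ by (intro summable_on_finite_union_disjoint) (auto simp: walks_def)
    show "[x, v] \<notin> (\<Union>y\<in>V - {v}. (#) x ` walks V B {v} y v)" by (auto simp: walks_def)
  qed
  also have "infsum (walk_weight W) (\<Union>y\<in>V - {v}. (#) x ` walks V B {v} y v)
      = (\<Sum>y\<in>V - {v}. infsum (walk_weight W) ((#) x ` walks V B {v} y v))"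
    using fin summ by (intro sum_infsum[symmetric] ) (auto simp: walks_def)
  also have "\<dots> = (\<Sum>y\<in>V - {v}. W x y * hit V B W {v} y v)"
    using val by simp
  finally show ?thesis by (simp add: walk_weight_def)
qed

text \<open>At \<open>x = v\<close> the value is \<open>1\<close>, whereas \<open>hit\<close> would also count the loops returning to \<open>v\<close>.\<close>

definition first_hit :: "'v set \<Rightarrow> 'v \<Rightarrow> 'v \<Rightarrow> real" where
  "first_hit U v x = (if x = v then 1 else if x \<in> U then hit U (B \<union> (V - U)) W {v} x v else 0)"

text \<open>With G the Green function of the walk killed outside U, this is sqrt(G(u,v) G(v,u) /
  (G(u,u) G(v,v))) for distinct sites of U. For symmetric W it is the correlation of the Gaussian
  vector with covariance matrix G.\<close>

definition two_way :: "'v set \<Rightarrow> 'v \<Rightarrow> 'v \<Rightarrow> real" where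
  "two_way U u v = sqrt (first_hit U v u * first_hit U u v)"

section \<open>Hitting functions as solutions of Dirichlet problems\<close>

lemma two_way_sym: "two_way U u v = two_way U v u"
  by (simp add: two_way_def mult.commute)

lemma first_hit_nonneg: "U \<subseteq> V \<Longrightarrow> finite V \<Longrightarrow> 0 \<le> first_hit U v x"
  unfolding first_hit_def using absorbing_walk.hit_nonneg[OF restrict] by auto

text \<open>The value 0 outside U encodes the killing and lets the sum run over all states.\<close>

lemma first_hit_eq:
  assumes U: "U \<subseteq> V" "finite V" and v: "v \<in> U" and x: "x \<in> U - {v}"
  shows "first_hit U v x = (\<Sum>y\<in>V \<union> B. W x y * first_hit U v y)"
proof -
  interpret r: absorbing_walk U "B \<union> (V - U)" W by (rule restrict[OF U])
  have fin: "finite (V \<union> B)" using U finite_absorbing by simp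
  have "first_hit U v x = W x v + (\<Sum>y\<in>U - {v}. W x y * hit U (B \<union> (V - U)) W {v} y v)"
    using r.hit_eq[OF v x] x by (simp add: first_hit_def)
  also have "\<dots> = W x v * first_hit U v v + (\<Sum>y\<in>U - {v}. W x y * first_hit U v y)"
    by (simp add: first_hit_def)
  also have "\<dots> = (\<Sum>y\<in>U. W x y * first_hit U v y)"
    using v fin U by (simp add: sum.remove finite_subset)
  also have "\<dots> = (\<Sum>y\<in>V \<union> B. W x y * first_hit U v y)"
    using fin U v by (intro sum.mono_neutral_left) (auto simp: first_hit_def)
  finally show ?thesis .
qed

text \<open>Uniqueness for the Dirichlet problem, by the maximum principle for f and for -f.
  Identities between hitting functions then only require a comparison of boundary values.\<close>

lemma harmonic_unique:
  assumes "U \<subseteq> V" and "\<And>x. x \<in> V \<union> B - U \<Longrightarrow> f x = 0"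
    and "\<And>x. x \<in> U \<Longrightarrow> f x = (\<Sum>y\<in>V \<union> B. W x y * f y)" and x: "x \<in> V \<union> B"
  shows "f x = 0"
proof -
  have 1: "f x \<le> 0"
    using assms(1) by (intro max_principle[of f, OF _ x])
      (metis DiffI assms(2,3) less_irrefl order_refl subsetD)
  have 2: "- f x \<le> 0"
  proof (rule max_principle[of "\<lambda>x. - f x", OF _ x])
    fix y assume "y \<in> V \<union> B" "0 < - f y"
    then have "y \<in> U" using assms(2)[of y] by auto
    then show "y \<in> V \<and> - f y \<le> (\<Sum>z\<in>V \<union> B. W y z * - f z)"
      using assms(1) assms(3)[of y] by (auto simp: sum_negf)
  qed
  show ?thesis using 1 2 by simp
qed

text \<open>The walk hits v before w, or it hits w before v and then continues from w to v. Both
  sides are harmonic on U - {v, w} and agree at v, at w and outside U.\<close>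

lemma first_hit_decomp:
  assumes U: "U \<subseteq> V" "finite V" and v: "v \<in> U" and w: "w \<in> U" "v \<noteq> w" and x: "x \<in> V \<union> B"
  shows "first_hit U v x = first_hit (U - {w}) v x + first_hit (U - {v}) w x * first_hit U v w"
proof -
  define d where "d x = first_hit U v x - (first_hit (U - {w}) v x + first_hit (U - {v}) w x * first_hit U v w)" for x
  have "d x = 0"
  proof (rule harmonic_unique[of "U - {v, w}"])
    show "U - {v, w} \<subseteq> V" using U by auto
    show "d y = 0" if "y \<in> V \<union> B - (U - {v, w})" for y
      using that v w by (auto simp: d_def first_hit_def)
    fix y assume y: "y \<in> U - {v, w}"
    have 1: "first_hit U v y = (\<Sum>z\<in>V \<union> B. W y z * first_hit U v z)"
      by (rule first_hit_eq) (use U v y in auto)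
    have 2: "first_hit (U - {w}) v y = (\<Sum>z\<in>V \<union> B. W y z * first_hit (U - {w}) v z)"
      by (rule first_hit_eq) (use U v w y in auto)
    have 3: "first_hit (U - {v}) w y = (\<Sum>z\<in>V \<union> B. W y z * first_hit (U - {v}) w z)"
      by (rule first_hit_eq) (use U v w y in auto)
    have "(\<Sum>z\<in>V \<union> B. W y z * d z) = (\<Sum>z\<in>V \<union> B. W y z * first_hit U v z)
        - ((\<Sum>z\<in>V \<union> B. W y z * first_hit (U - {w}) v z)
          + (\<Sum>z\<in>V \<union> B. W y z * first_hit (U - {v}) w z) * first_hit U v w)"
      by (simp add: d_def sum_distrib_right sum_subtractf sum.distrib distrib_left right_diff_distrib mult.assoc)
    then show "d y = (\<Sum>z\<in>V \<union> B. W y z * d z)"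
      unfolding 1[symmetric] 2[symmetric] 3[symmetric] by (simp add: d_def)
  qed (rule x)
  then show ?thesis by (simp add: d_def)
qed

text \<open>The one-step walk already contributes W x v. This links the hypothesis in codimension 2
  to \<open>two_way\<close> and is the start of the induction.\<close>

lemma weight_le_first_hit:
  assumes U: "U \<subseteq> V" "finite V" and "v \<in> U" "x \<in> U" "x \<noteq> v"
  shows "W x v \<le> first_hit U v x"
proof -
  have "W x v * first_hit U v v \<le> (\<Sum>y\<in>V \<union> B. W x y * first_hit U v y)"
    using assms finite_absorbing first_hit_nonneg[OF U] nonneg
    by (intro member_le_sum[where f = "\<lambda>y. W x y * first_hit U v y"] mult_nonneg_nonneg) auto
  also have "\<dots> = first_hit U v x" using first_hit_eq[OF U \<open>v \<in> U\<close>, of x] assms by auto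
  finally show ?thesis by (simp add: first_hit_def)
qed

lemma first_hit_le_1:
  assumes U: "U \<subseteq> V" "finite V" and v: "v \<in> U" and x: "x \<in> V \<union> B"
  shows "first_hit U v x \<le> 1"
proof -
  have "first_hit U v x - 1 \<le> 0"
  proof (rule max_principle[of "\<lambda>x. first_hit U v x - 1", OF _ x])
    fix y assume y: "y \<in> V \<union> B" "0 < first_hit U v y - 1"
    then have "y \<in> U - {v}" by (auto simp: first_hit_def split: if_splits)
    then show "y \<in> V \<and> first_hit U v y - 1 \<le> (\<Sum>z\<in>V \<union> B. W y z * (first_hit U v z - 1))"
      using first_hit_eq[OF U v, of y] row_sum[OF y(1)] U
      by (auto simp: right_diff_distrib sum_subtractf)
  qed
  then show ?thesis by simp
qed

text \<open>If \<open>u\<close> and \<open>v\<close> hit each other with certainty, then both hitting functions agree, and the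
  common function is harmonic on all of \<open>U\<close> and vanishes outside.\<close>

lemma two_way_less_1:
  assumes U: "U \<subseteq> V" "finite V" and uv: "u \<in> U" "v \<in> U" "u \<noteq> v"
  shows "two_way U u v < 1"
proof (rule ccontr)
  assume "\<not> two_way U u v < 1"
  then have ge: "1 \<le> first_hit U v u * first_hit U u v" by (simp add: two_way_def)
  have le: "first_hit U v u \<le> 1" "first_hit U u v \<le> 1" using first_hit_le_1[OF U] uv U by auto
  have nn: "0 \<le> first_hit U v u" "0 \<le> first_hit U u v" using first_hit_nonneg[OF U] by auto
  have one: "first_hit U v u = 1" "first_hit U u v = 1"
    using ge le nn mult_left_le[of "first_hit U v u" "first_hit U u v"]
      mult_left_le[of "first_hit U u v" "first_hit U v u"] by (simp_all add: mult.commute)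
  have eq: "first_hit U u x = first_hit U v x" if x: "x \<in> V \<union> B" for x
  proof -
    have "first_hit U u x - first_hit U v x = 0"
    proof (rule harmonic_unique[of "U - {u, v}" "\<lambda>x. first_hit U u x - first_hit U v x"])
      show "U - {u, v} \<subseteq> V" using U by auto
      show "first_hit U u y - first_hit U v y = 0" if "y \<in> V \<union> B - (U - {u, v})" for y
      proof -
        have "y \<notin> U \<or> y = u \<or> y = v" using that by auto
        then show ?thesis using one uv by (auto simp: first_hit_def)
      qed
      fix y assume y: "y \<in> U - {u, v}"
      show "first_hit U u y - first_hit U v y = (\<Sum>z\<in>V \<union> B. W y z * (first_hit U u z - first_hit U v z))"
        using first_hit_eq[OF U, of u y] first_hit_eq[OF U, of v y] uv y
        by (auto simp: right_diff_distrib sum_subtractf)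
    qed (rule x)
    then show ?thesis by simp
  qed
  have "first_hit U v v = 0"
  proof (rule harmonic_unique[of U "first_hit U v"])
    show "first_hit U v y = 0" if "y \<in> V \<union> B - U" for y
      using that uv by (auto simp: first_hit_def)
    fix y assume y: "y \<in> U"
    show "first_hit U v y = (\<Sum>z\<in>V \<union> B. W y z * first_hit U v z)"
    proof (cases "y = v")
      case True
      have "first_hit U v v = first_hit U u v" using eq[of v] uv U by auto
      also have "\<dots> = (\<Sum>z\<in>V \<union> B. W v z * first_hit U u z)"
        by (rule first_hit_eq[OF U]) (use uv in auto)
      also have "\<dots> = (\<Sum>z\<in>V \<union> B. W v z * first_hit U v z)" using eq by simp
      finally show ?thesis using True by simp
    qed (use y uv first_hit_eq[OF U, of v y] in auto)
  qed (use U uv in auto)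
  then show False by (simp add: first_hit_def)
qed

text \<open>The correlations \<open>two_way U\<close> on \<open>U - {w}\<close> become partial correlations given \<open>w\<close>.\<close>

lemma two_way_triangle:
  assumes U: "U \<subseteq> V" "finite V" and d: "u \<in> U" "v \<in> U" "w \<in> U" "u \<noteq> v" "u \<noteq> w" "v \<noteq> w"
  shows "two_way (U - {w}) u v * (sqrt (1 - (two_way U u w)\<^sup>2) * sqrt (1 - (two_way U v w)\<^sup>2))
      + two_way U u w * two_way U v w \<le> two_way U u v"
proof -
  define h where "h a b = first_hit U b a" for a b
  have nn: "0 \<le> h a b" "0 \<le> first_hit (U - {w}) a b" for a b
    unfolding h_def using U by (auto intro!: first_hit_nonneg)
  have le: "h a b * h b a \<le> 1" if "a \<in> U" "b \<in> U" for a b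
    using first_hit_le_1[OF U] that U nn by (auto simp: h_def intro!: mult_le_one)
  \<comment> \<open>Two decompositions, for the targets b and w, are linear in the probabilities of
    hitting one of the two before the other. Eliminating the probability of hitting w first leaves
    this identity; the last factor accounts for excursions from b to w and back.\<close>
  have key: "h a b - h a w * h w b = first_hit (U - {w}) b a * (1 - h b w * h w b)"
    if "a \<in> U" "b \<in> U" "a \<noteq> b" "a \<noteq> w" "b \<noteq> w" for a b
  proof -
    have "h a b = first_hit (U - {w}) b a + first_hit (U - {b}) w a * h w b"
      unfolding h_def by (rule first_hit_decomp[OF U]) (use that d U in auto)
    moreover have "h a w = first_hit (U - {b}) w a + first_hit (U - {w}) b a * h b w"
      unfolding h_def by (rule first_hit_decomp[OF U]) (use that d U in auto)
    ultimately show ?thesis by (simp add: algebra_simps)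
  qed
  \<comment> \<open>Cauchy-Schwarz for two summands. It combines the directions u to v and v to u,
    whose hitting probabilities may differ because W need not be symmetric.\<close>
  have cs: "sqrt (a * b) + sqrt (c * e) \<le> sqrt ((a + c) * (b + e))"
    if "0 \<le> a" "0 \<le> b" "0 \<le> c" "0 \<le> e" for a b c e :: real
  proof (rule real_le_rsqrt)
    have "2 * (sqrt (a * e) * sqrt (c * b)) \<le> a * e + c * b"
      using sum_squares_bound[of "sqrt (a * e)" "sqrt (c * b)"] that by simp
    moreover have "sqrt (a * e) * sqrt (c * b) = sqrt (a * b) * sqrt (c * e)"
      by (simp add: real_sqrt_mult mult_ac)
    ultimately show "(sqrt (a * b) + sqrt (c * e))\<^sup>2 \<le> (a + c) * (b + e)"
      using that by (simp add: power2_sum algebra_simps)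
  qed
  define z1 z2 where z: "z1 = first_hit (U - {w}) v u" "z2 = first_hit (U - {w}) u v"
  define x1 x2 where x: "x1 = z1 * (1 - h v w * h w v)" "x2 = z2 * (1 - h u w * h w u)"
  have sq: "(two_way U a b)\<^sup>2 = h a b * h b a" for a b
    using nn by (simp add: two_way_def h_def)
  have "two_way (U - {w}) u v * (sqrt (1 - (two_way U u w)\<^sup>2) * sqrt (1 - (two_way U v w)\<^sup>2))
      = sqrt (x1 * x2)"
    unfolding sq x unfolding two_way_def z by (simp only: real_sqrt_mult mult_ac)
  moreover have "two_way U u w * two_way U v w = sqrt ((h u w * h w v) * (h v w * h w u))"
    unfolding two_way_def h_def by (simp only: real_sqrt_mult mult_ac)
  moreover have "sqrt (x1 * x2) + sqrt ((h u w * h w v) * (h v w * h w u))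
      \<le> sqrt ((x1 + h u w * h w v) * (x2 + h v w * h w u))"
    using nn le d unfolding x z by (intro cs mult_nonneg_nonneg) auto
  moreover have "x1 + h u w * h w v = h u v" "x2 + h v w * h w u = h v u"
    using key[of u v] key[of v u] d unfolding x z by auto
  moreover have "sqrt (h u v * h v u) = two_way U u v" by (simp add: two_way_def h_def)
  ultimately show ?thesis by simp
qed

end

section \<open>Maximal correlation on a finite weighted set\<close>

definition wsum :: "'o set \<Rightarrow> ('o \<Rightarrow> real) \<Rightarrow> ('o \<Rightarrow> real) \<Rightarrow> real" where
  "wsum \<Omega> m F = (\<Sum>\<omega>\<in>\<Omega>. m \<omega> * F \<omega>)"

definition cond_mean :: "'o set \<Rightarrow> ('o \<Rightarrow> real) \<Rightarrow> ('o \<Rightarrow> 'x) \<Rightarrow> ('o \<Rightarrow> real) \<Rightarrow> 'x \<Rightarrow> real" where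
  "cond_mean \<Omega> m a F x = wsum {\<omega> \<in> \<Omega>. a \<omega> = x} m F / wsum {\<omega> \<in> \<Omega>. a \<omega> = x} m (\<lambda>_. 1)"

text \<open>Stated without quotients, so that functions of variance zero are covered. The inequality
  also bounds the absolute value of the covariance, since f may be negated.\<close>

definition corr_le :: "'o set \<Rightarrow> ('o \<Rightarrow> real) \<Rightarrow> ('o \<Rightarrow> 'x) \<Rightarrow> ('o \<Rightarrow> 'y) \<Rightarrow> real \<Rightarrow> bool" where
  "corr_le \<Omega> m a b c \<longleftrightarrow> (\<forall>f g. wsum \<Omega> m (\<lambda>\<omega>. f (a \<omega>)) = 0 \<longrightarrow> wsum \<Omega> m (\<lambda>\<omega>. g (b \<omega>)) = 0 \<longrightarrow>
     wsum \<Omega> m (\<lambda>\<omega>. f (a \<omega>) * g (b \<omega>))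
       \<le> c * (sqrt (wsum \<Omega> m (\<lambda>\<omega>. (f (a \<omega>))\<^sup>2)) * sqrt (wsum \<Omega> m (\<lambda>\<omega>. (g (b \<omega>))\<^sup>2))))"

text \<open>A mean-zero singular pair, for the singular value \<rho>, of the conditional expectation
  operators between functions of a and functions of b. Glued together, f and g become an
  eigenfunction of the bipartite walk.\<close>

definition extremal_pair ::
  "'o set \<Rightarrow> ('o \<Rightarrow> real) \<Rightarrow> ('o \<Rightarrow> 'x) \<Rightarrow> ('o \<Rightarrow> 'y) \<Rightarrow> real \<Rightarrow> ('x \<Rightarrow> real) \<Rightarrow> ('y \<Rightarrow> real) \<Rightarrow> bool" where
  "extremal_pair \<Omega> m a b \<rho> f g \<longleftrightarrow>
     wsum \<Omega> m (\<lambda>\<omega>. f (a \<omega>)) = 0 \<and> wsum \<Omega> m (\<lambda>\<omega>. g (b \<omega>)) = 0 \<and>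
     0 < wsum \<Omega> m (\<lambda>\<omega>. (f (a \<omega>))\<^sup>2) \<and>
     (\<forall>\<omega>\<in>\<Omega>. cond_mean \<Omega> m a (\<lambda>\<omega>. g (b \<omega>)) (a \<omega>) = \<rho> * f (a \<omega>)) \<and>
     (\<forall>\<omega>\<in>\<Omega>. cond_mean \<Omega> m b (\<lambda>\<omega>. f (a \<omega>)) (b \<omega>) = \<rho> * g (b \<omega>))"

text \<open>For \<rho> = 0 no pair is demanded: if a takes a single value, every mean-zero function
  of a vanishes on \<Omega>.\<close>

definition max_corr :: "'o set \<Rightarrow> ('o \<Rightarrow> real) \<Rightarrow> ('o \<Rightarrow> 'x) \<Rightarrow> ('o \<Rightarrow> 'y) \<Rightarrow> real \<Rightarrow> bool" where
  "max_corr \<Omega> m a b \<rho> \<longleftrightarrow>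
     0 \<le> \<rho> \<and> corr_le \<Omega> m a b \<rho> \<and> (0 < \<rho> \<longrightarrow> (\<exists>f g. extremal_pair \<Omega> m a b \<rho> f g))"

lemma wsum_add: "wsum \<Omega> m (\<lambda>\<omega>. F \<omega> + G \<omega>) = wsum \<Omega> m F + wsum \<Omega> m G"
  by (simp add: wsum_def sum.distrib distrib_left)

lemma wsum_diff: "wsum \<Omega> m (\<lambda>\<omega>. F \<omega> - G \<omega>) = wsum \<Omega> m F - wsum \<Omega> m G"
  by (simp add: wsum_def sum_subtractf right_diff_distrib)

lemma wsum_cmult: "wsum \<Omega> m (\<lambda>\<omega>. c * F \<omega>) = c * wsum \<Omega> m F"
  by (simp add: wsum_def sum_distrib_left mult_ac)

lemma wsum_cong: "(\<And>\<omega>. \<omega> \<in> \<Omega> \<Longrightarrow> F \<omega> = G \<omega>) \<Longrightarrow> wsum \<Omega> m F = wsum \<Omega> m G"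
  by (simp add: wsum_def)

lemma corr_le_sym:
  assumes "corr_le \<Omega> m a b c"
  shows "corr_le \<Omega> m b a c"
  unfolding corr_le_def
proof (intro allI impI)
  fix f g assume fg: "wsum \<Omega> m (\<lambda>\<omega>. f (b \<omega>)) = 0" "wsum \<Omega> m (\<lambda>\<omega>. g (a \<omega>)) = 0"
  show "wsum \<Omega> m (\<lambda>\<omega>. f (b \<omega>) * g (a \<omega>))
     \<le> c * (sqrt (wsum \<Omega> m (\<lambda>\<omega>. (f (b \<omega>))\<^sup>2)) * sqrt (wsum \<Omega> m (\<lambda>\<omega>. (g (a \<omega>))\<^sup>2)))"
    using assms[unfolded corr_le_def, rule_format, OF fg(2,1)] by (simp only: mult.commute)
qed

text \<open>The total mass is not normalised, so that restriction to a fibre stays inside the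
  locale.\<close>

locale weighted =
  fixes \<Omega> :: "'o set" and m :: "'o \<Rightarrow> real"
  assumes fin: "finite \<Omega>" and mpos: "\<And>\<omega>. \<omega> \<in> \<Omega> \<Longrightarrow> 0 < m \<omega>"
begin

lemma mnonneg: "\<omega> \<in> \<Omega> \<Longrightarrow> 0 \<le> m \<omega>"
  using mpos less_imp_le by blast

lemma wsum_nonneg: "(\<And>\<omega>. \<omega> \<in> \<Omega> \<Longrightarrow> 0 \<le> F \<omega>) \<Longrightarrow> 0 \<le> wsum \<Omega> m F"
  unfolding wsum_def by (intro sum_nonneg mult_nonneg_nonneg) (auto intro: mnonneg)

lemma wsum_square_le_0: "wsum \<Omega> m (\<lambda>\<omega>. (F \<omega>)\<^sup>2) \<le> 0 \<Longrightarrow> \<omega> \<in> \<Omega> \<Longrightarrow> F \<omega> = 0"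
proof -
  assume le: "wsum \<Omega> m (\<lambda>\<omega>. (F \<omega>)\<^sup>2) \<le> 0" and w: "\<omega> \<in> \<Omega>"
  have "(\<Sum>\<omega>\<in>\<Omega>. m \<omega> * (F \<omega>)\<^sup>2) = 0"
    using le wsum_nonneg[of "\<lambda>\<omega>. (F \<omega>)\<^sup>2"] by (simp add: wsum_def)
  then have "m \<omega> * (F \<omega>)\<^sup>2 = 0"
    using w fin mnonneg by (subst (asm) sum_nonneg_eq_0_iff) auto
  then show "F \<omega> = 0" using mpos[OF w] by simp
qed

lemma restrict: "weighted {\<omega> \<in> \<Omega>. P \<omega>} m"
  using fin mpos by unfold_locales auto

lemma wsum_Cauchy_Schwarz:
  "wsum \<Omega> m (\<lambda>\<omega>. F \<omega> * G \<omega>) \<le> sqrt (wsum \<Omega> m (\<lambda>\<omega>. (F \<omega>)\<^sup>2)) * sqrt (wsum \<Omega> m (\<lambda>\<omega>. (G \<omega>)\<^sup>2))"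
proof -
  have s: "sqrt (m \<omega>) * sqrt (m \<omega>) = m \<omega>" if "\<omega> \<in> \<Omega>" for \<omega> using mpos[OF that] by simp
  have e: "wsum \<Omega> m (\<lambda>\<omega>. H \<omega> * K \<omega>) = (\<Sum>\<omega>\<in>\<Omega>. (sqrt (m \<omega>) * H \<omega>) * (sqrt (m \<omega>) * K \<omega>))" for H K
    unfolding wsum_def
  proof (intro sum.cong refl)
    fix \<omega> assume "\<omega> \<in> \<Omega>"
    then have "m \<omega> * (H \<omega> * K \<omega>) = (sqrt (m \<omega>) * sqrt (m \<omega>)) * (H \<omega> * K \<omega>)"
      by (simp only: s)
    then show "m \<omega> * (H \<omega> * K \<omega>) = (sqrt (m \<omega>) * H \<omega>) * (sqrt (m \<omega>) * K \<omega>)"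
      by (simp only: mult_ac)
  qed
  have "(wsum \<Omega> m (\<lambda>\<omega>. F \<omega> * G \<omega>))\<^sup>2 \<le> wsum \<Omega> m (\<lambda>\<omega>. F \<omega> * F \<omega>) * wsum \<Omega> m (\<lambda>\<omega>. G \<omega> * G \<omega>)"
    unfolding e using Cauchy_Schwarz_ineq_sum[of "\<lambda>\<omega>. sqrt (m \<omega>) * F \<omega>" "\<lambda>\<omega>. sqrt (m \<omega>) * G \<omega>" \<Omega>]
    by (simp only: power2_eq_square)
  then show ?thesis
    unfolding real_sqrt_mult[symmetric] by (intro real_le_rsqrt) (simp only: power2_eq_square)
qed

section \<open>Conditional means and the existence of the maximal correlation\<close>

lemma wsum_by_fibres: "wsum \<Omega> m F = (\<Sum>x\<in>a ` \<Omega>. wsum {\<omega> \<in> \<Omega>. a \<omega> = x} m F)"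
  unfolding wsum_def by (rule sum.image_gen[OF fin])

lemma fibre_mass_pos: "x \<in> a ` \<Omega> \<Longrightarrow> 0 < wsum {\<omega> \<in> \<Omega>. a \<omega> = x} m (\<lambda>_. 1)"
  unfolding wsum_def using fin mpos by (intro sum_pos) auto

lemma wsum_fibre_cond_mean:
  assumes "x \<in> a ` \<Omega>"
  shows "wsum {\<omega> \<in> \<Omega>. a \<omega> = x} m (\<lambda>\<omega>. cond_mean \<Omega> m a F (a \<omega>)) = wsum {\<omega> \<in> \<Omega>. a \<omega> = x} m F"
proof -
  have "wsum {\<omega> \<in> \<Omega>. a \<omega> = x} m (\<lambda>\<omega>. cond_mean \<Omega> m a F (a \<omega>))
      = wsum {\<omega> \<in> \<Omega>. a \<omega> = x} m (\<lambda>\<omega>. cond_mean \<Omega> m a F x * 1)"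
    by (intro wsum_cong) auto
  then show ?thesis using fibre_mass_pos[OF assms] unfolding wsum_cmult by (simp add: cond_mean_def)
qed

lemma tower: "wsum \<Omega> m (\<lambda>\<omega>. f (a \<omega>) * cond_mean \<Omega> m a F (a \<omega>)) = wsum \<Omega> m (\<lambda>\<omega>. f (a \<omega>) * F \<omega>)"
proof -
  have pull: "wsum {\<omega> \<in> \<Omega>. a \<omega> = x} m (\<lambda>\<omega>. f (a \<omega>) * G \<omega>) = f x * wsum {\<omega> \<in> \<Omega>. a \<omega> = x} m G" for x G
    unfolding wsum_cmult[symmetric] by (intro wsum_cong) auto
  show ?thesis
    unfolding wsum_by_fibres[of _ a] pull by (intro sum.cong refl) (simp add: wsum_fibre_cond_mean)
qed

lemma wsum_cond_mean: "wsum \<Omega> m (\<lambda>\<omega>. cond_mean \<Omega> m a F (a \<omega>)) = wsum \<Omega> m F"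
  using tower[of "\<lambda>_. 1" a F] by simp

lemma extremal_pairD:
  assumes "extremal_pair \<Omega> m a b \<rho> f g"
  shows "wsum \<Omega> m (\<lambda>\<omega>. f (a \<omega>) * g (b \<omega>)) = \<rho> * wsum \<Omega> m (\<lambda>\<omega>. (f (a \<omega>))\<^sup>2)"
    and "wsum \<Omega> m (\<lambda>\<omega>. f (a \<omega>) * g (b \<omega>)) = \<rho> * wsum \<Omega> m (\<lambda>\<omega>. (g (b \<omega>))\<^sup>2)"
proof -
  have "wsum \<Omega> m (\<lambda>\<omega>. f (a \<omega>) * g (b \<omega>)) = wsum \<Omega> m (\<lambda>\<omega>. f (a \<omega>) * cond_mean \<Omega> m a (\<lambda>\<omega>. g (b \<omega>)) (a \<omega>))"
    by (rule tower[symmetric])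
  also have "\<dots> = wsum \<Omega> m (\<lambda>\<omega>. \<rho> * (f (a \<omega>))\<^sup>2)"
    using assms by (intro wsum_cong) (simp add: extremal_pair_def power2_eq_square)
  finally show "wsum \<Omega> m (\<lambda>\<omega>. f (a \<omega>) * g (b \<omega>)) = \<rho> * wsum \<Omega> m (\<lambda>\<omega>. (f (a \<omega>))\<^sup>2)"
    by (simp add: wsum_cmult)
  have "wsum \<Omega> m (\<lambda>\<omega>. g (b \<omega>) * f (a \<omega>)) = wsum \<Omega> m (\<lambda>\<omega>. g (b \<omega>) * cond_mean \<Omega> m b (\<lambda>\<omega>. f (a \<omega>)) (b \<omega>))"
    by (rule tower[symmetric])
  also have "\<dots> = wsum \<Omega> m (\<lambda>\<omega>. \<rho> * (g (b \<omega>))\<^sup>2)"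
    using assms by (intro wsum_cong) (simp add: extremal_pair_def power2_eq_square)
  finally show "wsum \<Omega> m (\<lambda>\<omega>. f (a \<omega>) * g (b \<omega>)) = \<rho> * wsum \<Omega> m (\<lambda>\<omega>. (g (b \<omega>))\<^sup>2)"
    by (simp add: wsum_cmult mult.commute)
qed

text \<open>The values of a come from an arbitrary type, so functions on it form a possibly infinite
  product. Demanding f = 0 off the finite image makes the ball a closed subset of a compact
  box.\<close>

lemma unit_ball_compact:
  fixes a :: "'o \<Rightarrow> 'b"
  shows "compact {f. (\<forall>x. x \<notin> a ` \<Omega> \<longrightarrow> f x = 0) \<and> wsum \<Omega> m (\<lambda>\<omega>. f (a \<omega>)) = 0 \<and> wsum \<Omega> m (\<lambda>\<omega>. (f (a \<omega>))\<^sup>2) \<le> 1}"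
    (is "compact ?K")
proof -
  \<comment> \<open>A function in the ball satisfies m \<omega> * (f (a \<omega>))^2 \<le> 1. The
    extra summand 1 gives C \<le> C^2, so that C bounds f itself and not only its square.\<close>
  define C where "C = 1 + (\<Sum>\<omega>\<in>\<Omega>. 1 / m \<omega>)"
  have C: "1 \<le> C" "\<And>\<omega>. \<omega> \<in> \<Omega> \<Longrightarrow> 1 / m \<omega> \<le> C"
  proof -
    have nn: "0 \<le> 1 / m \<omega>" if "\<omega> \<in> \<Omega>" for \<omega> using mpos[OF that] by simp
    then show "1 \<le> C" unfolding C_def by (simp add: sum_nonneg)
    show "1 / m \<omega> \<le> C" if "\<omega> \<in> \<Omega>" for \<omega>
      using member_le_sum[of \<omega> \<Omega> "\<lambda>\<omega>. 1 / m \<omega>"] nn fin that unfolding C_def by simp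
  qed
  define I where "I = (\<lambda>x. if x \<in> a ` \<Omega> then {-C..C} else {0::real})"
  have "compactin (product_topology (\<lambda>i. euclidean) UNIV) (PiE UNIV I)"
    by (auto simp: compactin_PiE I_def)
  then have comp: "compact (PiE UNIV I)" by (simp add: euclidean_product_topology)
  have coord: "continuous_on UNIV (\<lambda>f::'b \<Rightarrow> real. f x)" for x by simp
  have "closed {f. wsum \<Omega> m (\<lambda>\<omega>. f (a \<omega>)) = 0 \<and> wsum \<Omega> m (\<lambda>\<omega>. (f (a \<omega>))\<^sup>2) \<le> 1}"
    unfolding wsum_def
    by (intro closed_Collect_conj closed_Collect_eq closed_Collect_le continuous_intros coord)
  then have "compact (PiE UNIV I \<inter> {f. wsum \<Omega> m (\<lambda>\<omega>. f (a \<omega>)) = 0 \<and> wsum \<Omega> m (\<lambda>\<omega>. (f (a \<omega>))\<^sup>2) \<le> 1})"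
    using comp by (rule compact_Int_closed[rotated])
  moreover have "f \<in> PiE UNIV I" if "f \<in> ?K" for f
  proof -
    have "f x \<in> I x" for x
    proof (cases "x \<in> a ` \<Omega>")
      case True
      then obtain \<omega> where w: "\<omega> \<in> \<Omega>" "x = a \<omega>" by auto
      have "m \<omega> * (f x)\<^sup>2 \<le> wsum \<Omega> m (\<lambda>\<omega>. (f (a \<omega>))\<^sup>2)"
        unfolding wsum_def w(2) using w(1) fin mnonneg
        by (intro member_le_sum[of \<omega> \<Omega> "\<lambda>\<omega>. m \<omega> * (f (a \<omega>))\<^sup>2"]) auto
      then have "m \<omega> * (f x)\<^sup>2 \<le> 1" using that by simp
      then have "(f x)\<^sup>2 \<le> 1 / m \<omega>" using mpos[OF w(1)] by (simp add: field_simps)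
      also have "\<dots> \<le> C" using C w by simp
      also have "\<dots> \<le> C\<^sup>2" using C(1) by (simp add: power2_eq_square)
      finally have "\<bar>f x\<bar> \<le> C" using C(1) abs_le_square_iff[of "f x" C] by simp
      then show ?thesis using True by (simp add: I_def abs_le_iff)
    next
      case False
      then show ?thesis using that by (auto simp: I_def)
    qed
    then show ?thesis by auto
  qed
  moreover have "f \<in> ?K" if "f \<in> PiE UNIV I" "wsum \<Omega> m (\<lambda>\<omega>. f (a \<omega>)) = 0" "wsum \<Omega> m (\<lambda>\<omega>. (f (a \<omega>))\<^sup>2) \<le> 1" for f
    using that by (auto simp: I_def PiE_def Pi_def split: if_splits)
  ultimately show ?thesis
    by (elim back_subst[of compact]) blast
qed

text \<open>The conditional expectation \<open>h\<close> of \<open>g\<close> given \<open>a\<close> has norm at most \<open>\<rho>\<close> by maximality, and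
  \<open>\<langle>f, h\<rangle> = \<rho>\<close>; hence \<open>h = \<rho> f\<close>.\<close>

lemma maximizer_eigen:
  assumes corr: "corr_le \<Omega> m a b \<rho>" and rho: "0 \<le> \<rho>"
    and f: "wsum \<Omega> m (\<lambda>\<omega>. f (a \<omega>)) = 0" "wsum \<Omega> m (\<lambda>\<omega>. (f (a \<omega>))\<^sup>2) \<le> 1"
    and g: "wsum \<Omega> m (\<lambda>\<omega>. g (b \<omega>)) = 0" "wsum \<Omega> m (\<lambda>\<omega>. (g (b \<omega>))\<^sup>2) \<le> 1"
    and max: "wsum \<Omega> m (\<lambda>\<omega>. f (a \<omega>) * g (b \<omega>)) = \<rho>"
    and w: "\<omega> \<in> \<Omega>"
  shows "cond_mean \<Omega> m a (\<lambda>\<omega>. g (b \<omega>)) (a \<omega>) = \<rho> * f (a \<omega>)"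
proof -
  define h where "h = cond_mean \<Omega> m a (\<lambda>\<omega>. g (b \<omega>))"
  define H where "H = wsum \<Omega> m (\<lambda>\<omega>. (h (a \<omega>))\<^sup>2)"
  have h0: "wsum \<Omega> m (\<lambda>\<omega>. h (a \<omega>)) = 0" unfolding h_def using g by (simp add: wsum_cond_mean)
  have Hnn: "0 \<le> H" unfolding H_def by (intro wsum_nonneg) simp
  have fh: "wsum \<Omega> m (\<lambda>\<omega>. f (a \<omega>) * h (a \<omega>)) = \<rho>" unfolding h_def by (simp add: tower max)
  have "H = wsum \<Omega> m (\<lambda>\<omega>. h (a \<omega>) * g (b \<omega>))"
    unfolding H_def power2_eq_square by (subst (2) h_def) (rule tower)
  also have "\<dots> \<le> \<rho> * (sqrt H * sqrt (wsum \<Omega> m (\<lambda>\<omega>. (g (b \<omega>))\<^sup>2)))"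
    using corr h0 g unfolding corr_le_def H_def by blast
  also have "\<dots> \<le> \<rho> * (sqrt H * 1)"
    using g rho Hnn by (intro mult_left_mono) auto
  finally have "sqrt H * sqrt H \<le> \<rho> * sqrt H" using Hnn by simp
  then have "sqrt H \<le> \<rho>" using rho Hnn mult_right_le_imp_le[of "sqrt H" "sqrt H" \<rho>]
    by (cases "H = 0") auto
  then have "H \<le> \<rho>\<^sup>2" using Hnn sqrt_le_D by blast
  have "wsum \<Omega> m (\<lambda>\<omega>. (h (a \<omega>) - \<rho> * f (a \<omega>))\<^sup>2)
      = wsum \<Omega> m (\<lambda>\<omega>. (h (a \<omega>))\<^sup>2 + (\<rho>\<^sup>2 * (f (a \<omega>))\<^sup>2 - (2 * \<rho>) * (f (a \<omega>) * h (a \<omega>))))"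
    by (intro wsum_cong) (simp add: power2_eq_square algebra_simps)
  also have "\<dots> = H + \<rho>\<^sup>2 * wsum \<Omega> m (\<lambda>\<omega>. (f (a \<omega>))\<^sup>2) - 2 * \<rho> * \<rho>"
    by (simp only: wsum_add wsum_diff wsum_cmult fh H_def)
  also have "\<dots> \<le> 0"
    using \<open>H \<le> \<rho>\<^sup>2\<close> mult_left_mono[OF f(2), of "\<rho>\<^sup>2"] by (simp add: power2_eq_square)
  finally have "wsum \<Omega> m (\<lambda>\<omega>. (h (a \<omega>) - \<rho> * f (a \<omega>))\<^sup>2) \<le> 0" .
  from wsum_square_le_0[OF this w] show ?thesis by (simp add: h_def)
qed

text \<open>The covariance is continuous on a product of two compact unit balls and attains its
  maximum \<rho> there; rescaling extends the bound to all mean-zero functions. A maximiser is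
  extremal by \<open>maximizer_eigen\<close>, applied once in each direction.\<close>

lemma max_corr_exists:
  fixes a :: "'o \<Rightarrow> 'b" and b :: "'o \<Rightarrow> 'c"
  shows "\<exists>\<rho>. max_corr \<Omega> m a b \<rho>"
proof -
  define K where "K = {f. (\<forall>x. x \<notin> a ` \<Omega> \<longrightarrow> f x = 0) \<and> wsum \<Omega> m (\<lambda>\<omega>. f (a \<omega>)) = 0 \<and> wsum \<Omega> m (\<lambda>\<omega>. (f (a \<omega>))\<^sup>2) \<le> 1}"
  define L where "L = {f. (\<forall>x. x \<notin> b ` \<Omega> \<longrightarrow> f x = 0) \<and> wsum \<Omega> m (\<lambda>\<omega>. f (b \<omega>)) = 0 \<and> wsum \<Omega> m (\<lambda>\<omega>. (f (b \<omega>))\<^sup>2) \<le> 1}"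
  define J where "J p = wsum \<Omega> m (\<lambda>\<omega>. fst p (a \<omega>) * snd p (b \<omega>))" for p
  have comp: "compact (K \<times> L)"
    unfolding K_def L_def by (intro compact_Times unit_ball_compact)
  have zero: "((\<lambda>_. 0), (\<lambda>_. 0)) \<in> K \<times> L" by (auto simp: K_def L_def wsum_def)
  have c1: "continuous_on UNIV (\<lambda>p::('b \<Rightarrow> real) \<times> ('c \<Rightarrow> real). fst p x)" for x
    by (rule continuous_on_compose2[OF continuous_on_product_coordinates continuous_on_fst[OF continuous_on_id]]) auto
  have c2: "continuous_on UNIV (\<lambda>p::('b \<Rightarrow> real) \<times> ('c \<Rightarrow> real). snd p x)" for x
    by (rule continuous_on_compose2[OF continuous_on_product_coordinates continuous_on_snd[OF continuous_on_id]]) auto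
  have "continuous_on (K \<times> L) J"
    unfolding J_def wsum_def
    by (rule continuous_on_subset[of UNIV]) (intro continuous_on_sum continuous_on_mult continuous_on_const c1 c2, rule subset_UNIV)
  then obtain p where p: "p \<in> K \<times> L" "\<And>q. q \<in> K \<times> L \<Longrightarrow> J q \<le> J p"
    using continuous_attains_sup[OF comp] zero by blast
  obtain f g where fg: "p = (f, g)" by (cases p)
  define \<rho> where "\<rho> = J p"
  have rho: "0 \<le> \<rho>" using p(2)[OF zero] by (simp add: \<rho>_def J_def wsum_def)
  have "corr_le \<Omega> m a b \<rho>"
    unfolding corr_le_def
  proof (intro allI impI)
    fix f' :: "'b \<Rightarrow> real" and g' :: "'c \<Rightarrow> real"
    assume f': "wsum \<Omega> m (\<lambda>\<omega>. f' (a \<omega>)) = 0" and g': "wsum \<Omega> m (\<lambda>\<omega>. g' (b \<omega>)) = 0"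
    define F where "F = sqrt (wsum \<Omega> m (\<lambda>\<omega>. (f' (a \<omega>))\<^sup>2))"
    define G where "G = sqrt (wsum \<Omega> m (\<lambda>\<omega>. (g' (b \<omega>))\<^sup>2))"
    have FG: "F\<^sup>2 = wsum \<Omega> m (\<lambda>\<omega>. (f' (a \<omega>))\<^sup>2)" "G\<^sup>2 = wsum \<Omega> m (\<lambda>\<omega>. (g' (b \<omega>))\<^sup>2)" "0 \<le> F" "0 \<le> G"
      by (auto simp: F_def G_def intro!: wsum_nonneg)
    have "wsum \<Omega> m (\<lambda>\<omega>. f' (a \<omega>) * g' (b \<omega>)) \<le> \<rho> * (F * G)"
    proof (cases "F = 0 \<or> G = 0")
      case True
      then have "wsum \<Omega> m (\<lambda>\<omega>. f' (a \<omega>) * g' (b \<omega>)) \<le> 0"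
        using wsum_Cauchy_Schwarz[of "\<lambda>\<omega>. f' (a \<omega>)" "\<lambda>\<omega>. g' (b \<omega>)"] by (auto simp: F_def G_def)
      then show ?thesis using True by auto
    next
      case False
      then have pos: "F > 0" "G > 0" using FG by auto
      define f1 where "f1 x = (if x \<in> a ` \<Omega> then 1 / F * f' x else 0)" for x
      define g1 where "g1 x = (if x \<in> b ` \<Omega> then 1 / G * g' x else 0)" for x
      have e: "wsum \<Omega> m (\<lambda>\<omega>. f1 (a \<omega>)) = wsum \<Omega> m (\<lambda>\<omega>. 1 / F * f' (a \<omega>))"
        "wsum \<Omega> m (\<lambda>\<omega>. (f1 (a \<omega>))\<^sup>2) = wsum \<Omega> m (\<lambda>\<omega>. 1 / F\<^sup>2 * (f' (a \<omega>))\<^sup>2)"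
        "wsum \<Omega> m (\<lambda>\<omega>. g1 (b \<omega>)) = wsum \<Omega> m (\<lambda>\<omega>. 1 / G * g' (b \<omega>))"
        "wsum \<Omega> m (\<lambda>\<omega>. (g1 (b \<omega>))\<^sup>2) = wsum \<Omega> m (\<lambda>\<omega>. 1 / G\<^sup>2 * (g' (b \<omega>))\<^sup>2)"
        by (rule wsum_cong, simp add: f1_def g1_def power_divide)+
      have e1: "wsum \<Omega> m (\<lambda>\<omega>. f1 (a \<omega>)) = 0" "wsum \<Omega> m (\<lambda>\<omega>. g1 (b \<omega>)) = 0"
        unfolding e wsum_cmult f' g' by simp_all
      have e2: "wsum \<Omega> m (\<lambda>\<omega>. (f1 (a \<omega>))\<^sup>2) = 1" "wsum \<Omega> m (\<lambda>\<omega>. (g1 (b \<omega>))\<^sup>2) = 1"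
        unfolding e wsum_cmult FG(1,2)[symmetric] using pos by simp_all
      have "(f1, g1) \<in> K \<times> L"
        unfolding K_def L_def using e1 e2 by (simp add: f1_def g1_def)
      then have "J (f1, g1) \<le> \<rho>" unfolding \<rho>_def by (rule p(2))
      moreover have "J (f1, g1) = wsum \<Omega> m (\<lambda>\<omega>. 1 / (F * G) * (f' (a \<omega>) * g' (b \<omega>)))"
        unfolding J_def by (rule wsum_cong) (simp add: f1_def g1_def)
      ultimately have "1 / (F * G) * wsum \<Omega> m (\<lambda>\<omega>. f' (a \<omega>) * g' (b \<omega>)) \<le> \<rho>" by (simp only: wsum_cmult)
      then show ?thesis using pos by (simp add: field_simps)
    qed
    then show "wsum \<Omega> m (\<lambda>\<omega>. f' (a \<omega>) * g' (b \<omega>))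
       \<le> \<rho> * (sqrt (wsum \<Omega> m (\<lambda>\<omega>. (f' (a \<omega>))\<^sup>2)) * sqrt (wsum \<Omega> m (\<lambda>\<omega>. (g' (b \<omega>))\<^sup>2)))"
      by (simp add: F_def G_def)
  qed
  moreover have "\<exists>f g. extremal_pair \<Omega> m a b \<rho> f g" if "0 < \<rho>"
  proof (intro exI)
    have pf: "wsum \<Omega> m (\<lambda>\<omega>. f (a \<omega>)) = 0" "wsum \<Omega> m (\<lambda>\<omega>. (f (a \<omega>))\<^sup>2) \<le> 1"
      "wsum \<Omega> m (\<lambda>\<omega>. g (b \<omega>)) = 0" "wsum \<Omega> m (\<lambda>\<omega>. (g (b \<omega>))\<^sup>2) \<le> 1"
      using p(1) by (auto simp: fg K_def L_def)
    have max: "wsum \<Omega> m (\<lambda>\<omega>. f (a \<omega>) * g (b \<omega>)) = \<rho>" by (simp add: \<rho>_def J_def fg)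
    then have max': "wsum \<Omega> m (\<lambda>\<omega>. g (b \<omega>) * f (a \<omega>)) = \<rho>" by (simp add: mult.commute)
    have "0 < wsum \<Omega> m (\<lambda>\<omega>. (f (a \<omega>))\<^sup>2)"
      using wsum_Cauchy_Schwarz[of "\<lambda>\<omega>. f (a \<omega>)" "\<lambda>\<omega>. g (b \<omega>)"] max that
        wsum_nonneg[of "\<lambda>\<omega>. (f (a \<omega>))\<^sup>2"]
      by (cases "wsum \<Omega> m (\<lambda>\<omega>. (f (a \<omega>))\<^sup>2) = 0") auto
    then show "extremal_pair \<Omega> m a b \<rho> f g"
      unfolding extremal_pair_def
      using pf maximizer_eigen[OF \<open>corr_le \<Omega> m a b \<rho>\<close> rho pf max]
        maximizer_eigen[OF corr_le_sym[OF \<open>corr_le \<Omega> m a b \<rho>\<close>] rho pf(3,4,1,2) max']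
      by auto
  qed
  ultimately show ?thesis using rho unfolding max_corr_def by blast
qed

text \<open>Both functions have the same norm, with square F, and their covariance is \<rho> F.
  Hence the squared distance between them is (2 - 2 \<rho>) F \<le> 0.\<close>

lemma extremal_pair_eq:
  assumes "extremal_pair \<Omega> m a b \<rho> f g" "1 \<le> \<rho>" "\<omega> \<in> \<Omega>"
  shows "f (a \<omega>) = g (b \<omega>)"
proof -
  define F where "F = wsum \<Omega> m (\<lambda>\<omega>. (f (a \<omega>))\<^sup>2)"
  have pos: "0 < F" using assms by (simp add: extremal_pair_def F_def)
  have fg: "wsum \<Omega> m (\<lambda>\<omega>. f (a \<omega>) * g (b \<omega>)) = \<rho> * F"
    and G: "wsum \<Omega> m (\<lambda>\<omega>. (g (b \<omega>))\<^sup>2) = F"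
    using extremal_pairD[OF assms(1)] assms(2) by (auto simp: F_def)
  have "wsum \<Omega> m (\<lambda>\<omega>. (f (a \<omega>) - g (b \<omega>))\<^sup>2)
      = wsum \<Omega> m (\<lambda>\<omega>. (f (a \<omega>))\<^sup>2 + ((g (b \<omega>))\<^sup>2 - 2 * (f (a \<omega>) * g (b \<omega>))))"
    by (intro wsum_cong) (simp add: power2_eq_square algebra_simps)
  also have "\<dots> = 2 * F - 2 * (\<rho> * F)"
    by (simp only: wsum_add wsum_diff wsum_cmult fg G F_def[symmetric])
  also have "\<dots> \<le> 0" using pos assms(2) by simp
  finally have "wsum \<Omega> m (\<lambda>\<omega>. (f (a \<omega>) - g (b \<omega>))\<^sup>2) \<le> 0" .
  from wsum_square_le_0[OF this assms(3)] show ?thesis by simp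
qed

text \<open>On a fibre of c, the centred function is at once a function of a and of b, so its
  covariance with itself is its variance F. The correlation bound gives F \<le> \<beta> F with
  \<beta> < 1, hence F = 0.\<close>

lemma eq_determined_by_fibre:
  assumes eq: "\<And>\<omega>. \<omega> \<in> \<Omega> \<Longrightarrow> f (a \<omega>) = g (b \<omega>)"
    and corr: "corr_le {\<omega>' \<in> \<Omega>. c \<omega>' = c \<omega>} m a b \<beta>" "\<beta> < 1" and w: "\<omega> \<in> \<Omega>"
  shows "f (a \<omega>) = cond_mean \<Omega> m c (\<lambda>\<omega>. f (a \<omega>)) (c \<omega>)"
proof -
  define \<Omega>' where "\<Omega>' = {\<omega>' \<in> \<Omega>. c \<omega>' = c \<omega>}"
  interpret r: weighted \<Omega>' m unfolding \<Omega>'_def by (rule restrict)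
  define k where "k = cond_mean \<Omega> m c (\<lambda>\<omega>. f (a \<omega>)) (c \<omega>)"
  have k: "wsum \<Omega>' m (\<lambda>\<omega>. f (a \<omega>) - k) = 0"
  proof -
    have "wsum \<Omega>' m (\<lambda>\<omega>'. cond_mean \<Omega> m c (\<lambda>\<omega>. f (a \<omega>)) (c \<omega>')) = wsum \<Omega>' m (\<lambda>\<omega>. f (a \<omega>))"
      unfolding \<Omega>'_def by (rule wsum_fibre_cond_mean) (use w in auto)
    moreover have "wsum \<Omega>' m (\<lambda>\<omega>'. cond_mean \<Omega> m c (\<lambda>\<omega>. f (a \<omega>)) (c \<omega>')) = wsum \<Omega>' m (\<lambda>_. k)"
      by (rule wsum_cong) (simp add: \<Omega>'_def k_def)
    ultimately show ?thesis by (simp add: wsum_diff)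
  qed
  have e: "wsum \<Omega>' m (\<lambda>\<omega>. g (b \<omega>) - k) = wsum \<Omega>' m (\<lambda>\<omega>. f (a \<omega>) - k)"
    "wsum \<Omega>' m (\<lambda>\<omega>. (g (b \<omega>) - k)\<^sup>2) = wsum \<Omega>' m (\<lambda>\<omega>. (f (a \<omega>) - k)\<^sup>2)"
    "wsum \<Omega>' m (\<lambda>\<omega>. (f (a \<omega>) - k) * (g (b \<omega>) - k)) = wsum \<Omega>' m (\<lambda>\<omega>. (f (a \<omega>) - k)\<^sup>2)"
    by (rule wsum_cong, simp add: \<Omega>'_def eq power2_eq_square)+
  define F where "F = wsum \<Omega>' m (\<lambda>\<omega>. (f (a \<omega>) - k)\<^sup>2)"
  have Fnn: "0 \<le> F" unfolding F_def by (rule r.wsum_nonneg) simp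
  have "F \<le> \<beta> * (sqrt F * sqrt F)"
    using corr(1)[folded \<Omega>'_def, unfolded corr_le_def, rule_format, of "\<lambda>x. f x - k" "\<lambda>x. g x - k"]
    by (simp add: e k F_def del: real_sqrt_mult_self)
  then have "(1 - \<beta>) * F \<le> 0" using Fnn by (simp add: left_diff_distrib)
  then have "F \<le> 0" using corr(2) by (simp add: mult_le_0_iff)
  then show ?thesis
    using r.wsum_square_le_0[of "\<lambda>\<omega>. f (a \<omega>) - k" \<omega>] w by (simp add: F_def k_def \<Omega>'_def)
qed

text \<open>Splitting a covariance along the fibres of \<open>c\<close>: conditional covariances plus the covariance of
  the conditional means.\<close>

lemma corr_via_fibres:
  assumes beta: "0 \<le> \<beta>" and fib: "\<And>x. x \<in> c ` \<Omega> \<Longrightarrow> corr_le {\<omega> \<in> \<Omega>. c \<omega> = x} m a b \<beta>"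
    and ac: "corr_le \<Omega> m a c \<rho>\<^sub>1" "0 \<le> \<rho>\<^sub>1" and bc: "corr_le \<Omega> m b c \<rho>\<^sub>2" "0 \<le> \<rho>\<^sub>2"
    and f: "wsum \<Omega> m (\<lambda>\<omega>. f (a \<omega>)) = 0" "wsum \<Omega> m (\<lambda>\<omega>. (f (a \<omega>))\<^sup>2) = 1"
    and g: "wsum \<Omega> m (\<lambda>\<omega>. g (b \<omega>)) = 0" "wsum \<Omega> m (\<lambda>\<omega>. (g (b \<omega>))\<^sup>2) = 1"
  obtains s t where "0 \<le> s" "s \<le> \<rho>\<^sub>1" "0 \<le> t" "t \<le> \<rho>\<^sub>2"
    "wsum \<Omega> m (\<lambda>\<omega>. f (a \<omega>) * g (b \<omega>)) \<le> s * t + \<beta> * (sqrt (1 - s\<^sup>2) * sqrt (1 - t\<^sup>2))"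
proof -
  define M where "M F = cond_mean \<Omega> m c F" for F
  \<comment> \<open>The witnesses are s = N F and t = N G, the norms of the conditional means given
    c; the residuals then have variances 1 - s^2 and 1 - t^2. Testing \<open>corr_le\<close> against
    the conditional mean, itself a function of c, yields s \<le> \<open>\<rho>\<^sub>1\<close> and t
    \<le> \<open>\<rho>\<^sub>2\<close>.\<close>
  define N where "N F = sqrt (wsum \<Omega> m (\<lambda>\<omega>. (M F (c \<omega>))\<^sup>2))" for F
  have N2: "(N F)\<^sup>2 = wsum \<Omega> m (\<lambda>\<omega>. (M F (c \<omega>))\<^sup>2)" "0 \<le> N F" for F
    by (auto simp: N_def intro!: wsum_nonneg)
  have MM: "wsum \<Omega> m (\<lambda>\<omega>. F \<omega> * M G (c \<omega>)) = wsum \<Omega> m (\<lambda>\<omega>. M F (c \<omega>) * M G (c \<omega>))" for F G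
    using tower[of "M G" c F] by (simp add: M_def mult.commute)
  have NF: "N (\<lambda>\<omega>. h (d \<omega>)) \<le> \<rho>"
    if "corr_le \<Omega> m d c \<rho>" "0 \<le> \<rho>" "wsum \<Omega> m (\<lambda>\<omega>. h (d \<omega>)) = 0" "wsum \<Omega> m (\<lambda>\<omega>. (h (d \<omega>))\<^sup>2) = 1"
    for d :: "'o \<Rightarrow> 'z" and h \<rho>
  proof -
    define F where "F = (\<lambda>\<omega>. h (d \<omega>))"
    have "(N F)\<^sup>2 = wsum \<Omega> m (\<lambda>\<omega>. h (d \<omega>) * M F (c \<omega>))"
      using MM[of F F] unfolding N2 by (simp add: F_def power2_eq_square)
    also have "\<dots> \<le> \<rho> * (sqrt 1 * N F)"
      using that(1)[unfolded corr_le_def, rule_format, of h "M F"] that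
      by (simp add: N_def F_def M_def wsum_cond_mean)
    finally have "N F * N F \<le> \<rho> * N F" by (simp add: power2_eq_square)
    then show ?thesis using N2(2)[of F] that(2) unfolding F_def[symmetric]
      by (cases "N F = 0") auto
  qed
  have res: "wsum \<Omega> m (\<lambda>\<omega>. (F \<omega> - M F (c \<omega>)) * (G \<omega> - M G (c \<omega>)))
      = wsum \<Omega> m (\<lambda>\<omega>. F \<omega> * G \<omega>) - wsum \<Omega> m (\<lambda>\<omega>. M F (c \<omega>) * M G (c \<omega>))" for F G
  proof -
    have "wsum \<Omega> m (\<lambda>\<omega>. (F \<omega> - M F (c \<omega>)) * (G \<omega> - M G (c \<omega>)))
      = wsum \<Omega> m (\<lambda>\<omega>. F \<omega> * G \<omega> + M F (c \<omega>) * M G (c \<omega>) - F \<omega> * M G (c \<omega>) - G \<omega> * M F (c \<omega>))"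
      by (rule wsum_cong) (simp add: algebra_simps)
    moreover have "wsum \<Omega> m (\<lambda>\<omega>. G \<omega> * M F (c \<omega>)) = wsum \<Omega> m (\<lambda>\<omega>. M F (c \<omega>) * M G (c \<omega>))"
      unfolding MM[of G F] by (rule wsum_cong) (rule mult.commute)
    ultimately show ?thesis unfolding wsum_diff wsum_add MM[of F G] by simp
  qed
  define F where "F = (\<lambda>\<omega>. f (a \<omega>))"
  define G where "G = (\<lambda>\<omega>. g (b \<omega>))"
  define E where "E x = wsum {\<omega> \<in> \<Omega>. c \<omega> = x} m" for x
  have Esplit: "wsum \<Omega> m H = (\<Sum>x\<in>c ` \<Omega>. E x H)" for H
    unfolding E_def by (rule wsum_by_fibres)
  have fibre: "E x (\<lambda>\<omega>. (F \<omega> - M F (c \<omega>)) * (G \<omega> - M G (c \<omega>)))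
      \<le> \<beta> * (sqrt (E x (\<lambda>\<omega>. (F \<omega> - M F (c \<omega>))\<^sup>2)) * sqrt (E x (\<lambda>\<omega>. (G \<omega> - M G (c \<omega>))\<^sup>2)))"
    if x: "x \<in> c ` \<Omega>" for x
  proof -
    have zero: "E x (\<lambda>\<omega>. H \<omega> - M H x) = 0" for H
    proof -
      have "E x (\<lambda>\<omega>. H \<omega> - M H x) = E x (\<lambda>\<omega>. H \<omega> - M H (c \<omega>))"
        unfolding E_def by (rule wsum_cong) simp
      also have "\<dots> = 0" using wsum_fibre_cond_mean[OF x, of H] by (simp add: E_def M_def wsum_diff)
      finally show ?thesis .
    qed
    have "E x (\<lambda>\<omega>. (F \<omega> - M F x) * (G \<omega> - M G x))
      \<le> \<beta> * (sqrt (E x (\<lambda>\<omega>. (F \<omega> - M F x)\<^sup>2)) * sqrt (E x (\<lambda>\<omega>. (G \<omega> - M G x)\<^sup>2)))"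
      using fib[OF x, unfolded corr_le_def, rule_format, of "\<lambda>z. f z - M F x" "\<lambda>z. g z - M G x"]
        zero[of F] zero[of G] by (simp add: E_def F_def G_def)
    moreover have "E x (\<lambda>\<omega>. (F \<omega> - M F x) * (G \<omega> - M G x)) = E x (\<lambda>\<omega>. (F \<omega> - M F (c \<omega>)) * (G \<omega> - M G (c \<omega>)))"
      "E x (\<lambda>\<omega>. (H \<omega> - M H x)\<^sup>2) = E x (\<lambda>\<omega>. (H \<omega> - M H (c \<omega>))\<^sup>2)" for H
      unfolding E_def by (rule wsum_cong, simp)+
    ultimately show ?thesis by simp
  qed
  have Enn: "0 \<le> E x (\<lambda>\<omega>. (H \<omega>)\<^sup>2)" for x H
    unfolding E_def by (intro weighted.wsum_nonneg[OF restrict]) simp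
  have var: "wsum \<Omega> m (\<lambda>\<omega>. (H \<omega> - M H (c \<omega>))\<^sup>2) = wsum \<Omega> m (\<lambda>\<omega>. (H \<omega>)\<^sup>2) - (N H)\<^sup>2" for H
    using res[of H H] by (simp add: power2_eq_square N2(1)[unfolded power2_eq_square])
  have "wsum \<Omega> m (\<lambda>\<omega>. (F \<omega> - M F (c \<omega>)) * (G \<omega> - M G (c \<omega>)))
    \<le> (\<Sum>x\<in>c ` \<Omega>. \<beta> * (sqrt (E x (\<lambda>\<omega>. (F \<omega> - M F (c \<omega>))\<^sup>2)) * sqrt (E x (\<lambda>\<omega>. (G \<omega> - M G (c \<omega>))\<^sup>2))))"
    unfolding Esplit by (intro sum_mono fibre)
  also have "\<dots> = \<beta> * (\<Sum>x\<in>c ` \<Omega>. sqrt (E x (\<lambda>\<omega>. (F \<omega> - M F (c \<omega>))\<^sup>2)) * sqrt (E x (\<lambda>\<omega>. (G \<omega> - M G (c \<omega>))\<^sup>2)))"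
    by (simp add: sum_distrib_left)
  also have "\<dots> \<le> \<beta> * (sqrt (\<Sum>x\<in>c ` \<Omega>. E x (\<lambda>\<omega>. (F \<omega> - M F (c \<omega>))\<^sup>2)) * sqrt (\<Sum>x\<in>c ` \<Omega>. E x (\<lambda>\<omega>. (G \<omega> - M G (c \<omega>))\<^sup>2)))"
  proof (intro mult_left_mono beta)
    have "(\<Sum>x\<in>c ` \<Omega>. sqrt (P x) * sqrt (Q x))\<^sup>2 \<le> sum P (c ` \<Omega>) * sum Q (c ` \<Omega>)"
      if "\<And>x. 0 \<le> P x" "\<And>x. 0 \<le> Q x" for P Q :: "_ \<Rightarrow> real"
      using Cauchy_Schwarz_ineq_sum[of "\<lambda>x. sqrt (P x)" "\<lambda>x. sqrt (Q x)" "c ` \<Omega>"] that by simp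
    then show "(\<Sum>x\<in>c ` \<Omega>. sqrt (E x (\<lambda>\<omega>. (F \<omega> - M F (c \<omega>))\<^sup>2)) * sqrt (E x (\<lambda>\<omega>. (G \<omega> - M G (c \<omega>))\<^sup>2)))
      \<le> sqrt (\<Sum>x\<in>c ` \<Omega>. E x (\<lambda>\<omega>. (F \<omega> - M F (c \<omega>))\<^sup>2)) * sqrt (\<Sum>x\<in>c ` \<Omega>. E x (\<lambda>\<omega>. (G \<omega> - M G (c \<omega>))\<^sup>2))"
      using Enn by (simp add: real_le_rsqrt flip: real_sqrt_mult)
  qed
  also have "\<dots> = \<beta> * (sqrt (1 - (N F)\<^sup>2) * sqrt (1 - (N G)\<^sup>2))"
    unfolding Esplit[symmetric] var using f g by (simp add: F_def G_def)
  finally have "wsum \<Omega> m (\<lambda>\<omega>. F \<omega> * G \<omega>)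
     \<le> wsum \<Omega> m (\<lambda>\<omega>. M F (c \<omega>) * M G (c \<omega>)) + \<beta> * (sqrt (1 - (N F)\<^sup>2) * sqrt (1 - (N G)\<^sup>2))"
    unfolding res by simp
  also have "wsum \<Omega> m (\<lambda>\<omega>. M F (c \<omega>) * M G (c \<omega>)) \<le> N F * N G"
    unfolding N_def by (rule wsum_Cauchy_Schwarz)
  finally show ?thesis
    using that[of "N F" "N G"] N2(2) NF[OF ac f] NF[OF bc g] by (simp add: F_def G_def)
qed

text \<open>Both members of an extremal pair with \<rho> > 0 have the same norm, so a single factor
  k normalises them and turns the covariance into \<rho>.\<close>

lemma extremal_pair_via_fibres:
  assumes beta: "0 \<le> \<beta>" and fib: "\<And>x. x \<in> c ` \<Omega> \<Longrightarrow> corr_le {\<omega> \<in> \<Omega>. c \<omega> = x} m a b \<beta>"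
    and ac: "corr_le \<Omega> m a c \<rho>\<^sub>1" "0 \<le> \<rho>\<^sub>1" and bc: "corr_le \<Omega> m b c \<rho>\<^sub>2" "0 \<le> \<rho>\<^sub>2"
    and fg: "extremal_pair \<Omega> m a b \<rho> f g" and rho: "0 < \<rho>"
  obtains s t where "0 \<le> s" "s \<le> \<rho>\<^sub>1" "0 \<le> t" "t \<le> \<rho>\<^sub>2"
    "\<rho> \<le> s * t + \<beta> * (sqrt (1 - s\<^sup>2) * sqrt (1 - t\<^sup>2))"
proof -
  define F where "F = wsum \<Omega> m (\<lambda>\<omega>. (f (a \<omega>))\<^sup>2)"
  have F: "0 < F" using fg by (simp add: F_def extremal_pair_def)
  have G: "wsum \<Omega> m (\<lambda>\<omega>. (g (b \<omega>))\<^sup>2) = F" and FG: "wsum \<Omega> m (\<lambda>\<omega>. f (a \<omega>) * g (b \<omega>)) = \<rho> * F"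
    using extremal_pairD[OF fg] rho by (auto simp: F_def)
  define k where "k = 1 / sqrt F"
  have k: "k * k * F = 1" using F by (simp add: k_def)
  have k2: "k\<^sup>2 * F = 1" using k by (simp add: power2_eq_square)
  have n: "wsum \<Omega> m (\<lambda>\<omega>. k * f (a \<omega>)) = 0" "wsum \<Omega> m (\<lambda>\<omega>. k * g (b \<omega>)) = 0"
    "wsum \<Omega> m (\<lambda>\<omega>. (k * f (a \<omega>))\<^sup>2) = 1" "wsum \<Omega> m (\<lambda>\<omega>. (k * g (b \<omega>))\<^sup>2) = 1"
    using fg by (simp_all only: power_mult_distrib wsum_cmult G F_def[symmetric] k2 extremal_pair_def mult_zero_right)
  have "wsum \<Omega> m (\<lambda>\<omega>. (k * f (a \<omega>)) * (k * g (b \<omega>))) = wsum \<Omega> m (\<lambda>\<omega>. (k * k) * (f (a \<omega>) * g (b \<omega>)))"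
    by (rule wsum_cong) simp
  also have "\<dots> = \<rho>" unfolding wsum_cmult FG using k by (simp add: mult_ac)
  finally show thesis
    using corr_via_fibres[OF beta fib ac bc n(1,3,2,4)] that by metis
qed

lemma corr_le_mono:
  assumes "corr_le \<Omega> m a b c" "c \<le> c'"
  shows "corr_le \<Omega> m a b c'"
  unfolding corr_le_def
proof (intro allI impI)
  fix f g assume fg: "wsum \<Omega> m (\<lambda>\<omega>. f (a \<omega>)) = 0" "wsum \<Omega> m (\<lambda>\<omega>. g (b \<omega>)) = 0"
  define R where "R = sqrt (wsum \<Omega> m (\<lambda>\<omega>. (f (a \<omega>))\<^sup>2)) * sqrt (wsum \<Omega> m (\<lambda>\<omega>. (g (b \<omega>))\<^sup>2))"
  have "0 \<le> R" unfolding R_def by (intro mult_nonneg_nonneg) (auto intro!: wsum_nonneg)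
  then have "c * R \<le> c' * R" using assms(2) by (intro mult_right_mono)
  moreover have "wsum \<Omega> m (\<lambda>\<omega>. f (a \<omega>) * g (b \<omega>)) \<le> c * R"
    using assms(1)[unfolded corr_le_def, rule_format, OF fg] by (simp add: R_def)
  ultimately show "wsum \<Omega> m (\<lambda>\<omega>. f (a \<omega>) * g (b \<omega>)) \<le> c' * (sqrt (wsum \<Omega> m (\<lambda>\<omega>. (f (a \<omega>))\<^sup>2)) * sqrt (wsum \<Omega> m (\<lambda>\<omega>. (g (b \<omega>))\<^sup>2)))"
    by (simp add: R_def)
qed

end

section \<open>Second eigenvalues of bipartite walks\<close>

lemma eigenvalue_mat_iff:
  fixes A :: "nat \<Rightarrow> nat \<Rightarrow> real"
  shows "eigenvalue (Matrix.mat n n (\<lambda>(i, j). A i j)) k \<longleftrightarrow>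
    (\<exists>w. (\<exists>i<n. w i \<noteq> 0) \<and> (\<forall>i<n. (\<Sum>j<n. A i j * w j) = k * w i))"  (is "?L \<longleftrightarrow> ?R")
proof
  assume ?L
  then obtain v where v: "v \<in> carrier_vec n" "v \<noteq> 0\<^sub>v n"
    and eq: "Matrix.mat n n (\<lambda>(i, j). A i j) *\<^sub>v v = k \<cdot>\<^sub>v v"
    unfolding eigenvalue_def eigenvector_def by auto
  have "\<exists>i<n. vec_index v i \<noteq> 0"
  proof (rule ccontr)
    assume "\<not> (\<exists>i<n. vec_index v i \<noteq> 0)"
    then have "v = 0\<^sub>v n" using v(1) by (intro eq_vecI) auto
    then show False using v(2) by simp
  qed
  moreover have "(\<Sum>j<n. A i j * vec_index v j) = k * vec_index v i" if "i < n" for i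
    using arg_cong[OF eq, of "\<lambda>u. vec_index u i"] v(1) that
    by (simp add: scalar_prod_def atLeast0LessThan)
  ultimately show ?R by blast
next
  assume ?R
  then obtain w where w: "\<exists>i<n. w i \<noteq> 0" "\<forall>i<n. (\<Sum>j<n. A i j * w j) = k * w i" by blast
  have "Matrix.vec n w \<noteq> 0\<^sub>v n"
    using w(1) by (metis index_vec index_zero_vec(1))
  moreover have "Matrix.mat n n (\<lambda>(i, j). A i j) *\<^sub>v Matrix.vec n w = k \<cdot>\<^sub>v Matrix.vec n w"
    using w(2) by (intro eq_vecI) (auto simp: scalar_prod_def atLeast0LessThan)
  ultimately show ?L unfolding eigenvalue_def eigenvector_def by (intro exI[of _ "Matrix.vec n w"]) auto
qed

text \<open>If the rows of \<open>A\<close> sum to \<open>1\<close>, conjugation makes the all-ones vector the first basis vector and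
  brings \<open>A\<close> into the form \<open>[1, r; 0, A']\<close>.  A double root \<open>1\<close> of the characteristic polynomial is
  then an eigenvalue of \<open>A'\<close>.\<close>

lemma double_root_1:
  fixes A :: "nat \<Rightarrow> nat \<Rightarrow> real"
  assumes rows: "\<And>i. i < n \<Longrightarrow> (\<Sum>j<n. A i j) = 1"
    and order: "2 \<le> order 1 (char_poly (Matrix.mat n n (\<lambda>(i, j). A i j)))"
  shows "\<exists>w c. w 0 = 0 \<and> (\<exists>i<n. w i \<noteq> 0) \<and> (\<forall>i<n. (\<Sum>j<n. A i j * w j) = w i + c)"
proof -
  define M where "M = Matrix.mat n n (\<lambda>(i, j). A i j)"
  have M: "M \<in> carrier_mat n n" by (simp add: M_def)
  have "n \<noteq> 0"
  proof
    assume "n = 0"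
    then have "degree (char_poly M) = 0" "char_poly M \<noteq> 0"
      using degree_monic_char_poly[OF M] by auto
    then have "order 1 (char_poly M) = 0" using order_degree[of "char_poly M" 1] by simp
    then show False using order by (simp add: M_def)
  qed
  then obtain k where k: "n = Suc k" by (cases n) auto
  define r where "r = Matrix.mat 1 k (\<lambda>(i, j). A 0 (Suc j))"
  define A' where "A' = Matrix.mat k k (\<lambda>(i, j). A (Suc i) (Suc j) - A 0 (Suc j))"
  define u where "u = Matrix.mat k 1 (\<lambda>(i, j). 1 :: real)"
  define u' where "u' = Matrix.mat k 1 (\<lambda>(i, j). - 1 :: real)"
  define D where "D = four_block_mat (1\<^sub>m 1) r (0\<^sub>m k 1) A'"
  define P where "P = four_block_mat (1\<^sub>m 1) (0\<^sub>m 1 k) u (1\<^sub>m k)"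
  define Q where "Q = four_block_mat (1\<^sub>m 1) (0\<^sub>m 1 k) u' (1\<^sub>m k)"
  have carr: "r \<in> carrier_mat 1 k" "A' \<in> carrier_mat k k" "u \<in> carrier_mat k 1" "u' \<in> carrier_mat k 1"
    by (auto simp: r_def A'_def u_def u'_def)
  have one: "four_block_mat (1\<^sub>m 1) (0\<^sub>m 1 k) (0\<^sub>m k 1) (1\<^sub>m k) = (1\<^sub>m n :: real mat)"
    by (rule eq_matI) (auto simp: four_block_mat_def k)
  have uu: "u + u' = 0\<^sub>m k 1" "u' + u = 0\<^sub>m k 1" by (rule eq_matI; simp add: u_def u'_def)+
  have PQ: "P * Q = 1\<^sub>m n"
    unfolding P_def Q_def
    by (subst mult_four_block_mat[of _ 1 1 _ k _ k _ _ 1 _ k]) (use carr uu one in auto)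
  have QP: "Q * P = 1\<^sub>m n"
    unfolding P_def Q_def
    by (subst mult_four_block_mat[of _ 1 1 _ k _ k _ _ 1 _ k]) (use carr uu one in auto)
  have PD: "P * D = four_block_mat (1\<^sub>m 1) r u (u * r + A')"
    unfolding P_def D_def
    by (subst mult_four_block_mat[of _ 1 1 _ k _ k _ _ 1 _ k]) (use carr in auto)
  have PDQ: "P * D * Q = four_block_mat (1\<^sub>m 1 + r * u') r (u + (u * r + A') * u') (u * r + A')"
    unfolding PD Q_def
    by (subst mult_four_block_mat[of _ 1 1 _ k _ k _ _ 1 _ k]) (use carr in auto)
  have urA: "u * r + A' = Matrix.mat k k (\<lambda>(i, j). A (Suc i) (Suc j))"
    by (rule eq_matI) (auto simp: u_def r_def A'_def scalar_prod_def)
  have rows': "A i 0 = 1 - (\<Sum>j<k. A i (Suc j))" if "i < n" for i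
    using rows[OF that] by (simp add: k sum.lessThan_Suc_shift del: sum.lessThan_Suc)
  have "M = P * D * Q"
    unfolding PDQ urA
    by (rule eq_matI)
      (auto simp: M_def k four_block_mat_def r_def u_def u'_def scalar_prod_def rows' atLeast0LessThan
        sum_negf less_Suc_eq_0_disj)
  then have "char_poly M = char_poly D"
    using M PQ QP by (intro char_poly_similar similar_matI[of _ _ P Q n])
      (auto simp: P_def Q_def D_def k A'_def)
  also have "\<dots> = char_poly (1\<^sub>m 1) * char_poly A'"
    unfolding D_def by (rule char_poly_four_block_zeros_col) (use carr in auto)
  also have "char_poly (1\<^sub>m 1) = [:- 1, 1 :: real:]"
    by (simp add: char_poly_defs det_def sign_def)
  finally have cp: "char_poly M = [:- 1, 1:] * char_poly A'" .
  have nz: "char_poly A' \<noteq> 0" using degree_monic_char_poly[OF carr(2)] by auto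
  then have "order 1 (char_poly M) = order 1 [:- 1, 1 :: real:] + order 1 (char_poly A')"
    unfolding cp by (intro order_mult) (simp only: mult_eq_0_iff, simp)
  also have "order 1 [:- 1, 1 :: real:] = 1" using order_power_n_n[of 1 1] by simp
  finally have "order 1 (char_poly A') \<noteq> 0" using order by (simp add: M_def)
  then have "eigenvalue A' 1"
    using nz by (simp add: eigenvalue_root_char_poly[OF carr(2)] order_root)
  then obtain v where v: "\<exists>i<k. v i \<noteq> 0"
    "\<forall>i<k. (\<Sum>j<k. (A (Suc i) (Suc j) - A 0 (Suc j)) * v j) = 1 * v i"
    unfolding A'_def eigenvalue_mat_iff by blast
  \<comment> \<open>The eigenvector of A' is extended by 0 at the first coordinate, which makes w
    nonconstant. It is an eigenvector of the original matrix only modulo constants: c \<noteq> 0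
    corresponds to a Jordan block, which is excluded later by reversibility.\<close>
  define w where "w = (\<lambda>i. case i of 0 \<Rightarrow> 0 | Suc j \<Rightarrow> v j)"
  define c where "c = (\<Sum>j<k. A 0 (Suc j) * v j)"
  have s: "(\<Sum>j<n. A i j * w j) = (\<Sum>j<k. A i (Suc j) * v j)" for i
    by (simp add: k sum.lessThan_Suc_shift w_def del: sum.lessThan_Suc)
  have "(\<Sum>j<n. A i j * w j) = w i + c" if "i < n" for i
  proof (cases i)
    case 0
    then show ?thesis by (simp add: s c_def) (simp add: w_def)
  next
    case (Suc i')
    then have "(\<Sum>j<k. A i (Suc j) * v j) - c = v i'"
      using v(2) that by (simp add: c_def k left_diff_distrib sum_subtractf)
    then show ?thesis by (simp add: s Suc) (simp add: w_def)
  qed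
  moreover obtain i where "i < k" "v i \<noteq> 0" using v(1) by blast
  then have "\<exists>i<n. w i \<noteq> 0" by (intro exI[of _ "Suc i"]) (simp add: w_def k)
  moreover have "w 0 = 0" by (simp add: w_def)
  ultimately show ?thesis by blast
qed

section \<open>Entries of the eigenvalue list and eigenfunctions\<close>

definition eigenfunction :: "'a set \<Rightarrow> ('a \<Rightarrow> 'a \<Rightarrow> real) \<Rightarrow> real \<Rightarrow> ('a \<Rightarrow> real) \<Rightarrow> bool" where
  "eigenfunction N P k h \<longleftrightarrow> (\<exists>x\<in>N. h x \<noteq> 0) \<and> (\<forall>x\<in>N. (\<Sum>y\<in>N. P x y * h y) = k * h x)"

lemma indexed_mat_enum:
  assumes "finite N"
  obtains e where "bij_betw e {..<card N} N"
    "\<And>P. indexed_mat N P = Matrix.mat (card N) (card N) (\<lambda>(i, j). P (e i) (e j))"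
proof -
  have "\<exists>e. bij_betw e {..<card N} N"
    using ex_bij_betw_nat_finite[OF assms] by (simp add: atLeast0LessThan)
  then have "bij_betw (SOME e. bij_betw e {..<card N} N) {..<card N} N" by (rule someI_ex)
  then show thesis using that by (simp add: indexed_mat_def Let_def)
qed

lemma indexed_mat_cong:
  assumes "finite N" "\<And>x y. x \<in> N \<Longrightarrow> y \<in> N \<Longrightarrow> P x y = P' x y"
  shows "indexed_mat N P = indexed_mat N P'"
proof -
  obtain e where e: "bij_betw e {..<card N} N"
    "\<And>P. indexed_mat N P = Matrix.mat (card N) (card N) (\<lambda>(i, j). P (e i) (e j))"
    using indexed_mat_enum[OF assms(1)] by blast
  have "e i \<in> N" if "i < card N" for i using e(1) that by (auto simp: bij_betw_def)
  then show ?thesis unfolding e(2) using assms(2) by (intro eq_matI) auto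
qed

lemma lambda2_srw_cong:
  assumes "finite N" "\<And>x y. x \<in> N \<Longrightarrow> y \<in> N \<Longrightarrow> w x y = w' x y"
  shows "lambda2 N (srw N w) = lambda2 N (srw N w')"
proof -
  have "indexed_mat N (srw N w) = indexed_mat N (srw N w')"
    using assms by (intro indexed_mat_cong) (auto simp: srw_def intro!: arg_cong2[where f = "(/)"] sum.cong)
  then show ?thesis by (simp add: lambda2_def)
qed

lemma set_eigenvalues:
  assumes "finite N"
  shows "k \<in> set (eigenvalues (indexed_mat N P)) \<longleftrightarrow> (\<exists>h. eigenfunction N P k h)"
proof -
  obtain e where e: "bij_betw e {..<card N} N"
    "\<And>P. indexed_mat N P = Matrix.mat (card N) (card N) (\<lambda>(i, j). P (e i) (e j))"
    using indexed_mat_enum[OF assms(1)] by blast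
  define n where "n = card N"
  have img: "e ` {..<n} = N" and inj: "inj_on e {..<n}" using e(1) by (auto simp: bij_betw_def n_def)
  have c: "indexed_mat N P \<in> carrier_mat n n" by (simp add: e n_def)
  have nz: "char_poly (indexed_mat N P) \<noteq> 0" using degree_monic_char_poly[OF c] by auto
  have sums: "(\<Sum>y\<in>N. F y) = (\<Sum>j<n. F (e j))" for F :: "_ \<Rightarrow> real"
    using sum.reindex_bij_betw[OF e(1), of F] by (simp add: n_def)
  have "k \<in> set (eigenvalues (indexed_mat N P)) \<longleftrightarrow> eigenvalue (indexed_mat N P) k"
    using nz by (simp add: eigenvalues_def eigenvalue_root_char_poly[OF c])
  also have "\<dots> \<longleftrightarrow> (\<exists>w. (\<exists>i<n. w i \<noteq> 0) \<and> (\<forall>i<n. (\<Sum>j<n. P (e i) (e j) * w j) = k * w i))"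
    unfolding e(2) n_def by (rule eigenvalue_mat_iff)
  also have "\<dots> \<longleftrightarrow> (\<exists>h. eigenfunction N P k h)"
  proof
    assume "\<exists>w. (\<exists>i<n. w i \<noteq> 0) \<and> (\<forall>i<n. (\<Sum>j<n. P (e i) (e j) * w j) = k * w i)"
    then obtain w where w: "\<exists>i<n. w i \<noteq> 0" "\<forall>i<n. (\<Sum>j<n. P (e i) (e j) * w j) = k * w i" by blast
    define h where "h x = w (inv_into {..<n} e x)" for x
    have he: "h (e i) = w i" if "i < n" for i using inj that by (simp add: h_def)
    have "eigenfunction N P k h"
      unfolding eigenfunction_def sums using w img he by (auto simp: img[symmetric])
    then show "\<exists>h. eigenfunction N P k h" by blast
  next
    assume "\<exists>h. eigenfunction N P k h"
    then obtain h where "eigenfunction N P k h" by blast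
    then show "\<exists>w. (\<exists>i<n. w i \<noteq> 0) \<and> (\<forall>i<n. (\<Sum>j<n. P (e i) (e j) * w j) = k * w i)"
      unfolding eigenfunction_def sums using img by (intro exI[of _ "\<lambda>i. h (e i)"]) auto
  qed
  finally show ?thesis .
qed

lemma sorted_eigenvalues: "sorted_wrt (\<ge>) (eigenvalues A)"
  by (simp add: eigenvalues_def sorted_wrt_rev)

text \<open>The descending list contains the larger number l, so k occurs at index 1 or
  later.\<close>

lemma eigenvalue_le_lambda2:
  assumes "finite N" "eigenfunction N P k h" "eigenfunction N P l g" "k < l"
  shows "k \<le> lambda2 N P"
proof -
  define L where "L = eigenvalues (indexed_mat N P)"
  obtain i where i: "i < length L" "L ! i = k"
    using set_eigenvalues[OF assms(1)] assms(2) by (metis L_def in_set_conv_nth)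
  obtain j where j: "j < length L" "L ! j = l"
    using set_eigenvalues[OF assms(1)] assms(3) by (metis L_def in_set_conv_nth)
  have "i \<noteq> 0"
  proof
    assume "i = 0"
    then have "j > 0" using i j assms(4) by (cases j) auto
    then have "L ! j \<le> L ! i"
      using sorted_wrt_nth_less[OF sorted_eigenvalues[of "indexed_mat N P"], of i j] i j \<open>i = 0\<close> by (simp add: L_def)
    then show False using i j assms(4) by simp
  qed
  then have "i = 1 \<or> 1 < i" by auto
  then show ?thesis
    using sorted_wrt_nth_less[OF sorted_eigenvalues[of "indexed_mat N P"], of 1 i] i
    by (auto simp: L_def lambda2_def)
qed

text \<open>If the entry at index 1 exceeded C, then so would the one at index 0, and by
  \<open>le\<close> both would be 1. The double root yields a function as in \<open>le1\<close>. The
  eigenvalue -1 ensures that the list has at least two entries, so that index 1 is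
  meaningful.\<close>

lemma lambda2_le:
  assumes fin: "finite N" and rows: "\<And>x. x \<in> N \<Longrightarrow> (\<Sum>y\<in>N. P x y) = 1"
    and minus: "eigenfunction N P (- 1) s" and "0 \<le> C"
    and le: "\<And>k h. eigenfunction N P k h \<Longrightarrow> 0 < k \<Longrightarrow> k \<noteq> 1 \<Longrightarrow> k \<le> C"
    and le1: "\<And>h c x y. x \<in> N \<Longrightarrow> y \<in> N \<Longrightarrow> h x \<noteq> h y \<Longrightarrow> (\<And>z. z \<in> N \<Longrightarrow> (\<Sum>y\<in>N. P z y * h y) = h z + c) \<Longrightarrow> 1 \<le> C"
  shows "lambda2 N P \<le> C"
proof (rule ccontr)
  assume contra: "\<not> lambda2 N P \<le> C"
  define L where "L = eigenvalues (indexed_mat N P)"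
  have L: "k \<in> set L \<longleftrightarrow> (\<exists>h. eigenfunction N P k h)" for k
    unfolding L_def by (rule set_eigenvalues[OF fin])
  obtain x where "x \<in> N" using minus by (auto simp: eigenfunction_def)
  then have "eigenfunction N P 1 (\<lambda>_. 1)" using rows by (auto simp: eigenfunction_def)
  then have "{1, - 1} \<subseteq> set L" using L minus by auto
  then have "card {1, - 1 :: real} \<le> card (set L)" by (intro card_mono) auto
  then have len: "2 \<le> length L" using card_length[of L] by simp
  then obtain a b L' where Lab: "L = a # b # L'" by (cases L; cases "tl L") auto
  have b: "b = lambda2 N P" by (simp add: lambda2_def L_def[symmetric] Lab)
  have "b \<le> a" using sorted_eigenvalues[of "indexed_mat N P"] Lab by (simp add: L_def[symmetric])
  have "a = 1" "b = 1"
  proof -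
    have *: "k = 1" if "k \<in> set L" "C < k" for k
      using that L le \<open>0 \<le> C\<close> by fastforce
    show "a = 1" "b = 1" using *[of a] *[of b] contra b \<open>b \<le> a\<close> by (auto simp: Lab)
  qed
  obtain e where e: "bij_betw e {..<card N} N"
    "\<And>P. indexed_mat N P = Matrix.mat (card N) (card N) (\<lambda>(i, j). P (e i) (e j))"
    using indexed_mat_enum[OF fin] by blast
  define n where "n = card N"
  have img: "e ` {..<n} = N" and inj: "inj_on e {..<n}" using e(1) by (auto simp: bij_betw_def n_def)
  have sums: "(\<Sum>y\<in>N. F y) = (\<Sum>j<n. F (e j))" for F :: "_ \<Rightarrow> real"
    using sum.reindex_bij_betw[OF e(1), of F] by (simp add: n_def)
  have c: "indexed_mat N P \<in> carrier_mat n n" by (simp add: e n_def)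
  have nz: "char_poly (indexed_mat N P) \<noteq> 0" using degree_monic_char_poly[OF c] by auto
  have "mset L = proots (char_poly (indexed_mat N P))" by (simp add: L_def eigenvalues_def)
  then have "order 1 (char_poly (indexed_mat N P)) = count (mset L) 1" using nz by simp
  then have order1: "2 \<le> order 1 (char_poly (Matrix.mat n n (\<lambda>(i, j). P (e i) (e j))))"
    using e(2)[of P] \<open>a = 1\<close> \<open>b = 1\<close> by (simp add: Lab n_def)
  have rows1: "(\<Sum>j<n. P (e i) (e j)) = 1" if "i < n" for i
    using rows[of "e i"] sums[of "P (e i)"] img that by auto
  have "\<exists>w c. w 0 = 0 \<and> (\<exists>i<n. w i \<noteq> 0) \<and> (\<forall>i<n. (\<Sum>j<n. P (e i) (e j) * w j) = w i + c)"
    by (rule double_root_1[OF rows1 order1])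
  then obtain w c i where w: "w 0 = 0" "i < n" "w i \<noteq> 0"
    "\<And>i. i < n \<Longrightarrow> (\<Sum>j<n. P (e i) (e j) * w j) = w i + c"
    by auto
  define h where "h x = w (inv_into {..<n} e x)" for x
  have he: "h (e i) = w i" if "i < n" for i using inj that by (simp add: h_def)
  have "1 \<le> C"
  proof (rule le1[of "e i" "e 0" h c])
    show "e i \<in> N" "e 0 \<in> N" "h (e i) \<noteq> h (e 0)" using w(1-3) img he by auto
    show "(\<Sum>y\<in>N. P z y * h y) = h z + c" if "z \<in> N" for z
      using that w(4) he unfolding sums by (auto simp: img[symmetric])
  qed
  then show False using contra b \<open>b = 1\<close> by simp
qed

text \<open>Common form of the link graph in codimension 2 and of the pair graph of two sites, so
  that one analysis serves both the hypothesis and the conclusion.\<close>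

definition bip_weight ::
  "'o set \<Rightarrow> ('o \<Rightarrow> real) \<Rightarrow> ('o \<Rightarrow> 'x) \<Rightarrow> ('o \<Rightarrow> 'x) \<Rightarrow> 'x \<Rightarrow> 'x \<Rightarrow> real" where
  "bip_weight \<Omega> m a b x y = wsum {\<omega> \<in> \<Omega>. a \<omega> = x \<and> b \<omega> = y \<or> b \<omega> = x \<and> a \<omega> = y} m (\<lambda>_. 1)"

lemma bip_weight_sym: "bip_weight \<Omega> m a b = bip_weight \<Omega> m b a"
  by (intro ext) (simp add: bip_weight_def disj_commute conj_commute)

section \<open>The second eigenvalue of a bipartite walk against the maximal correlation\<close>

locale bipartite = weighted \<Omega> m for \<Omega> :: "'o set" and m +
  fixes a b :: "'o \<Rightarrow> 'x"
  assumes disj: "a ` \<Omega> \<inter> b ` \<Omega> = {}" and nonempty: "\<Omega> \<noteq> {}"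
begin

abbreviation "nodes \<equiv> a ` \<Omega> \<union> b ` \<Omega>"
abbreviation "walk \<equiv> srw nodes (bip_weight \<Omega> m a b)"

lemma swap: "bipartite \<Omega> m b a"
  using disj nonempty by unfold_locales auto

lemma sum_weight:
  assumes x: "x \<in> a ` \<Omega>"
  shows "(\<Sum>y\<in>nodes. bip_weight \<Omega> m a b x y * h y) = wsum {\<omega> \<in> \<Omega>. a \<omega> = x} m (\<lambda>\<omega>. h (b \<omega>))"
proof -
  let ?F = "{\<omega> \<in> \<Omega>. a \<omega> = x}"
  have w: "bip_weight \<Omega> m a b x y = wsum {\<omega> \<in> ?F. b \<omega> = y} m (\<lambda>_. 1)" for y
    unfolding bip_weight_def using x disj by (intro arg_cong[where f = "\<lambda>S. wsum S m (\<lambda>_. 1)"]) blast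
  have "(\<Sum>y\<in>nodes. bip_weight \<Omega> m a b x y * h y) = (\<Sum>y\<in>b ` ?F. bip_weight \<Omega> m a b x y * h y)"
  proof (rule sum.mono_neutral_right)
    show "\<forall>y\<in>nodes - b ` ?F. bip_weight \<Omega> m a b x y * h y = 0"
    proof
      fix y assume "y \<in> nodes - b ` ?F"
      then have "{\<omega> \<in> ?F. b \<omega> = y} = {}" by auto
      then show "bip_weight \<Omega> m a b x y * h y = 0" unfolding w by (simp only: wsum_def sum.empty mult_zero_left)
    qed
  qed (use fin in auto)
  also have "\<dots> = (\<Sum>y\<in>b ` ?F. wsum {\<omega> \<in> ?F. b \<omega> = y} m (\<lambda>\<omega>. h (b \<omega>)))"
  proof (rule sum.cong[OF refl])
    fix y
    have "wsum {\<omega> \<in> ?F. b \<omega> = y} m (\<lambda>\<omega>. h (b \<omega>)) = wsum {\<omega> \<in> ?F. b \<omega> = y} m (\<lambda>\<omega>. h y * 1)"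
      by (rule wsum_cong) simp
    then show "bip_weight \<Omega> m a b x y * h y = wsum {\<omega> \<in> ?F. b \<omega> = y} m (\<lambda>\<omega>. h (b \<omega>))"
      unfolding w wsum_cmult by simp
  qed
  also have "\<dots> = wsum ?F m (\<lambda>\<omega>. h (b \<omega>))"
    by (rule weighted.wsum_by_fibres[OF restrict, symmetric])
  finally show ?thesis .
qed

lemma walk_left:
  assumes "x \<in> a ` \<Omega>"
  shows "(\<Sum>y\<in>nodes. walk x y * h y) = cond_mean \<Omega> m a (\<lambda>\<omega>. h (b \<omega>)) x"
proof -
  have "(\<Sum>y\<in>nodes. walk x y * h y)
      = (\<Sum>y\<in>nodes. bip_weight \<Omega> m a b x y * h y) / (\<Sum>y\<in>nodes. bip_weight \<Omega> m a b x y * 1)"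
    by (simp add: srw_def sum_divide_distrib)
  then show ?thesis unfolding sum_weight[OF assms] cond_mean_def .
qed

lemma walk_right:
  assumes "x \<in> b ` \<Omega>"
  shows "(\<Sum>y\<in>nodes. walk x y * h y) = cond_mean \<Omega> m b (\<lambda>\<omega>. h (a \<omega>)) x"
  using bipartite.walk_left[OF swap assms, of h]
  unfolding bip_weight_sym[of \<Omega> m b a] Un_commute[of "b ` \<Omega>"] .

lemma finite_nodes: "finite nodes" using fin by simp

lemma walk_rows: "x \<in> nodes \<Longrightarrow> (\<Sum>y\<in>nodes. walk x y) = 1"
proof -
  assume "x \<in> nodes"
  then have "(\<Sum>y\<in>nodes. walk x y * (1 :: real)) = 1"
  proof
    assume x: "x \<in> a ` \<Omega>"
    show ?thesis unfolding walk_left[OF x] using fibre_mass_pos[OF x] by (simp add: cond_mean_def)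
  next
    assume x: "x \<in> b ` \<Omega>"
    show ?thesis unfolding walk_right[OF x] using fibre_mass_pos[OF x] by (simp add: cond_mean_def)
  qed
  then show ?thesis by simp
qed

text \<open>The direction for the hypothesis in codimension 2. Since a and b have disjoint images, f
  and g glue to an eigenfunction for \<rho>, which lies strictly below the eigenvalue 1 of the
  constants.\<close>

lemma extremal_pair_le_lambda2:
  assumes fg: "extremal_pair \<Omega> m a b \<rho> f g" and "\<rho> < 1"
  shows "\<rho> \<le> lambda2 nodes walk"
proof (rule eigenvalue_le_lambda2)
  define h where "h x = (if x \<in> a ` \<Omega> then f x else g x)" for x
  have ha: "h (a \<omega>) = f (a \<omega>)" and hb: "h (b \<omega>) = g (b \<omega>)" if "\<omega> \<in> \<Omega>" for \<omega>
    using that disj by (auto simp: h_def)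
  have ca: "cond_mean \<Omega> m a (\<lambda>\<omega>. h (b \<omega>)) x = cond_mean \<Omega> m a (\<lambda>\<omega>. g (b \<omega>)) x"
    and cb: "cond_mean \<Omega> m b (\<lambda>\<omega>. h (a \<omega>)) x = cond_mean \<Omega> m b (\<lambda>\<omega>. f (a \<omega>)) x" for x
    unfolding cond_mean_def by (auto intro!: arg_cong2[where f = "(/)"] wsum_cong simp: ha hb)
  show "eigenfunction nodes walk \<rho> h"
    unfolding eigenfunction_def
  proof
    show "\<exists>x\<in>nodes. h x \<noteq> 0"
    proof (rule ccontr)
      assume "\<not> ?thesis"
      then have "f (a \<omega>) = 0" if "\<omega> \<in> \<Omega>" for \<omega> using ha[OF that] that by auto
      then have "wsum \<Omega> m (\<lambda>\<omega>. (f (a \<omega>))\<^sup>2) = 0" by (simp add: wsum_def)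
      then show False using fg by (simp add: extremal_pair_def)
    qed
    show "\<forall>x\<in>nodes. (\<Sum>y\<in>nodes. walk x y * h y) = \<rho> * h x"
    proof
      fix x assume "x \<in> nodes"
      then show "(\<Sum>y\<in>nodes. walk x y * h y) = \<rho> * h x"
      proof
        assume x: "x \<in> a ` \<Omega>"
        show ?thesis unfolding walk_left[OF x] ca using x fg ha by (auto simp: extremal_pair_def)
      next
        assume x: "x \<in> b ` \<Omega>"
        show ?thesis unfolding walk_right[OF x] cb using x fg hb by (auto simp: extremal_pair_def)
      qed
    qed
  qed
  show "eigenfunction nodes walk 1 (\<lambda>_. 1)"
    using walk_rows nonempty by (auto simp: eigenfunction_def)
qed (use finite_nodes assms in auto)

lemma wsum_walk:
  "wsum \<Omega> m (\<lambda>\<omega>. \<Sum>y\<in>nodes. walk (a \<omega>) y * h y) = wsum \<Omega> m (\<lambda>\<omega>. h (b \<omega>))"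
  "wsum \<Omega> m (\<lambda>\<omega>. \<Sum>y\<in>nodes. walk (b \<omega>) y * h y) = wsum \<Omega> m (\<lambda>\<omega>. h (a \<omega>))"
proof -
  have "wsum \<Omega> m (\<lambda>\<omega>. \<Sum>y\<in>nodes. walk (a \<omega>) y * h y)
      = wsum \<Omega> m (\<lambda>\<omega>. cond_mean \<Omega> m a (\<lambda>\<omega>. h (b \<omega>)) (a \<omega>))"
    by (rule wsum_cong, rule walk_left) simp
  then show "wsum \<Omega> m (\<lambda>\<omega>. \<Sum>y\<in>nodes. walk (a \<omega>) y * h y) = wsum \<Omega> m (\<lambda>\<omega>. h (b \<omega>))"
    by (simp add: wsum_cond_mean)
  have "wsum \<Omega> m (\<lambda>\<omega>. \<Sum>y\<in>nodes. walk (b \<omega>) y * h y)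
      = wsum \<Omega> m (\<lambda>\<omega>. cond_mean \<Omega> m b (\<lambda>\<omega>. h (a \<omega>)) (b \<omega>))"
    by (rule wsum_cong, rule walk_right) simp
  then show "wsum \<Omega> m (\<lambda>\<omega>. \<Sum>y\<in>nodes. walk (b \<omega>) y * h y) = wsum \<Omega> m (\<lambda>\<omega>. h (a \<omega>))"
    by (simp add: wsum_cond_mean)
qed

text \<open>The two halves of h have covariance k F and also k G, hence equal norms as k > 0. The
  correlation bound then reads k F \<le> C F with F > 0.\<close>

lemma eigenvalue_le_corr:
  assumes corr: "corr_le \<Omega> m a b C" and h: "eigenfunction nodes walk k h" and k: "0 < k"
    and zero: "wsum \<Omega> m (\<lambda>\<omega>. h (a \<omega>)) = 0" "wsum \<Omega> m (\<lambda>\<omega>. h (b \<omega>)) = 0"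
  shows "k \<le> C"
proof -
  have eig: "(\<Sum>y\<in>nodes. walk x y * h y) = k * h x" if "x \<in> nodes" for x
    using h that by (simp add: eigenfunction_def)
  define F where "F = wsum \<Omega> m (\<lambda>\<omega>. (h (a \<omega>))\<^sup>2)"
  define G where "G = wsum \<Omega> m (\<lambda>\<omega>. (h (b \<omega>))\<^sup>2)"
  have nn: "0 \<le> F" "0 \<le> G" unfolding F_def G_def by (auto intro: wsum_nonneg)
  have "wsum \<Omega> m (\<lambda>\<omega>. h (a \<omega>) * h (b \<omega>)) = wsum \<Omega> m (\<lambda>\<omega>. h (a \<omega>) * cond_mean \<Omega> m a (\<lambda>\<omega>. h (b \<omega>)) (a \<omega>))"
    by (rule tower[symmetric])
  also have "\<dots> = wsum \<Omega> m (\<lambda>\<omega>. k * (h (a \<omega>))\<^sup>2)"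
    by (rule wsum_cong) (simp add: eig power2_eq_square flip: walk_left)
  finally have 1: "wsum \<Omega> m (\<lambda>\<omega>. h (a \<omega>) * h (b \<omega>)) = k * F" by (simp add: wsum_cmult F_def)
  have "wsum \<Omega> m (\<lambda>\<omega>. h (b \<omega>) * h (a \<omega>)) = wsum \<Omega> m (\<lambda>\<omega>. h (b \<omega>) * cond_mean \<Omega> m b (\<lambda>\<omega>. h (a \<omega>)) (b \<omega>))"
    by (rule tower[symmetric])
  also have "\<dots> = wsum \<Omega> m (\<lambda>\<omega>. k * (h (b \<omega>))\<^sup>2)"
    by (rule wsum_cong) (simp add: eig power2_eq_square flip: walk_right)
  finally have "wsum \<Omega> m (\<lambda>\<omega>. h (a \<omega>) * h (b \<omega>)) = k * G" by (simp add: wsum_cmult G_def mult.commute)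
  then have "F = G" using 1 k by simp
  have "F \<noteq> 0"
  proof
    assume "F = 0"
    then have "h (a \<omega>) = 0" "h (b \<omega>) = 0" if "\<omega> \<in> \<Omega>" for \<omega>
      using wsum_square_le_0[of "\<lambda>\<omega>. h (a \<omega>)" \<omega>] wsum_square_le_0[of "\<lambda>\<omega>. h (b \<omega>)" \<omega>] that \<open>F = G\<close>
      by (auto simp: F_def G_def)
    then show False using h by (auto simp: eigenfunction_def)
  qed
  moreover have "k * F \<le> C * (sqrt F * sqrt F)"
    using corr[unfolded corr_le_def, rule_format, OF zero] 1 \<open>F = G\<close>
    by (simp add: F_def[symmetric] G_def[symmetric] del: real_sqrt_mult_self)
  ultimately show ?thesis using nn by simp
qed

text \<open>The direction for the conclusion: apart from the constants, every positive eigenvalue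
  has an eigenfunction whose two halves have mean zero. The sign of the side gives the eigenvalue
  -1.\<close>

lemma lambda2_le_corr:
  assumes corr: "corr_le \<Omega> m a b C" and C: "0 \<le> C"
  shows "lambda2 nodes walk \<le> C"
proof (rule lambda2_le[OF finite_nodes walk_rows])
  define s where "s x = (if x \<in> a ` \<Omega> then 1 else - 1 :: real)" for x
  show "eigenfunction nodes walk (- 1) s"
    unfolding eigenfunction_def
  proof (intro conjI ballI)
    show "\<exists>x\<in>nodes. s x \<noteq> 0" using nonempty by (auto simp: s_def)
    fix x assume "x \<in> nodes"
    then show "(\<Sum>y\<in>nodes. walk x y * s y) = - 1 * s x"
    proof
      assume x: "x \<in> a ` \<Omega>"
      have "wsum {\<omega> \<in> \<Omega>. a \<omega> = x} m (\<lambda>\<omega>. s (b \<omega>)) = wsum {\<omega> \<in> \<Omega>. a \<omega> = x} m (\<lambda>\<omega>. - 1 * 1)"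
        by (rule wsum_cong) (use disj in \<open>auto simp: s_def\<close>)
      then show ?thesis
        unfolding walk_left[OF x] cond_mean_def wsum_cmult using x fibre_mass_pos[OF x] by (auto simp: s_def)
    next
      assume x: "x \<in> b ` \<Omega>"
      then have "x \<notin> a ` \<Omega>" using disj by blast
      have "wsum {\<omega> \<in> \<Omega>. b \<omega> = x} m (\<lambda>\<omega>. s (a \<omega>)) = wsum {\<omega> \<in> \<Omega>. b \<omega> = x} m (\<lambda>\<omega>. 1)"
        by (rule wsum_cong) (auto simp: s_def)
      then show ?thesis
        unfolding walk_right[OF x] cond_mean_def using \<open>x \<notin> a ` \<Omega>\<close> fibre_mass_pos[OF x] by (simp add: s_def)
    qed
  qed
next
  fix k h assume h: "eigenfunction nodes walk k h" and k: "0 < k" "k \<noteq> 1"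
  \<comment> \<open>The walk exchanges the totals of the two sides, so k A = B and k B = A. As k is
    positive and not 1, both totals vanish.\<close>
  define A where "A = wsum \<Omega> m (\<lambda>\<omega>. h (a \<omega>))"
  define B where "B = wsum \<Omega> m (\<lambda>\<omega>. h (b \<omega>))"
  have e: "(\<Sum>y\<in>nodes. walk x y * h y) = k * h x" if "x \<in> nodes" for x
    using h that by (simp add: eigenfunction_def)
  have "wsum \<Omega> m (\<lambda>\<omega>. k * h (a \<omega>)) = B" "wsum \<Omega> m (\<lambda>\<omega>. k * h (b \<omega>)) = A"
    unfolding A_def B_def wsum_walk[symmetric, of h] by (rule wsum_cong, simp only: e UnI1 UnI2 imageI)+
  then have "k * A = B" "k * B = A" by (simp_all add: wsum_cmult A_def B_def)
  then have "(k * k - 1) * A = 0" by (auto simp only: left_diff_distrib mult.assoc)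
  moreover have "k * k \<noteq> 1" using k by (auto simp: square_eq_1_iff)
  ultimately have "A = 0" "B = 0" using \<open>k * A = B\<close> by auto
  then show "k \<le> C" using eigenvalue_le_corr[OF corr h k(1)] by (simp add: A_def B_def)
next
  fix h c x y
  assume xy: "x \<in> nodes" "y \<in> nodes" "h x \<noteq> h y"
    and h: "\<And>z. z \<in> nodes \<Longrightarrow> (\<Sum>y\<in>nodes. walk z y * h y) = h z + c"
  define A where "A = wsum \<Omega> m (\<lambda>\<omega>. h (a \<omega>))"
  define B where "B = wsum \<Omega> m (\<lambda>\<omega>. h (b \<omega>))"
  define M where "M = wsum \<Omega> m (\<lambda>_. 1)"
  have M: "0 < M" unfolding M_def wsum_def using fin mpos nonempty by (intro sum_pos) auto
  have "wsum \<Omega> m (\<lambda>\<omega>. h (a \<omega>) + c * 1) = B" "wsum \<Omega> m (\<lambda>\<omega>. h (b \<omega>) + c * 1) = A"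
    unfolding A_def B_def wsum_walk[symmetric, of h] by (rule wsum_cong, simp only: h UnI1 UnI2 imageI mult_1_right)+
  \<comment> \<open>Stationarity excludes the Jordan block: adding the equations gives c = 0, hence
    A = B. Subtracting the common mean A / M from h leaves a mean-zero eigenfunction for 1, which is
    nonzero because h is not constant.\<close>
  then have "A + c * M = B" "B + c * M = A"
    unfolding wsum_add wsum_cmult by (simp_all add: A_def B_def M_def)
  then have "c * M = 0" "A = B" by auto
  then have "c = 0" using M by simp
  define g where "g z = h z - A / M" for z
  have eig: "eigenfunction nodes walk 1 g"
    unfolding eigenfunction_def
  proof
    have "g x \<noteq> 0 \<or> g y \<noteq> 0" using xy(3) by (auto simp: g_def)
    then show "\<exists>z\<in>nodes. g z \<noteq> 0" using xy(1,2) by blast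
    show "\<forall>z\<in>nodes. (\<Sum>y\<in>nodes. walk z y * g y) = 1 * g z"
    proof
      fix z assume z: "z \<in> nodes"
      have "(\<Sum>y\<in>nodes. walk z y * g y) = (\<Sum>y\<in>nodes. walk z y * h y) - (\<Sum>y\<in>nodes. walk z y) * (A / M)"
        unfolding g_def right_diff_distrib sum_subtractf sum_distrib_right ..
      then show "(\<Sum>y\<in>nodes. walk z y * g y) = 1 * g z"
        unfolding h[OF z] walk_rows[OF z] by (simp add: g_def \<open>c = 0\<close>)
    qed
  qed
  have "wsum \<Omega> m (\<lambda>_. A / M) = A"
    using wsum_cmult[of \<Omega> m "A / M" "\<lambda>_. 1"] M by (simp add: M_def)
  then have "wsum \<Omega> m (\<lambda>\<omega>. g (a \<omega>)) = 0" "wsum \<Omega> m (\<lambda>\<omega>. g (b \<omega>)) = 0"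
    unfolding g_def wsum_diff using \<open>A = B\<close> by (simp_all add: A_def B_def)
  then show "1 \<le> C" using eigenvalue_le_corr[OF corr eig] by simp
qed (use C in auto)

end

section \<open>Trickling down\<close>

context partite_complex
begin

definition pick :: "'v \<Rightarrow> 'a set \<Rightarrow> 'a" where
  "pick v \<omega> = (THE x. x \<in> \<omega> \<inter> S v)"

definition facets_over :: "'a set \<Rightarrow> 'a set set" where
  "facets_over \<tau> = {\<omega> \<in> facets X. \<tau> \<subseteq> \<omega>}"

definition free_sites :: "'a set \<Rightarrow> 'v set" where
  "free_sites \<tau> = V - sites_of V S \<tau>"

abbreviation corr :: "'a set \<Rightarrow> 'v \<Rightarrow> 'v \<Rightarrow> real \<Rightarrow> bool" where
  "corr \<tau> u v \<equiv> corr_le (facets_over \<tau>) (pmf \<mu>) (pick u) (pick v)"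

section \<open>Facets over a face and their spins\<close>

lemma finite_X: "finite X"
proof -
  have "X \<subseteq> Pow (\<Union>v\<in>V. S v)" using vertices by auto
  then show ?thesis using finite_sites finite_spins by (auto intro: finite_subset)
qed

lemma extend_to_facet:
  assumes "\<sigma> \<in> X"
  obtains \<omega> where "\<omega> \<in> facets X" "\<sigma> \<subseteq> \<omega>"
proof -
  obtain \<omega> where "\<omega> \<in> X" "\<sigma> \<subseteq> \<omega>" "\<forall>\<omega>'\<in>X. \<omega> \<subseteq> \<omega>' \<longrightarrow> \<omega> = \<omega>'"
    using finite_has_maximal2[OF finite_X assms] by auto
  then have "\<omega> \<in> facets X" unfolding facets_def by blast
  then show thesis using \<open>\<sigma> \<subseteq> \<omega>\<close> by (rule that)
qed

lemma pick: "\<omega> \<in> facets X \<Longrightarrow> v \<in> V \<Longrightarrow> pick v \<omega> \<in> \<omega> \<and> pick v \<omega> \<in> S v"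
  using theI'[OF facet_spin, of \<omega> v] unfolding pick_def by blast

lemma pick_eq_iff: "\<omega> \<in> facets X \<Longrightarrow> v \<in> V \<Longrightarrow> x \<in> S v \<Longrightarrow> pick v \<omega> = x \<longleftrightarrow> x \<in> \<omega>"
  using pick facet_spin by blast

lemma site_unique: "x \<in> S u \<Longrightarrow> x \<in> S v \<Longrightarrow> u \<in> V \<Longrightarrow> v \<in> V \<Longrightarrow> u = v"
  using spins_disjoint by (auto simp: disjoint_family_on_def)

lemma facets_overD: "\<omega> \<in> facets_over \<tau> \<Longrightarrow> \<omega> \<in> facets X \<and> \<tau> \<subseteq> \<omega> \<and> \<omega> \<in> X"
  by (auto simp: facets_over_def facets_def)

lemma weighted_facets: "weighted (facets_over \<tau>) (pmf \<mu>)"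
proof
  show "finite (facets_over \<tau>)" using finite_X by (auto simp: facets_over_def facets_def)
  show "0 < pmf \<mu> \<omega>" if "\<omega> \<in> facets_over \<tau>" for \<omega>
    using that support facets_overD pmf_positive by metis
qed

lemma facets_over_nonempty: "\<tau> \<in> X \<Longrightarrow> facets_over \<tau> \<noteq> {}"
  by (auto simp: facets_over_def elim: extend_to_facet)

lemma spin_site: "\<sigma> \<in> X \<Longrightarrow> x \<in> \<sigma> \<Longrightarrow> \<exists>v\<in>V. x \<in> S v"
  using vertices by blast

lemma free_site_spin:
  assumes "\<omega> \<in> facets_over \<tau>" "x \<in> \<omega>" "x \<in> S w" "w \<in> V"
  shows "x \<in> \<tau> \<longleftrightarrow> w \<notin> free_sites \<tau>"
proof
  assume "x \<in> \<tau>"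
  then show "w \<notin> free_sites \<tau>" using assms by (auto simp: free_sites_def sites_of_def)
next
  assume "w \<notin> free_sites \<tau>"
  then obtain y where y: "y \<in> \<tau>" "y \<in> S w" using assms by (auto simp: free_sites_def sites_of_def)
  then have "y \<in> \<omega>" using facets_overD[OF assms(1)] by auto
  then show "x \<in> \<tau>" using facet_spin[of \<omega> w] facets_overD[OF assms(1)] assms y by blast
qed

lemma pick_notin: "\<omega> \<in> facets_over \<tau> \<Longrightarrow> w \<in> free_sites \<tau> \<Longrightarrow> pick w \<omega> \<in> \<omega> - \<tau>"
  using free_site_spin[of \<omega> \<tau> "pick w \<omega>" w] pick[of \<omega> w] facets_overD
  by (auto simp: free_sites_def)

lemma card_face:
  assumes "\<tau> \<in> X"
  shows "card \<tau> + card (free_sites \<tau>) = card V"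
proof -
  obtain \<omega> where w: "\<omega> \<in> facets X" "\<tau> \<subseteq> \<omega>" using extend_to_facet[OF assms] .
  have "bij_betw (\<lambda>v. pick v \<omega>) (sites_of V S \<tau>) \<tau>"
    unfolding bij_betw_def
  proof
    show "inj_on (\<lambda>v. pick v \<omega>) (sites_of V S \<tau>)"
      using pick[OF w(1)] site_unique by (intro inj_onI) (metis (mono_tags, lifting) mem_Collect_eq sites_of_def)
    show "(\<lambda>v. pick v \<omega>) ` sites_of V S \<tau> = \<tau>"
    proof (intro equalityI subsetI)
      fix x assume "x \<in> (\<lambda>v. pick v \<omega>) ` sites_of V S \<tau>"
      then obtain v y where "v \<in> V" "y \<in> \<tau>" "y \<in> S v" "x = pick v \<omega>" by (auto simp: sites_of_def)
      moreover have "pick v \<omega> = y" using pick_eq_iff[OF w(1)] calculation w(2) by blast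
      ultimately show "x \<in> \<tau>" by simp
    next
      fix x assume x: "x \<in> \<tau>"
      then obtain v where v: "v \<in> V" "x \<in> S v" using spin_site[OF assms] by blast
      then have "pick v \<omega> = x" using pick_eq_iff[OF w(1)] w(2) x by blast
      moreover have "v \<in> sites_of V S \<tau>" using v x by (auto simp: sites_of_def)
      ultimately show "x \<in> (\<lambda>v. pick v \<omega>) ` sites_of V S \<tau>" by blast
    qed
  qed
  then have "card (sites_of V S \<tau>) = card \<tau>" by (rule bij_betw_same_card)
  moreover have "sites_of V S \<tau> \<subseteq> V" by (auto simp: sites_of_def)
  ultimately show ?thesis
    using finite_sites card_mono[of V "sites_of V S \<tau>"] finite_subset[of "sites_of V S \<tau>" V]
    by (simp add: free_sites_def card_Diff_subset)
qed

text \<open>Conditioning on a spin is passing to a smaller link: the fibres of \<open>pick w\<close>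
  are again sets of facets over a face, with one free site less. This makes the induction hypothesis
  available on fibres.\<close>

lemma pin_spin:
  assumes w: "w \<in> free_sites \<tau>" and x: "x \<in> pick w ` facets_over \<tau>"
  shows "insert x \<tau> \<in> X" "facets_over (insert x \<tau>) = {\<omega> \<in> facets_over \<tau>. pick w \<omega> = x}"
    "free_sites (insert x \<tau>) = free_sites \<tau> - {w}"
proof -
  obtain \<omega> where o: "\<omega> \<in> facets_over \<tau>" "x = pick w \<omega>" using x by auto
  have wV: "w \<in> V" using w by (simp add: free_sites_def)
  have xS: "x \<in> S w" "x \<in> \<omega>" using pick[of \<omega> w] facets_overD[OF o(1)] o wV by auto
  show "insert x \<tau> \<in> X" using facets_overD[OF o(1)] xS by (auto intro: face_subset)
  show "facets_over (insert x \<tau>) = {\<omega> \<in> facets_over \<tau>. pick w \<omega> = x}"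
    using pick_eq_iff[OF _ wV xS(1)] by (auto simp: facets_over_def)
  have "x \<in> S v \<longleftrightarrow> v = w" if "v \<in> V" for v using site_unique[OF xS(1) _ wV that] xS by blast
  then have "insert x \<tau> \<inter> S v \<noteq> {} \<longleftrightarrow> \<tau> \<inter> S v \<noteq> {} \<or> v = w" if "v \<in> V" for v
    using that by blast
  then show "free_sites (insert x \<tau>) = free_sites \<tau> - {w}"
    unfolding free_sites_def sites_of_def by blast
qed

lemma link_vertices_iff: "x \<in> link_vertices X \<tau> \<longleftrightarrow> (\<exists>\<omega>\<in>facets_over \<tau>. x \<in> \<omega> - \<tau>)"
proof
  assume "x \<in> link_vertices X \<tau>"
  then obtain \<sigma> where s: "\<sigma> \<in> X" "\<tau> \<subseteq> \<sigma>" "{x} = \<sigma> - \<tau>"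
    by (auto simp: link_vertices_def faces_def link_def)
  obtain \<omega> where "\<omega> \<in> facets X" "\<sigma> \<subseteq> \<omega>" using extend_to_facet[OF s(1)] .
  then show "\<exists>\<omega>\<in>facets_over \<tau>. x \<in> \<omega> - \<tau>" using s by (intro bexI[of _ \<omega>]) (auto simp: facets_over_def)
next
  assume "\<exists>\<omega>\<in>facets_over \<tau>. x \<in> \<omega> - \<tau>"
  then obtain \<omega> where w: "\<omega> \<in> facets_over \<tau>" "x \<in> \<omega> - \<tau>" by blast
  then have "insert x \<tau> \<in> X" using facets_overD[OF w(1)] by (auto intro: face_subset)
  moreover have "{x} = insert x \<tau> - \<tau>" using w by auto
  ultimately have "{x} \<in> link X \<tau>" unfolding link_def by blast
  then show "x \<in> link_vertices X \<tau>" by (auto simp: link_vertices_def faces_def)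
qed

lemma link_edge_iff:
  "{x, y} \<in> faces (link X \<tau>) 2 \<longleftrightarrow> x \<noteq> y \<and> (\<exists>\<omega>\<in>facets_over \<tau>. {x, y} \<subseteq> \<omega> - \<tau>)"
proof
  assume e: "{x, y} \<in> faces (link X \<tau>) 2"
  then have "x \<noteq> y" by (auto simp: faces_def)
  obtain \<sigma> where s: "\<sigma> \<in> X" "\<tau> \<subseteq> \<sigma>" "{x, y} = \<sigma> - \<tau>"
    using e by (auto simp: faces_def link_def)
  obtain \<omega> where "\<omega> \<in> facets X" "\<sigma> \<subseteq> \<omega>" using extend_to_facet[OF s(1)] .
  then have "\<omega> \<in> facets_over \<tau>" "{x, y} \<subseteq> \<omega> - \<tau>" using s by (auto simp: facets_over_def)
  then show "x \<noteq> y \<and> (\<exists>\<omega>\<in>facets_over \<tau>. {x, y} \<subseteq> \<omega> - \<tau>)" using \<open>x \<noteq> y\<close> by blast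
next
  assume "x \<noteq> y \<and> (\<exists>\<omega>\<in>facets_over \<tau>. {x, y} \<subseteq> \<omega> - \<tau>)"
  then obtain \<omega> where w: "x \<noteq> y" "\<omega> \<in> facets_over \<tau>" "{x, y} \<subseteq> \<omega> - \<tau>" by blast
  have "\<tau> \<union> {x, y} \<in> X" using facets_overD[OF w(2)] w(3) by (auto intro: face_subset)
  moreover have "{x, y} = (\<tau> \<union> {x, y}) - \<tau>" using w by auto
  ultimately have "{x, y} \<in> link X \<tau>" unfolding link_def by blast
  then show "{x, y} \<in> faces (link X \<tau>) 2" using w(1) by (simp add: faces_def)
qed

text \<open>A function of facets that agrees whenever two of them share a spin outside \<tau>
  descends to the vertices of the link. There it is constant along edges, since the two ends of an
  edge lie in a common facet.\<close>

lemma connected_const: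
  assumes conn: "connected_complex V X" and \<tau>: "\<tau> \<in> X" "2 \<le> card (free_sites \<tau>)"
    and share: "\<And>\<omega> \<omega>' x. \<omega> \<in> facets_over \<tau> \<Longrightarrow> \<omega>' \<in> facets_over \<tau> \<Longrightarrow> x \<in> \<omega> \<Longrightarrow> x \<in> \<omega>' \<Longrightarrow> x \<notin> \<tau> \<Longrightarrow> \<phi> \<omega> = \<phi> \<omega>'"
    and w: "\<omega> \<in> facets_over \<tau>" "\<omega>' \<in> facets_over \<tau>"
  shows "\<phi> \<omega> = \<phi> \<omega>'"
proof -
  define F where "F x = \<phi> (SOME \<omega>. \<omega> \<in> facets_over \<tau> \<and> x \<in> \<omega>)" for x
  have F: "F x = \<phi> \<omega>" if "\<omega> \<in> facets_over \<tau>" "x \<in> \<omega> - \<tau>" for x \<omega>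
  proof -
    have "\<exists>\<omega>. \<omega> \<in> facets_over \<tau> \<and> x \<in> \<omega>" using that by blast
    from someI_ex[OF this] show ?thesis using share that unfolding F_def by blast
  qed
  obtain v where v: "v \<in> free_sites \<tau>" using \<tau>(2) by fastforce
  have x: "pick v \<omega> \<in> \<omega> - \<tau>" "pick v \<omega>' \<in> \<omega>' - \<tau>" using pick_notin w v by auto
  have "card \<tau> + 2 \<le> card V" using card_face[OF \<tau>(1)] \<tau>(2) by simp
  moreover have "pick v \<omega> \<in> link_vertices X \<tau>" "pick v \<omega>' \<in> link_vertices X \<tau>"
    unfolding link_vertices_iff using x w by blast+
  ultimately have "(pick v \<omega>, pick v \<omega>') \<in> {(a, b). {a, b} \<in> faces (link X \<tau>) 2}\<^sup>*"
    using conn \<tau>(1) unfolding connected_complex_def by blast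
  then have "F (pick v \<omega>) = F (pick v \<omega>')"
  proof (induction rule: rtrancl_induct)
    case (step y z)
    then obtain \<omega>'' where o: "\<omega>'' \<in> facets_over \<tau>" "{y, z} \<subseteq> \<omega>'' - \<tau>"
      using link_edge_iff[of y z \<tau>] by auto
    have "F y = F z" using F[OF o(1), of y] F[OF o(1), of z] o(2) by simp
    then show ?case using step.IH by simp
  qed simp
  then show ?thesis using F w x by simp
qed

text \<open>For \<rho> \<ge> 1 the spins at u and at v determine a common value f = g on each facet.
  By \<open>pinned\<close>, the spin at any third free site determines this value too, so facets
  sharing a free spin agree. Connectedness makes the value constant, and mean zero then contradicts
  positive variance.\<close>

lemma max_corr_less_1:
  assumes conn: "connected_complex V X" and \<tau>: "\<tau> \<in> X"
    and uv: "u \<in> free_sites \<tau>" "v \<in> free_sites \<tau>" "u \<noteq> v"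
    and pinned: "\<And>w x. w \<in> free_sites \<tau> - {u, v} \<Longrightarrow> x \<in> pick w ` facets_over \<tau> \<Longrightarrow>
      \<exists>\<beta><1. corr (insert x \<tau>) u v \<beta>"
    and fg: "extremal_pair (facets_over \<tau>) (pmf \<mu>) (pick u) (pick v) \<rho> f g"
  shows "\<rho> < 1"
proof (rule ccontr)
  assume "\<not> \<rho> < 1"
  interpret weighted "facets_over \<tau>" "pmf \<mu>" by (rule weighted_facets)
  have eq: "f (pick u \<omega>) = g (pick v \<omega>)" if "\<omega> \<in> facets_over \<tau>" for \<omega>
    using extremal_pair_eq[OF fg _ that] \<open>\<not> \<rho> < 1\<close> by simp
  have "finite (free_sites \<tau>)" using finite_sites by (simp add: free_sites_def)
  then have card2: "2 \<le> card (free_sites \<tau>)"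
    using uv card_mono[of "free_sites \<tau>" "{u, v}"] by auto
  have const: "f (pick u \<omega>) = f (pick u \<omega>')" if "\<omega> \<in> facets_over \<tau>" "\<omega>' \<in> facets_over \<tau>" for \<omega> \<omega>'
  proof (rule connected_const[OF conn \<tau> card2 _ that])
    fix \<omega> \<omega>' x
    assume w: "\<omega> \<in> facets_over \<tau>" "\<omega>' \<in> facets_over \<tau>" and x: "x \<in> \<omega>" "x \<in> \<omega>'" "x \<notin> \<tau>"
    obtain z where z: "z \<in> V" "x \<in> S z" using spin_site x facets_overD[OF w(1)] by blast
    have zfree: "z \<in> free_sites \<tau>" using free_site_spin[OF w(1) x(1) z(2,1)] x by simp
    have same: "pick z \<omega> = x" "pick z \<omega>' = x"
      using pick_eq_iff[OF _ z] facets_overD w x by auto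
    consider "z = u" | "z = v" | "z \<in> free_sites \<tau> - {u, v}" using zfree by blast
    then show "f (pick u \<omega>) = f (pick u \<omega>')"
    proof cases
      case 1 then show ?thesis using same by simp
    next
      case 2 then show ?thesis using same eq w by simp
    next
      case 3
      have xi: "x \<in> pick z ` facets_over \<tau>" using same w by blast
      obtain \<beta> where b: "\<beta> < 1" "corr (insert x \<tau>) u v \<beta>" using pinned[OF 3 xi] by blast
      have "f (pick u \<omega>'') = cond_mean (facets_over \<tau>) (pmf \<mu>) (pick z) (\<lambda>\<omega>. f (pick u \<omega>)) x"
        if "\<omega>'' \<in> facets_over \<tau>" "pick z \<omega>'' = x" for \<omega>''
        using eq_determined_by_fibre[of f "pick u" g "pick v" "pick z" \<omega>'' \<beta>] eq that b pin_spin(2)[OF zfree xi]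
        by simp
      then show ?thesis using same w by metis
    qed
  qed
  obtain \<omega>\<^sub>0 where w0: "\<omega>\<^sub>0 \<in> facets_over \<tau>" using facets_over_nonempty[OF \<tau>] by blast
  define k where "k = f (pick u \<omega>\<^sub>0)"
  have fk: "f (pick u \<omega>) = k" if "\<omega> \<in> facets_over \<tau>" for \<omega>
    unfolding k_def by (rule const[OF that w0])
  have "wsum (facets_over \<tau>) (pmf \<mu>) (\<lambda>\<omega>. f (pick u \<omega>)) = wsum (facets_over \<tau>) (pmf \<mu>) (\<lambda>\<omega>. k * 1)"
    by (rule wsum_cong) (simp add: fk)
  then have "k * wsum (facets_over \<tau>) (pmf \<mu>) (\<lambda>\<omega>. 1) = 0"
    using fg unfolding wsum_cmult by (simp add: extremal_pair_def)
  moreover have "0 < wsum (facets_over \<tau>) (pmf \<mu>) (\<lambda>\<omega>. 1)"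
    unfolding wsum_def using fin mpos w0 by (intro sum_pos) auto
  ultimately have "k = 0" by simp
  then have "wsum (facets_over \<tau>) (pmf \<mu>) (\<lambda>\<omega>. (f (pick u \<omega>))\<^sup>2) = 0"
    by (simp add: wsum_def fk)
  then show False using fg by (simp add: extremal_pair_def)
qed

section \<open>Link graphs and pair graphs as bipartite graphs of spins\<close>

lemma bipartite_facets:
  assumes "\<tau> \<in> X" "u \<in> V" "v \<in> V" "u \<noteq> v"
  shows "bipartite (facets_over \<tau>) (pmf \<mu>) (pick u) (pick v)"
proof -
  interpret weighted "facets_over \<tau>" "pmf \<mu>" by (rule weighted_facets)
  show ?thesis
  proof
    show "pick u ` facets_over \<tau> \<inter> pick v ` facets_over \<tau> = {}"
      using pick site_unique assms facets_overD by (metis (no_types, lifting) disjoint_iff imageE)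
    show "facets_over \<tau> \<noteq> {}" using facets_over_nonempty assms by simp
  qed
qed

lemma facets_with_pair:
  assumes uv: "u \<in> V" "v \<in> V" "u \<noteq> v" and xy: "x \<in> S u \<and> y \<in> S v \<or> x \<in> S v \<and> y \<in> S u"
  shows "{\<omega> \<in> facets_over \<tau>. pick u \<omega> = x \<and> pick v \<omega> = y \<or> pick v \<omega> = x \<and> pick u \<omega> = y}
    = {\<omega> \<in> facets_over \<tau>. x \<in> \<omega> \<and> y \<in> \<omega>}"
  using xy
proof
  assume xy: "x \<in> S u \<and> y \<in> S v"
  have "pick v \<omega> \<noteq> x" if "\<omega> \<in> facets_over \<tau>" for \<omega>
    using pick[of \<omega> v] site_unique[of x u v] uv xy facets_overD[OF that] by blast
  then show ?thesis using pick_eq_iff xy uv facets_overD by blast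
next
  assume xy: "x \<in> S v \<and> y \<in> S u"
  have "pick u \<omega> \<noteq> x" if "\<omega> \<in> facets_over \<tau>" for \<omega>
    using pick[of \<omega> u] site_unique[of x u v] uv xy facets_overD[OF that] by blast
  then show ?thesis using pick_eq_iff xy uv facets_overD by blast
qed

lemma no_facets_with_pair:
  assumes uv: "u \<in> V" "v \<in> V" and xy: "\<not> (x \<in> S u \<and> y \<in> S v \<or> x \<in> S v \<and> y \<in> S u)"
  shows "{\<omega> \<in> facets_over \<tau>. pick u \<omega> = x \<and> pick v \<omega> = y \<or> pick v \<omega> = x \<and> pick u \<omega> = y} = {}"
  using xy pick uv facets_overD by blast

lemma bip_weight_pair:
  assumes uv: "u \<in> V" "v \<in> V" "u \<noteq> v" and xy: "x \<in> S u \<and> y \<in> S v \<or> x \<in> S v \<and> y \<in> S u"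
  shows "bip_weight (facets_over \<tau>) (pmf \<mu>) (pick u) (pick v) x y
    = sum (pmf \<mu>) {\<omega> \<in> facets_over \<tau>. x \<in> \<omega> \<and> y \<in> \<omega>}"
  unfolding bip_weight_def facets_with_pair[OF assms] wsum_def by simp

lemma bip_weight_no_pair:
  assumes uv: "u \<in> V" "v \<in> V" and xy: "\<not> (x \<in> S u \<and> y \<in> S v \<or> x \<in> S v \<and> y \<in> S u)"
  shows "bip_weight (facets_over \<tau>) (pmf \<mu>) (pick u) (pick v) x y = 0"
  unfolding bip_weight_def no_facets_with_pair[OF assms] wsum_def by simp

text \<open>With only two free sites, each vertex of the link is the spin of a facet at u or v.
  Where the guard in \<open>link_weight\<close> gives 0, no facet contains the pair, so the
  bipartite weight is 0 as well.\<close>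

lemma lambda2_link_eq:
  assumes \<tau>: "\<tau> \<in> X" and uv: "free_sites \<tau> = {u, v}" "u \<noteq> v"
  shows "lambda2_link X \<mu> \<tau> = lambda2 (pick u ` facets_over \<tau> \<union> pick v ` facets_over \<tau>)
    (srw (pick u ` facets_over \<tau> \<union> pick v ` facets_over \<tau>)
      (bip_weight (facets_over \<tau>) (pmf \<mu>) (pick u) (pick v)))"
proof -
  let ?N = "pick u ` facets_over \<tau> \<union> pick v ` facets_over \<tau>"
  have uvV: "u \<in> V" "v \<in> V" using uv by (auto simp: free_sites_def)
  have finN: "finite ?N" using weighted.fin[OF weighted_facets[of \<tau>]] by simp
  have N: "link_vertices X \<tau> = ?N"
  proof (intro equalityI subsetI)
    fix x assume "x \<in> link_vertices X \<tau>"
    then obtain \<omega> where w: "\<omega> \<in> facets_over \<tau>" "x \<in> \<omega>" "x \<notin> \<tau>" unfolding link_vertices_iff by blast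
    obtain z where z: "z \<in> V" "x \<in> S z" using spin_site facets_overD[OF w(1)] w by blast
    have "z \<in> free_sites \<tau>" using free_site_spin[OF w(1,2) z(2,1)] w by simp
    moreover have "pick z \<omega> = x" using pick_eq_iff[OF _ z] facets_overD[OF w(1)] w by auto
    ultimately show "x \<in> ?N" using w uv(1) by auto
  next
    fix x assume "x \<in> ?N"
    then show "x \<in> link_vertices X \<tau>" unfolding link_vertices_iff using pick_notin uv(1) by blast
  qed
  have "link_weight X \<mu> \<tau> x y = bip_weight (facets_over \<tau>) (pmf \<mu>) (pick u) (pick v) x y"
    if xy: "x \<in> ?N" "y \<in> ?N" for x y
  proof -
    have S: "x \<in> S u \<or> x \<in> S v" "y \<in> S u \<or> y \<in> S v" using xy pick uvV facets_overD by blast+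
    have nt: "x \<notin> \<tau>" "y \<notin> \<tau>" using xy pick_notin uv(1) by blast+
    show ?thesis
    proof (cases "x \<in> S u \<and> y \<in> S v \<or> x \<in> S v \<and> y \<in> S u")
      case True
      then have "x \<noteq> y" using site_unique uvV uv(2) by blast
      have e: "{\<omega> \<in> facets X. \<tau> \<union> {x, y} \<subseteq> \<omega>} = {\<omega> \<in> facets_over \<tau>. x \<in> \<omega> \<and> y \<in> \<omega>}"
        by (auto simp: facets_over_def)
      show ?thesis
      proof (cases "{x, y} \<in> faces (link X \<tau>) 2")
        case edge: True
        then show ?thesis
          unfolding bip_weight_pair[OF uvV uv(2) True] e[symmetric] by (simp add: link_weight_def)
      next
        case False
        then have empty: "{\<omega> \<in> facets_over \<tau>. x \<in> \<omega> \<and> y \<in> \<omega>} = {}"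
          using nt \<open>x \<noteq> y\<close> unfolding link_edge_iff by blast
        show ?thesis
          unfolding bip_weight_pair[OF uvV uv(2) True] empty using False by (simp add: link_weight_def)
      qed
    next
      case False
      have "{x, y} \<notin> faces (link X \<tau>) 2"
      proof
        assume "{x, y} \<in> faces (link X \<tau>) 2"
        then obtain \<omega> where w: "x \<noteq> y" "\<omega> \<in> facets_over \<tau>" "x \<in> \<omega>" "y \<in> \<omega>"
          unfolding link_edge_iff by blast
        have "x = y" if "z \<in> V" "x \<in> S z" "y \<in> S z" for z
          using pick_eq_iff[of \<omega> z x] pick_eq_iff[of \<omega> z y] facets_overD[OF w(2)] w(3,4) that by simp
        then show False using S False w(1) uvV by blast
      qed
      then show ?thesis unfolding bip_weight_no_pair[OF uvV False] by (simp add: link_weight_def)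
    qed
  qed
  then show ?thesis unfolding lambda2_link_def N by (rule lambda2_srw_cong[OF finN])
qed

lemma empty_face: "{} \<in> X"
proof -
  obtain \<omega> where "\<omega> \<in> facets X" using set_pmf_not_empty[of \<mu>] support by auto
  then show ?thesis using face_subset[of \<omega> "{}"] by (auto simp: facets_def)
qed

lemma lambda2_pair_eq:
  assumes uv: "u \<in> V" "v \<in> V" "u \<noteq> v"
  shows "lambda2_pair S \<mu> u v = lambda2 (pick u ` facets_over {} \<union> pick v ` facets_over {})
    (srw (pick u ` facets_over {} \<union> pick v ` facets_over {})
      (bip_weight (facets_over {}) (pmf \<mu>) (pick u) (pick v)))"
proof -
  let ?N = "pick u ` facets_over {} \<union> pick v ` facets_over {}"
  have fo: "facets_over {} = facets X" by (simp add: facets_over_def)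
  have finN: "finite ?N" using weighted.fin[OF weighted_facets[of "{}"]] by simp
  \<comment> \<open>By \<open>vertices\<close> every spin lies in some face and hence in a facet;
    this makes the node sets of both graphs coincide.\<close>
  have surj: "pick z ` facets X = S z" if z: "z \<in> V" for z
  proof (intro equalityI subsetI)
    fix x assume x: "x \<in> S z"
    then obtain \<sigma> where "\<sigma> \<in> X" "x \<in> \<sigma>" using vertices z by blast
    then obtain \<omega> where "\<omega> \<in> facets X" "x \<in> \<omega>" by (metis extend_to_facet subsetD)
    then show "x \<in> pick z ` facets X" using pick_eq_iff[OF _ z x] by blast
  qed (use pick z in blast)
  have N: "pair_vertices S u v = ?N" unfolding pair_vertices_def fo using surj uv by simp
  have "pair_weight S \<mu> u v x y = bip_weight (facets_over {}) (pmf \<mu>) (pick u) (pick v) x y" for x y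
  proof (cases "x \<in> S u \<and> y \<in> S v \<or> x \<in> S v \<and> y \<in> S u")
    case True
    have "measure_pmf.prob \<mu> {\<sigma>. x \<in> \<sigma> \<and> y \<in> \<sigma>} = measure_pmf.prob \<mu> ({\<sigma>. x \<in> \<sigma> \<and> y \<in> \<sigma>} \<inter> set_pmf \<mu>)"
      by (simp add: measure_Int_set_pmf)
    also have "{\<sigma>. x \<in> \<sigma> \<and> y \<in> \<sigma>} \<inter> set_pmf \<mu> = {\<omega> \<in> facets_over {}. x \<in> \<omega> \<and> y \<in> \<omega>}"
      unfolding fo support by auto
    also have "measure_pmf.prob \<mu> \<dots> = sum (pmf \<mu>) \<dots>"
      using weighted.fin[OF weighted_facets[of "{}"]] by (intro measure_measure_pmf_finite) simp
    finally show ?thesis unfolding bip_weight_pair[OF uv True] using True by (simp add: pair_weight_def)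
  next
    case False
    then show ?thesis unfolding bip_weight_no_pair[OF uv(1,2) False] pair_weight_def by (rule if_not_P)
  qed
  then show ?thesis unfolding lambda2_pair_def N by (intro lambda2_srw_cong[OF finN])
qed

end

section \<open>The induction on the number of free sites\<close>

locale trickle_down = partite_complex V S X \<mu> + absorbing_walk V B W
  for V B :: "'v set" and S :: "'v \<Rightarrow> 'a set" and X \<mu> and W :: "'v \<Rightarrow> 'v \<Rightarrow> real" +
  assumes connected: "connected_complex V X"
    and local_bound: "\<And>\<sigma> u v. \<sigma> \<in> faces X (card V - 2) \<Longrightarrow> u \<noteq> v \<Longrightarrow> V - sites_of V S \<sigma> = {u, v} \<Longrightarrow>
           lambda2_link X \<mu> \<sigma> \<le> sqrt (W u v * W v u)"
begin

lemma two_way_nonneg: "U \<subseteq> V \<Longrightarrow> 0 \<le> two_way U u v"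
  unfolding two_way_def by (intro real_sqrt_ge_zero mult_nonneg_nonneg first_hit_nonneg finite_sites)

text \<open>The first summand in \<open>two_way_triangle\<close> is nonnegative. The result supplies
  the multiplicative triangle inequalities required for shrinking.\<close>

lemma two_way_mult_le:
  assumes "U \<subseteq> V" "u \<in> U" "v \<in> U" "w \<in> U" "u \<noteq> v" "u \<noteq> w" "v \<noteq> w"
  shows "two_way U u w * two_way U v w \<le> two_way U u v"
proof -
  have nn: "0 \<le> 1 - (two_way U x w)\<^sup>2" if "x \<in> U" "x \<noteq> w" for x
    using two_way_less_1[OF assms(1) finite_sites that(1) assms(4) that(2)] two_way_nonneg[OF assms(1)]
    by (simp add: power_le_one)
  have "0 \<le> two_way (U - {w}) u v * (sqrt (1 - (two_way U u w)\<^sup>2) * sqrt (1 - (two_way U v w)\<^sup>2))"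
    using assms nn by (intro mult_nonneg_nonneg two_way_nonneg) auto
  then show ?thesis using two_way_triangle[OF assms(1) finite_sites assms(2-7)] by linarith
qed

theorem corr_two_way:
  assumes "\<tau> \<in> X" "u \<in> free_sites \<tau>" "v \<in> free_sites \<tau>" "u \<noteq> v"
  shows "corr \<tau> u v (two_way (free_sites \<tau>) u v)"
  using assms
proof (induction "card (free_sites \<tau>)" arbitrary: \<tau> u v rule: less_induct)
  case (less \<tau> u v)
  define U where "U = free_sites \<tau>"
  have U: "U \<subseteq> V" "finite U" using finite_sites by (auto simp: U_def free_sites_def)
  interpret weighted "facets_over \<tau>" "pmf \<mu>" by (rule weighted_facets)
  have pinned: "corr (insert x \<tau>) p q (two_way (U - {w}) p q)"
    if "p \<in> U" "q \<in> U" "w \<in> U" "p \<noteq> q" "p \<noteq> w" "q \<noteq> w" "x \<in> pick w ` facets_over \<tau>" for p q w x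
  proof -
    note pin = pin_spin[OF that(3)[unfolded U_def] that(7)]
    have "card (free_sites (insert x \<tau>)) < card (free_sites \<tau>)"
      unfolding pin(3) using that(3) U by (intro card_Diff1_less) (auto simp: U_def)
    from less.hyps[OF this pin(1), of p q] show ?thesis
      using that unfolding pin(3) by (simp add: U_def)
  qed
  have r1: "two_way U p q < 1" if "p \<in> U" "q \<in> U" "p \<noteq> q" for p q
    using two_way_less_1[OF U(1) finite_sites that] .
  have r0: "0 \<le> two_way U' p q" if "U' \<subseteq> U" for p q U'
    using two_way_nonneg that U by auto
  define \<rho> where "\<rho> p q = (SOME r. max_corr (facets_over \<tau>) (pmf \<mu>) (pick p) (pick q) r)" for p q
  have \<rho>: "max_corr (facets_over \<tau>) (pmf \<mu>) (pick p) (pick q) (\<rho> p q)" for p q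
    unfolding \<rho>_def by (rule someI_ex[OF max_corr_exists])
  have \<rho>_corr: "corr \<tau> p q (\<rho> p q)" and \<rho>0: "0 \<le> \<rho> p q" for p q
    using \<rho>[of p q] unfolding max_corr_def by blast+
  have \<rho>_pair: "\<exists>f g. extremal_pair (facets_over \<tau>) (pmf \<mu>) (pick p) (pick q) (\<rho> p q) f g"
    if "0 < \<rho> p q" for p q
    using \<rho>[of p q] that unfolding max_corr_def by blast
  have \<rho>1: "\<rho> p q < 1" if pq: "p \<in> U" "q \<in> U" "p \<noteq> q" for p q
  proof (cases "0 < \<rho> p q")
    case True
    then obtain f g where fg: "extremal_pair (facets_over \<tau>) (pmf \<mu>) (pick p) (pick q) (\<rho> p q) f g"
      using \<rho>_pair[OF True] by blast
    show ?thesis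
    proof (rule max_corr_less_1[OF connected less.prems(1) _ _ pq(3) _ fg])
      fix w x assume w: "w \<in> free_sites \<tau> - {p, q}" and x: "x \<in> pick w ` facets_over \<tau>"
      have "two_way (U - {w}) p q < 1"
        by (rule two_way_less_1) (use U finite_sites pq w in auto)
      moreover have "corr (insert x \<tau>) p q (two_way (U - {w}) p q)"
        by (rule pinned) (use pq w x in \<open>auto simp: U_def\<close>)
      ultimately show "\<exists>\<beta><1. corr (insert x \<tau>) p q \<beta>" by blast
    qed (use pq in \<open>auto simp: U_def\<close>)
  qed simp
  have "\<rho> u v \<le> two_way U u v"
  proof (cases "card U = 2")
    case True
    then have Ueq: "free_sites \<tau> = {u, v}"
      using less.prems U card_seteq[of U "{u, v}"] by (auto simp: U_def)
    have uvV: "u \<in> V" "v \<in> V" using less.prems U by (auto simp: U_def)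
    have W: "W u v \<le> first_hit U v u" "W v u \<le> first_hit U u v"
      using weight_le_first_hit[OF U(1) finite_sites] less.prems by (auto simp: U_def)
    have Wnn: "0 \<le> W u v" "0 \<le> W v u" using nonneg uvV by auto
    \<comment> \<open>With two free sites the link graph is the one in the hypothesis, and the bound
      given there lies below \<open>two_way\<close> by counting one-step walks only.\<close>
    have W2: "sqrt (W u v * W v u) \<le> two_way U u v"
      unfolding two_way_def using W Wnn by (intro real_sqrt_le_mono mult_mono) auto
    show ?thesis
    proof (cases "0 < \<rho> u v")
      case True
      then obtain f g where fg: "extremal_pair (facets_over \<tau>) (pmf \<mu>) (pick u) (pick v) (\<rho> u v) f g"
        using \<rho>_pair[OF True] by blast
      interpret bipartite "facets_over \<tau>" "pmf \<mu>" "pick u" "pick v"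
        by (rule bipartite_facets) (use less.prems uvV in auto)
      have "\<rho> u v \<le> lambda2_link X \<mu> \<tau>"
        unfolding lambda2_link_eq[OF less.prems(1) Ueq less.prems(4)]
        by (rule extremal_pair_le_lambda2[OF fg]) (use \<rho>1 less.prems in \<open>auto simp: U_def\<close>)
      also have "\<dots> \<le> sqrt (W u v * W v u)"
      proof (rule local_bound)
        show "\<tau> \<in> faces X (card V - 2)"
          using card_face[OF less.prems(1)] \<open>card U = 2\<close> less.prems(1) by (auto simp: faces_def U_def)
      qed (use less.prems Ueq in \<open>auto simp: free_sites_def\<close>)
      finally show ?thesis using W2 by simp
    next
      case False
      then show ?thesis using r0[of U u v] by simp
    qed
  next
    case False
    define pairs where "pairs = {(p, q). p \<in> U \<and> q \<in> U \<and> p \<noteq> q}"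
    define R where "R = (\<lambda>(p, q). (1 - \<rho> p q) / (1 - two_way U p q))"
    have "pairs \<subseteq> U \<times> U" by (auto simp: pairs_def)
    then have finp: "finite pairs" using U(2) by (auto intro: finite_subset)
    have uvp: "(u, v) \<in> pairs" using less.prems by (auto simp: pairs_def U_def)
    \<comment> \<open>The largest shrinking factor for which every \<rho> x y is at most 1 - t (1 -
      \<open>two_way U x y\<close>). Equality holds at the minimising pair (p, q).\<close>
    define t where "t = Min (R ` pairs)"
    have "t \<in> R ` pairs" unfolding t_def using finp uvp by (intro Min_in) auto
    then obtain p q where pq: "p \<in> U" "q \<in> U" "p \<noteq> q" and tpq: "t = R (p, q)"
      by (auto simp: pairs_def)
    have bound: "\<rho> x y \<le> 1 - t * (1 - two_way U x y)" if "x \<in> U" "y \<in> U" "x \<noteq> y" for x y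
    proof -
      have "t \<le> R (x, y)" unfolding t_def using finp that by (intro Min_le) (auto simp: pairs_def)
      then show ?thesis using r1[OF that] by (simp add: R_def field_simps)
    qed
    \<comment> \<open>Positivity is where connectedness enters, through \<open>\<rho>1\<close>; at t
      = 0 the comparison below would not be strict.\<close>
    have tpos: "0 < t" using r1[OF pq] \<rho>1[OF pq] by (simp add: tpq R_def)
    have "1 \<le> t"
    proof (rule ccontr)
      assume "\<not> 1 \<le> t"
      have \<rho>pq: "\<rho> p q = 1 - t * (1 - two_way U p q)" using r1[OF pq] by (simp add: tpq R_def)
      \<comment> \<open>For t < 1 the correlation at (p, q) exceeds \<open>two_way U p q\<close>, so
        it is positive and an extremal pair exists.\<close>
      have "t * (1 - two_way U p q) < 1 * (1 - two_way U p q)"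
        using \<open>\<not> 1 \<le> t\<close> r1[OF pq] by (intro mult_strict_right_mono) auto
      then have "0 < \<rho> p q" using \<rho>pq r0[of U p q] by simp
      then obtain f g where fg: "extremal_pair (facets_over \<tau>) (pmf \<mu>) (pick p) (pick q) (\<rho> p q) f g"
        using \<rho>_pair by blast
      have "\<not> U \<subseteq> {p, q}"
      proof
        assume "U \<subseteq> {p, q}"
        then have "U = {p, q}" using pq by auto
        then show False using False pq by simp
      qed
      then obtain w where w: "w \<in> U" "p \<noteq> w" "q \<noteq> w" by auto
      define \<beta> where "\<beta> = two_way (U - {w}) p q"
      have \<beta>0: "0 \<le> \<beta>" unfolding \<beta>_def by (rule r0) auto
      have fibre: "corr_le {\<omega> \<in> facets_over \<tau>. pick w \<omega> = x} (pmf \<mu>) (pick p) (pick q) \<beta>"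
        if "x \<in> pick w ` facets_over \<tau>" for x
        using pinned[OF pq(1,2) w(1) pq(3) w(2,3) that] pin_spin(2)[OF w(1)[unfolded U_def] that]
        by (simp add: \<beta>_def)
      obtain s s' where s: "0 \<le> s" "s \<le> \<rho> p w" "0 \<le> s'" "s' \<le> \<rho> q w"
        "\<rho> p q \<le> s * s' + \<beta> * (sqrt (1 - s\<^sup>2) * sqrt (1 - s'\<^sup>2))"
        by (rule extremal_pair_via_fibres[OF \<beta>0 fibre \<rho>_corr \<rho>0 \<rho>_corr \<rho>0 fg \<open>0 < \<rho> p q\<close>])
      \<comment> \<open>The left side bounds \<rho> p q from above, whereas the right side equals
        \<rho> p q by the choice of (p, q).\<close>
      have "s * s' + \<beta> * (sqrt (1 - s\<^sup>2) * sqrt (1 - s'\<^sup>2)) < 1 - t * (1 - two_way U p q)"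
      proof (rule triangle_trickle_down[where p = "two_way U p w" and q = "two_way U q w"])
        show "two_way U p w * two_way U p q \<le> two_way U q w"
          using two_way_mult_le[OF U(1), of w q p] pq w by (simp add: two_way_sym mult.commute)
        show "two_way U q w * two_way U p q \<le> two_way U p w"
          using two_way_mult_le[OF U(1), of w p q] pq w by (simp add: two_way_sym mult.commute)
        show "\<beta> * (sqrt (1 - (two_way U p w)\<^sup>2) * sqrt (1 - (two_way U q w)\<^sup>2))
            + two_way U p w * two_way U q w \<le> two_way U p q"
          unfolding \<beta>_def by (rule two_way_triangle[OF U(1) finite_sites]) (use pq w in auto)
        show "s \<le> 1 - t * (1 - two_way U p w)" using s(2) bound[OF pq(1) w(1,2)] by simp
        show "s' \<le> 1 - t * (1 - two_way U q w)" using s(4) bound[OF pq(2) w(1,3)] by simp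
      qed (use r0[of U] r0[of "U - {w}"] r1 pq w tpos \<open>\<not> 1 \<le> t\<close> s in \<open>auto simp: \<beta>_def\<close>)
      then show False using s(5) \<rho>pq by simp
    qed
    have uvU: "u \<in> U" "v \<in> U" using less.prems by (auto simp: U_def)
    have "1 * (1 - two_way U u v) \<le> t * (1 - two_way U u v)"
      using \<open>1 \<le> t\<close> r1[OF uvU less.prems(4)] by (intro mult_right_mono) auto
    then show ?thesis using bound[OF uvU less.prems(4)] by simp
  qed
  then show ?case using corr_le_mono[OF \<rho>_corr] by (simp add: U_def)
qed

lemma lambda2_pair_le:
  assumes uv: "u \<in> V" "v \<in> V" "u \<noteq> v"
  shows "lambda2_pair S \<mu> u v \<le> sqrt (hit V B W {u} v u * hit V B W {v} u v)"
proof -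
  have free: "free_sites {} = V" by (auto simp: free_sites_def sites_of_def)
  interpret bipartite "facets_over {}" "pmf \<mu>" "pick u" "pick v"
    by (rule bipartite_facets[OF empty_face uv])
  have "corr {} u v (two_way V u v)"
    using corr_two_way[OF empty_face, of u v] uv by (simp add: free)
  then have "lambda2_pair S \<mu> u v \<le> two_way V u v"
    unfolding lambda2_pair_eq[OF uv] by (rule lambda2_le_corr) (simp add: two_way_nonneg)
  \<comment> \<open>For U = V no further sites are killed: B \<union> (V - V) is B, so
    \<open>first_hit\<close> at a different site is the original hitting sum.\<close>
  also have "\<dots> = sqrt (hit V B W {u} v u * hit V B W {v} u v)"
    using uv by (simp add: two_way_def first_hit_def mult.commute)
  finally show ?thesis .
qed

end

theorem theorem4p1:
  fixes V B :: "'v set" and S :: "'v \<Rightarrow> 'a set" and X :: "'a set set"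
    and \<mu> :: "'a set pmf" and W :: "'v \<Rightarrow> 'v \<Rightarrow> real"
  assumes "partite_complex V S X \<mu>"
    and "connected_complex V X"
    and "absorbing_walk V B W"
    and "\<And>\<sigma> u v. \<sigma> \<in> faces X (card V - 2) \<Longrightarrow> u \<noteq> v \<Longrightarrow> V - sites_of V S \<sigma> = {u, v} \<Longrightarrow>
           lambda2_link X \<mu> \<sigma> \<le> sqrt (W u v * W v u)"
  shows "\<forall>u\<in>V. \<forall>v\<in>V. u \<noteq> v \<longrightarrow>
           lambda2_pair S \<mu> u v \<le> sqrt (hit V B W {u} v u * hit V B W {v} u v)"
proof -
  interpret trickle_down V B S X \<mu> W
    using assms by (intro trickle_down.intro trickle_down_axioms.intro)
  show ?thesis using lambda2_pair_le by blast
qed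

end
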